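(* Let $\mathcal{L}(\mathbf{x},\boldsymbol{\lambda})$ be a scalar cost function of $\mathbf{x}\in\mathbb{R}^n$ and $\boldsymbol{\lambda}\in\mathbb{R}^m$, and let $\mathbf{M}_{\mathbf{x}}(\mathbf{x})$ and $\mathbf{M}_{\boldsymbol{\lambda}}(\boldsymbol{\lambda})$ be symmetric positive definite metrics on $\mathbb{R}^n$ and $\mathbb{R}^m$. Suppose $\mathcal{L}$ is geodesically strongly convex over $\mathbf{x}$ in the metric $\mathbf{M}_{\mathbf{x}}$ and geodesically concave (not necessarily strongly so) over $\boldsymbol{\lambda}$ in the metric $\mathbf{M}_{\boldsymbol{\lambda}}$. Consider the geodesic primal-dual dynamics $$\mathbf{M}_{\mathbf{x}}(\mathbf{x})\,\dot{\mathbf{x}}=-\nabla_{\mathbf{x}}\mathcal{L}(\mathbf{x},\boldsymbol{\lambda}),\qquad \mathbf{M}_{\boldsymbol{\lambda}}(\boldsymbol{\lambda})\,\dot{\boldsymbol{\lambda}}=\nabla_{\boldsymbol{\lambda}}\mathcal{L}(\mathbf{x},\boldsymbol{\lambda}),$$ and suppose also that one solution of these dynamics is bounded. Then, for any initial condition, the dynamics converge to an equilibrium $(\mathbf{x}^*,\boldsymbol{\lambda}^* )$. Moreover, $\mathbf{x}^*$ is independent of initial conditions.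
   Context: All functions are assumed sufficiently smooth that derivatives of the necessary order exist and are continuous. A metric is a matrix-valued function with symmetric positive definite values. Riemannian Hessian: for a function $f(\mathbf{x})$ and metric $\mathbf{M}(\mathbf{x})$, $H_{ij}=\frac{\partial^2 f}{\partial x_i\partial x_j}-\sum_k\Gamma_{ij}^k\frac{\partial f}{\partial x_k}$ with $\Gamma_{ij}^m=\frac12\sum_k M^{mk}\left(\frac{\partial M_{ik}}{\partial x_j}+\frac{\partial M_{jk}}{\partial x_i}-\frac{\partial M_{ij}}{\partial x_k}\right)$ and $M^{ij}=(\mathbf{M}^{-1})_{ij}$. The function $f$ is geodesically $\alpha$-strongly convex in $\mathbf{M}$ ($\alpha>0$) if $\mathbf{H}(\mathbf{x})\succeq\alpha\mathbf{M}(\mathbf{x})$ for all $\mathbf{x}$, geodesically convex if this holds with $\alpha=0$, and geodesically concave if $-f$ is geodesically convex. "$\mathcal{L}$ is geodesically strongly convex over $\mathbf{x}$" means that there is a constant $\alpha_1>0$ such that $\mathbf{x}\mapsto\mathcal{L}(\mathbf{x},\boldsymbol{\lambda})$ is geodesically $\alpha_1$-strongly convex in $\mathbf{M}_{\mathbf{x}}$ for every $\boldsymbol{\lambda}$; "geodesically concave over $\boldsymbol{\lambda}$" means that $\boldsymbol{\lambda}\mapsto\mathcal{L}(\mathbf{x},\boldsymbol{\lambda})$ is geodesically concave in $\mathbf{M}_{\boldsymbol{\lambda}}$ for every $\mathbf{x}$.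
   Formalization: The formal theorem additionally assumes that both metrics M_x and M_λ are complete (Cauchy sequences of the geodesic distance converge); without completeness the claim fails, e.g. for the flat metric of a slit plane pulled back to R^2. *)

theory Defs
  imports "HOL-Analysis.Analysis"
begin

section \<open>Smoothness and partial derivatives\<close>

definition C1_map :: "('a::real_normed_vector \<Rightarrow> 'b::real_normed_vector) \<Rightarrow> bool" where
  "C1_map f \<longleftrightarrow>
     (\<exists>f' :: 'a \<Rightarrow> 'a \<Rightarrow>\<^sub>L 'b.
        (\<forall>x. (f has_derivative blinfun_apply (f' x)) (at x)) \<and> continuous_on UNIV f')"

definition C2_map :: "('a::real_normed_vector \<Rightarrow> 'b::real_normed_vector) \<Rightarrow> bool" where
  "C2_map f \<longleftrightarrow>
     (\<exists>f' :: 'a \<Rightarrow> 'a \<Rightarrow>\<^sub>L 'b.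
        (\<forall>x. (f has_derivative blinfun_apply (f' x)) (at x)) \<and> C1_map f')"

definition partial_deriv :: "'n::finite \<Rightarrow> (real ^ 'n \<Rightarrow> real) \<Rightarrow> real ^ 'n \<Rightarrow> real" where
  "partial_deriv i f x = deriv (\<lambda>h. f (x + h *\<^sub>R axis i 1)) 0"

definition grad :: "(real ^ 'n::finite \<Rightarrow> real) \<Rightarrow> real ^ 'n \<Rightarrow> real ^ 'n" where
  "grad f x = (\<chi> i. partial_deriv i f x)"


section \<open>Riemannian metrics on Euclidean space\<close>

definition riemannian_metric :: "(real ^ 'n::finite \<Rightarrow> real ^ 'n ^ 'n) \<Rightarrow> bool" where
  "riemannian_metric M \<longleftrightarrow>
     C1_map M \<and>
     (\<forall>x. transpose (M x) = M x \<and> (\<forall>v. v \<noteq> 0 \<longrightarrow> 0 < v \<bullet> (M x *v v)))"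

definition loewner_ge :: "real ^ 'n ^ 'n::finite \<Rightarrow> real ^ 'n ^ 'n \<Rightarrow> bool" where
  "loewner_ge A B \<longleftrightarrow> (\<forall>v. 0 \<le> v \<bullet> ((A - B) *v v))"

text \<open>\<open>christoffel M m i j x\<close> is the symbol with upper index \<open>m\<close> and lower indices \<open>i j\<close>.\<close>

definition christoffel ::
    "(real ^ 'n::finite \<Rightarrow> real ^ 'n ^ 'n) \<Rightarrow> 'n \<Rightarrow> 'n \<Rightarrow> 'n \<Rightarrow> real ^ 'n \<Rightarrow> real" where
  "christoffel M m i j x =
     1 / 2 * (\<Sum>k\<in>UNIV. matrix_inv (M x) $ m $ k *
        (partial_deriv j (\<lambda>y. M y $ i $ k) x
       + partial_deriv i (\<lambda>y. M y $ j $ k) x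
       - partial_deriv k (\<lambda>y. M y $ i $ j) x))"

definition riem_hessian ::
    "(real ^ 'n::finite \<Rightarrow> real ^ 'n ^ 'n) \<Rightarrow> (real ^ 'n \<Rightarrow> real) \<Rightarrow> real ^ 'n \<Rightarrow> real ^ 'n ^ 'n" where
  "riem_hessian M f x =
     (\<chi> i j. partial_deriv i (partial_deriv j f) x
            - (\<Sum>k\<in>UNIV. christoffel M k i j x * partial_deriv k f x))"

definition geod_strongly_convex ::
    "real \<Rightarrow> (real ^ 'n::finite \<Rightarrow> real ^ 'n ^ 'n) \<Rightarrow> (real ^ 'n \<Rightarrow> real) \<Rightarrow> bool" where
  "geod_strongly_convex \<alpha> M f \<longleftrightarrow>
     \<alpha> > 0 \<and> (\<forall>x. loewner_ge (riem_hessian M f x) (\<alpha> *\<^sub>R M x))"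

definition geod_convex ::
    "(real ^ 'n::finite \<Rightarrow> real ^ 'n ^ 'n) \<Rightarrow> (real ^ 'n \<Rightarrow> real) \<Rightarrow> bool" where
  "geod_convex M f \<longleftrightarrow> (\<forall>x. loewner_ge (riem_hessian M f x) 0)"

definition geod_concave ::
    "(real ^ 'n::finite \<Rightarrow> real ^ 'n ^ 'n) \<Rightarrow> (real ^ 'n \<Rightarrow> real) \<Rightarrow> bool" where
  "geod_concave M f \<longleftrightarrow> geod_convex M (\<lambda>x. - f x)"

text \<open>
  Curves are taken \<open>C\<^sup>1\<close> on all of \<open>[0,1]\<close> rather than merely \<open>valid_path\<close>, because the speed of
  the latter may be non-integrable near a breakpoint, where \<open>integral\<close> would silently be zero.
  Piecewise \<open>C\<^sup>1\<close> curves with bounded speed give the same infimum.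
\<close>

definition riem_length :: "(real ^ 'n::finite \<Rightarrow> real ^ 'n ^ 'n) \<Rightarrow> (real \<Rightarrow> real ^ 'n) \<Rightarrow> real" where
  "riem_length M \<gamma> =
     integral {0..1} (\<lambda>t. sqrt (vector_derivative \<gamma> (at t) \<bullet> (M (\<gamma> t) *v vector_derivative \<gamma> (at t))))"

definition riem_dist :: "(real ^ 'n::finite \<Rightarrow> real ^ 'n ^ 'n) \<Rightarrow> real ^ 'n \<Rightarrow> real ^ 'n \<Rightarrow> real" where
  "riem_dist M x y =
     (INF \<gamma>\<in>{\<gamma>. \<gamma> C1_differentiable_on {0..1} \<and> \<gamma> 0 = x \<and> \<gamma> 1 = y}. riem_length M \<gamma>)"

text \<open>
  Completeness of the geodesic distance. That distance induces the Euclidean topology, so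
  \<open>convergent\<close> below may be read in either sense. Being a metric does not include completeness;
  convergence of the primal-dual dynamics needs it as a separate hypothesis: on a slit plane with
  its flat metric, a bounded solution can coexist with solutions that run into the slit.
\<close>

definition complete_metric :: "(real ^ 'n::finite \<Rightarrow> real ^ 'n ^ 'n) \<Rightarrow> bool" where
  "complete_metric M \<longleftrightarrow>
     (\<forall>X :: nat \<Rightarrow> real ^ 'n.
        (\<forall>e>0. \<exists>N. \<forall>i\<ge>N. \<forall>j\<ge>N. riem_dist M (X i) (X j) < e) \<longrightarrow> convergent X)"


section \<open>Geodesic primal-dual dynamics\<close>

text \<open>The velocity \<open>(x', l')\<close> satisfies the (implicit) equations of motion at the state \<open>(x, l)\<close>.\<close>

definition primal_dual_velocity ::
    "(real ^ 'n::finite \<Rightarrow> real ^ 'm::finite \<Rightarrow> real) \<Rightarrow> (real ^ 'n \<Rightarrow> real ^ 'n ^ 'n) \<Rightarrow>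
     (real ^ 'm \<Rightarrow> real ^ 'm ^ 'm) \<Rightarrow> real ^ 'n \<Rightarrow> real ^ 'm \<Rightarrow> real ^ 'n \<Rightarrow> real ^ 'm \<Rightarrow> bool" where
  "primal_dual_velocity L Mx Ml x l x' l' \<longleftrightarrow>
     Mx x *v x' = - grad (\<lambda>y. L y l) x \<and> Ml l *v l' = grad (\<lambda>k. L x k) l"

definition primal_dual_solution ::
    "(real ^ 'n::finite \<Rightarrow> real ^ 'm::finite \<Rightarrow> real) \<Rightarrow> (real ^ 'n \<Rightarrow> real ^ 'n ^ 'n) \<Rightarrow>
     (real ^ 'm \<Rightarrow> real ^ 'm ^ 'm) \<Rightarrow> (real \<Rightarrow> real ^ 'n) \<Rightarrow> (real \<Rightarrow> real ^ 'm) \<Rightarrow> bool" where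
  "primal_dual_solution L Mx Ml x l \<longleftrightarrow>
     (\<forall>t\<ge>0. \<exists>x' l'.
        (x has_vector_derivative x') (at t within {0..}) \<and>
        (l has_vector_derivative l') (at t within {0..}) \<and>
        primal_dual_velocity L Mx Ml (x t) (l t) x' l')"

definition primal_dual_equilibrium ::
    "(real ^ 'n::finite \<Rightarrow> real ^ 'm::finite \<Rightarrow> real) \<Rightarrow> (real ^ 'n \<Rightarrow> real ^ 'n ^ 'n) \<Rightarrow>
     (real ^ 'm \<Rightarrow> real ^ 'm ^ 'm) \<Rightarrow> real ^ 'n \<Rightarrow> real ^ 'm \<Rightarrow> bool" where
  "primal_dual_equilibrium L Mx Ml x l \<longleftrightarrow> primal_dual_velocity L Mx Ml x l 0 0"

end

theory Submission
  imports Defs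
begin

text \<open>
  Write the dynamics as \<open>z' = F z\<close> for \<open>z = (x, l)\<close> in the product metric. For a variation \<open>v\<close> of \<open>z\<close>, the
  derivative of \<open>\<bar>v\<bar>\<^sup>2\<close> along the flow is \<open>- 2 H_x(v_x, v_x) + 2 H_l(v_l, v_l)\<close>, where \<open>H\<close> are the Riemannian
  Hessians: the mixed second derivatives of \<open>L\<close> cancel. Hence it is at most \<open>- 2 \<alpha> \<bar>v_x\<bar>\<^sup>2\<close>, and the
  geodesic distance to an equilibrium does not increase. To avoid differentiating the flow in its initial
  value, this is shown by moving nearly minimal curves by one Euler step; the error is uniform since
  bounded sets of a complete metric are relatively compact (Hopf-Rinow).

  Applied to \<open>v = F z\<close>, the same estimate shows that \<open>V = \<bar>F z\<bar>\<^sup>2\<close> satisfies \<open>(L - V / \<alpha>)' \<ge> V\<close>, so on a bounded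
  solution \<open>V\<close> is not bounded away from 0 and an equilibrium \<open>e\<close> lies in the closure of its orbit. Then every
  solution stays at bounded distance from \<open>e\<close>, hence is global and bounded, hence accumulates at an
  equilibrium, to which it converges because its distance to it does not increase. Two equilibria with
  different \<open>x\<close> would get strictly closer under the flow, which fixes both.
\<close>

section \<open>Continuously differentiable maps\<close>

text \<open>No geodesic is ever constructed. For a metric that is only continuously differentiable
  the Christoffel symbols are merely continuous, so the geodesic equation need not determine its
  solutions; curves with length close to the infimum take the place of minimizers. Concavity in
  \<open>l\<close> without strictness makes the contraction degenerate: only the norm of
  \<open>v_x\<close>, called \<open>p\<close> below, is controlled, so the distance to an
  equilibrium need not decay and convergence must have another source. That source is the cost
  itself. Since \<open>x\<close> descends and \<open>l\<close> ascends, its derivative along a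
  solution is \<open>\<bar>l'\<bar>\<^sup>2 - \<bar>x'\<bar>\<^sup>2 = V - 2
  \<bar>x'\<bar>\<^sup>2\<close>, while \<open>V' \<le> - 2 \<alpha> \<bar>x'\<bar>\<^sup>2\<close>;
  in \<open>L - V / \<alpha>\<close> the negative term cancels. For two equilibria the degeneracy is
  overcome by integration: along every curve between them the integral of \<open>p\<close> is
  bounded below in terms of the gap in \<open>x\<close>, however the motion in \<open>x\<close> is
  spread over the curve, and this yields a fixed gain per Euler step.\<close>

lemma C1_mapI:
  fixes f :: "'a::euclidean_space \<Rightarrow> 'b::real_normed_vector"
  assumes d: "\<And>x. (f has_derivative f' x) (at x)" and c: "\<And>v. continuous_on UNIV (\<lambda>x. f' x v)"
  shows "C1_map f"
  unfolding C1_map_def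
proof (intro exI conjI allI)
  have bl: "blinfun_apply (Blinfun (f' x)) = f' x" for x
    using d has_derivative_bounded_linear by (blast intro: bounded_linear_Blinfun_apply)
  show "(f has_derivative blinfun_apply (Blinfun (f' x))) (at x)" for x
    using d by (simp add: bl)
  \<comment> \<open>On a finite-dimensional domain, operator-norm continuity can be tested on one
    vector at a time.\<close>
  show "continuous_on UNIV (\<lambda>x. Blinfun (f' x))"
    by (rule continuous_on_blinfun_componentwise) (simp add: bl c)
qed

lemma C1_mapE:
  assumes "C1_map f"
  obtains f' where "\<And>x. (f has_derivative blinfun_apply (f' x)) (at x)" "continuous_on UNIV f'"
  using assms unfolding C1_map_def by blast

lemma C1_map_continuous: "C1_map f \<Longrightarrow> continuous_on UNIV f"
  unfolding C1_map_def by (meson continuous_at_imp_continuous_on has_derivative_continuous)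

lemma C1_map_bounded_linear:
  fixes f :: "'a::euclidean_space \<Rightarrow> 'b::real_normed_vector"
  shows "bounded_linear f \<Longrightarrow> C1_map f"
  by (rule C1_mapI[where f'="\<lambda>_. f"]) (simp_all add: bounded_linear_imp_has_derivative)

lemma C1_map_const: "C1_map (\<lambda>_ :: 'a::euclidean_space. c)"
  by (rule C1_mapI[where f'="\<lambda>_ _. 0"]) simp_all

lemma C1_map_compose:
  fixes f :: "'a::euclidean_space \<Rightarrow> 'b::real_normed_vector"
  assumes "C1_map f" "C1_map g"
  shows "C1_map (\<lambda>x. g (f x))"
proof -
  obtain f' where f: "\<And>x. (f has_derivative blinfun_apply (f' x)) (at x)" "continuous_on UNIV f'"
    using assms(1) by (rule C1_mapE) blast
  obtain g' where g: "\<And>x. (g has_derivative blinfun_apply (g' x)) (at x)" "continuous_on UNIV g'"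
    using assms(2) by (rule C1_mapE) blast
  have "continuous_on UNIV (\<lambda>x. g' (f x))"
    by (rule continuous_on_compose2[OF g(2) C1_map_continuous[OF assms(1)]]) simp
  then have "continuous_on UNIV (\<lambda>x. blinfun_apply (g' (f x)) (blinfun_apply (f' x) v))" for v
    by (intro continuous_intros f(2))
  then show ?thesis
    by (rule C1_mapI[where f'="\<lambda>x v. g' (f x) (f' x v)", OF has_derivative_compose[OF f(1) g(1)]])
qed

lemma (in bounded_bilinear) C1_map:
  fixes f :: "'d::euclidean_space \<Rightarrow> 'a" and g :: "'d \<Rightarrow> 'b"
  assumes "C1_map f" "C1_map g"
  shows "C1_map (\<lambda>x. f x ** g x)"
proof -
  obtain f' where f: "\<And>x. (f has_derivative blinfun_apply (f' x)) (at x)" "continuous_on UNIV f'"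
    using assms(1) by (rule C1_mapE) blast
  obtain g' where g: "\<And>x. (g has_derivative blinfun_apply (g' x)) (at x)" "continuous_on UNIV g'"
    using assms(2) by (rule C1_mapE) blast
  have "continuous_on UNIV (\<lambda>x. f x ** blinfun_apply (g' x) v + blinfun_apply (f' x) v ** g x)" for v
    by (intro continuous_on_add continuous_on continuous_intros C1_map_continuous[OF assms(1)]
        C1_map_continuous[OF assms(2)] f(2) g(2))
  then show ?thesis
    by (intro C1_mapI[where f'="\<lambda>x v. f x ** g' x v + f' x v ** g x"] FDERIV f g) auto
qed

lemma C1_map_Pair:
  fixes f :: "'a::euclidean_space \<Rightarrow> 'b::real_normed_vector" and g :: "'a \<Rightarrow> 'c::real_normed_vector"
  assumes "C1_map f" "C1_map g"
  shows "C1_map (\<lambda>x. (f x, g x))"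
proof -
  obtain f' where f: "\<And>x. (f has_derivative blinfun_apply (f' x)) (at x)" "continuous_on UNIV f'"
    using assms(1) by (rule C1_mapE) blast
  obtain g' where g: "\<And>x. (g has_derivative blinfun_apply (g' x)) (at x)" "continuous_on UNIV g'"
    using assms(2) by (rule C1_mapE) blast
  have "continuous_on UNIV (\<lambda>x. (blinfun_apply (f' x) v, blinfun_apply (g' x) v))" for v
    by (intro continuous_intros f(2) g(2))
  then show ?thesis
    by (intro C1_mapI[where f'="\<lambda>x v. (f' x v, g' x v)"] has_derivative_Pair f g) auto
qed

lemma C1_map_add:
  fixes f g :: "'a::euclidean_space \<Rightarrow> 'b::real_normed_vector"
  assumes "C1_map f" "C1_map g"
  shows "C1_map (\<lambda>x. f x + g x)"
proof -
  obtain f' where f: "\<And>x. (f has_derivative blinfun_apply (f' x)) (at x)" "continuous_on UNIV f'"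
    using assms(1) by (rule C1_mapE) blast
  obtain g' where g: "\<And>x. (g has_derivative blinfun_apply (g' x)) (at x)" "continuous_on UNIV g'"
    using assms(2) by (rule C1_mapE) blast
  have "continuous_on UNIV (\<lambda>x. blinfun_apply (f' x) v + blinfun_apply (g' x) v)" for v
    by (intro continuous_intros f(2) g(2))
  then show ?thesis
    by (intro C1_mapI[where f'="\<lambda>x v. f' x v + g' x v"] has_derivative_add f g) auto
qed

lemma C1_map_linear_compose:
  fixes f :: "'a::euclidean_space \<Rightarrow> 'b::real_normed_vector"
  assumes "bounded_linear h" "C1_map f"
  shows "C1_map (\<lambda>x. h (f x))"
proof -
  obtain f' where f: "\<And>x. (f has_derivative blinfun_apply (f' x)) (at x)" "continuous_on UNIV f'"
    using assms(2) by (rule C1_mapE) blast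
  have "continuous_on UNIV (\<lambda>x. h (blinfun_apply (f' x) v))" for v
    by (intro bounded_linear.continuous_on[OF assms(1)] continuous_intros f(2))
  then show ?thesis
    by (intro C1_mapI[where f'="\<lambda>x v. h (f' x v)"] bounded_linear.has_derivative[OF assms(1)] f) auto
qed

lemma C1_map_sum:
  fixes f :: "'i \<Rightarrow> 'a::euclidean_space \<Rightarrow> 'b::real_normed_vector"
  assumes "\<And>i. i \<in> I \<Longrightarrow> C1_map (f i)"
  shows "C1_map (\<lambda>x. \<Sum>i\<in>I. f i x)"
  using assms by (induction I rule: infinite_finite_induct) (auto intro: C1_map_const C1_map_add)

lemma C1_map_prod:
  fixes f :: "'i \<Rightarrow> 'a::euclidean_space \<Rightarrow> real"
  assumes "\<And>i. i \<in> I \<Longrightarrow> C1_map (f i)"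
  shows "C1_map (\<lambda>x. \<Prod>i\<in>I. f i x)"
  using assms by (induction I rule: infinite_finite_induct)
    (auto intro: C1_map_const bounded_bilinear.C1_map[OF bounded_bilinear_mult])

lemma C1_map_inverse:
  fixes f :: "'a::euclidean_space \<Rightarrow> real"
  assumes "C1_map f" and nz: "\<And>x. f x \<noteq> 0"
  shows "C1_map (\<lambda>x. inverse (f x))"
proof -
  obtain f' where f: "\<And>x. (f has_derivative blinfun_apply (f' x)) (at x)" "continuous_on UNIV f'"
    using assms(1) by (rule C1_mapE) blast
  have "continuous_on UNIV (\<lambda>x. - (inverse (f x) * blinfun_apply (f' x) v * inverse (f x)))" for v
    by (intro continuous_intros f(2) C1_map_continuous[OF assms(1)] ballI nz)
  then show ?thesis
    by (intro C1_mapI[where f'="\<lambda>x v. - (inverse (f x) * f' x v * inverse (f x))"] Deriv.has_derivative_inverse f nz)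
qed

lemma C1_map_vec_nth:
  fixes f :: "'a::euclidean_space \<Rightarrow> 'b::real_normed_vector ^ 'n"
  shows "C1_map f \<Longrightarrow> C1_map (\<lambda>x. f x $ i)"
  by (rule C1_map_linear_compose[OF bounded_linear_vec_nth])

lemma C1_map_vec:
  fixes f :: "'a::euclidean_space \<Rightarrow> real ^ 'n"
  assumes "\<And>i. C1_map (\<lambda>x. f x $ i)"
  shows "C1_map f"
proof -
  have "C1_map (\<lambda>x. \<Sum>i\<in>UNIV. f x $ i *\<^sub>R axis i (1::real))"
    by (intro C1_map_sum bounded_bilinear.C1_map[OF bounded_bilinear_scaleR] assms C1_map_const)
  also have "(\<lambda>x. \<Sum>i\<in>UNIV. f x $ i *\<^sub>R axis i (1::real)) = f"
    using basis_expansion[of "f _"] by (simp add: scalar_mult_eq_scaleR)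
  finally show ?thesis .
qed

section \<open>Determinants and inverse matrices\<close>

lemma C1_map_det:
  fixes A :: "'a::euclidean_space \<Rightarrow> real ^ 'n ^ 'n"
  assumes "\<And>i j. C1_map (\<lambda>x. A x $ i $ j)"
  shows "C1_map (\<lambda>x. det (A x))"
  unfolding det_def
  by (intro C1_map_sum bounded_bilinear.C1_map[OF bounded_bilinear_mult] C1_map_const C1_map_prod assms)

lemma matrix_inv_mult:
  fixes A :: "real ^ 'n ^ 'n"
  assumes "invertible A"
  shows "A ** matrix_inv A = mat 1" "matrix_inv A ** A = mat 1"
  using someI_ex[OF assms[unfolded invertible_def]] unfolding matrix_inv_def by auto

lemma matrix_inv_vector_mult_eq:
  fixes A :: "real ^ 'n ^ 'n"
  assumes "invertible A"
  shows "A *v x = b \<longleftrightarrow> x = matrix_inv A *v b"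
  using matrix_inv_mult[OF assms]
  by (metis matrix_vector_mul_assoc matrix_vector_mul_lid)

text \<open>By Cramer's rule each entry is a quotient of determinants whose denominator
  \<open>det (A x)\<close> never vanishes. This is what makes the velocity field of the implicit
  equations continuously differentiable.\<close>

lemma C1_map_matrix_inv_vector_mult:
  fixes A :: "'a::euclidean_space \<Rightarrow> real ^ 'n ^ 'n"
  assumes "C1_map A" "C1_map g" and inv: "\<And>x. invertible (A x)"
  shows "C1_map (\<lambda>x. matrix_inv (A x) *v g x)"
proof -
  have nz: "det (A x) \<noteq> 0" for x using inv invertible_det_nz by blast
  have comp: "C1_map (\<lambda>x. A x $ i $ j)" for i j by (intro C1_map_vec_nth assms)
  have "matrix_inv (A x) *v g x
    = (\<chi> k. det (\<chi> i j. if j = k then g x $ i else A x $ i $ j) / det (A x))" for x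
    using cramer[OF nz[of x], of "matrix_inv (A x) *v g x" "g x"] matrix_inv_vector_mult_eq[OF inv[of x]] by simp
  then have e: "(matrix_inv (A x) *v g x) $ k
    = det (\<chi> i j. if j = k then g x $ i else A x $ i $ j) * inverse (det (A x))" for x k
    by (simp add: divide_inverse)
  have "C1_map (\<lambda>x. (\<chi> i j. if j = k then g x $ i else A x $ i $ j) $ i $ j)" for i j k
    by (cases "j = k") (simp_all add: comp C1_map_vec_nth assms)
  then show ?thesis
    by (intro C1_map_vec) (unfold e, intro bounded_bilinear.C1_map[OF bounded_bilinear_mult] C1_map_inverse
        C1_map_det comp nz)
qed

section \<open>Symmetry of mixed second derivatives\<close>

lemma second_difference_mean_value:
  fixes f :: "'a::real_normed_vector \<Rightarrow> real"
  assumes f: "\<And>x. (f has_derivative blinfun_apply (f' x)) (at x)"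
    and f': "\<And>x. (f' has_derivative f'' x) (at x)" and "0 < h"
  shows "\<exists>a. dist a z \<le> h * (norm u + norm v) \<and>
    f (z + h *\<^sub>R u + h *\<^sub>R v) - f (z + h *\<^sub>R u) - f (z + h *\<^sub>R v) + f z = h * h * blinfun_apply (f'' a v) u"
proof -
  \<comment> \<open>The first difference in direction \<open>v\<close>, viewed along
    \<open>u\<close>. One mean value theorem here and another for \<open>?m\<close> along
    \<open>v\<close> turn the second difference into \<open>f''\<close> at a single point.\<close>
  let ?k = "\<lambda>s. f (z + s *\<^sub>R u + h *\<^sub>R v) - f (z + s *\<^sub>R u)"
  have "(?k has_real_derivative blinfun_apply (f' (z + s *\<^sub>R u + h *\<^sub>R v)) u - blinfun_apply (f' (z + s *\<^sub>R u)) u) (at s)" for s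
    unfolding has_field_derivative_def
    by (rule derivative_eq_intros has_derivative_compose[OF _ f] refl)+
      (auto simp: blinfun.bilinear_simps algebra_simps)
  then obtain s where s: "0 < s" "s < h"
    "?k h - ?k 0 = (h - 0) * (blinfun_apply (f' (z + s *\<^sub>R u + h *\<^sub>R v)) u - blinfun_apply (f' (z + s *\<^sub>R u)) u)"
    using MVT2[OF \<open>0 < h\<close>, of ?k "\<lambda>s. f' (z + s *\<^sub>R u + h *\<^sub>R v) u - f' (z + s *\<^sub>R u) u"] by blast
  let ?m = "\<lambda>t. blinfun_apply (f' (z + s *\<^sub>R u + t *\<^sub>R v)) u"
  have lin: "linear (f'' x)" for x using f' has_derivative_linear by blast
  have "(?m has_real_derivative blinfun_apply (f'' (z + s *\<^sub>R u + t *\<^sub>R v) v) u) (at t)" for t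
    unfolding has_field_derivative_def
    by (rule derivative_eq_intros has_derivative_compose[OF _ f'] refl)+
      (auto simp: blinfun.bilinear_simps linear_cmul[OF lin] mult.commute)
  then obtain t where t: "0 < t" "t < h"
    "?m h - ?m 0 = (h - 0) * blinfun_apply (f'' (z + s *\<^sub>R u + t *\<^sub>R v) v) u"
    using MVT2[OF \<open>0 < h\<close>, of ?m "\<lambda>t. f'' (z + s *\<^sub>R u + t *\<^sub>R v) v u"] by blast
  have "dist (z + s *\<^sub>R u + t *\<^sub>R v) z \<le> s * norm u + t * norm v"
    using s t norm_triangle_ineq[of "s *\<^sub>R u" "t *\<^sub>R v"] by (simp add: dist_norm algebra_simps)
  also have "\<dots> \<le> h * (norm u + norm v)"
    using s t by (simp add: distrib_left add_mono mult_right_mono)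
  finally show ?thesis using s(3) t(3) by (intro exI[of _ "z + s *\<^sub>R u + t *\<^sub>R v"]) simp
qed

text \<open>The second difference does not change when \<open>u\<close> and \<open>v\<close> are
  exchanged. Evaluating it in both orders gives two points near \<open>z\<close> with equal mixed
  derivatives, and shrinking the step brings both points to \<open>z\<close>.\<close>

lemma second_derivative_symmetric:
  fixes f :: "'a::real_normed_vector \<Rightarrow> real"
  assumes f: "\<And>x. (f has_derivative blinfun_apply (f' x)) (at x)"
    and f': "\<And>x. (f' has_derivative blinfun_apply (f'' x)) (at x)" and f'': "continuous_on UNIV f''"
  shows "blinfun_apply (blinfun_apply (f'' z) v) u = blinfun_apply (blinfun_apply (f'' z) u) v"
proof -
  let ?h = "\<lambda>n. inverse (real (Suc n))"
  let ?r = "norm u + norm v"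
  have "\<exists>a b. dist a z \<le> ?h n * ?r \<and> dist b z \<le> ?h n * ?r \<and>
    blinfun_apply (blinfun_apply (f'' a) v) u = blinfun_apply (blinfun_apply (f'' b) u) v" for n
  proof -
    have p: "0 < ?h n" by simp
    obtain a where a: "dist a z \<le> ?h n * ?r"
      "f (z + ?h n *\<^sub>R u + ?h n *\<^sub>R v) - f (z + ?h n *\<^sub>R u) - f (z + ?h n *\<^sub>R v) + f z
         = ?h n * ?h n * blinfun_apply (blinfun_apply (f'' a) v) u"
      using second_difference_mean_value[OF f f' p] by blast
    obtain b where b: "dist b z \<le> ?h n * (norm v + norm u)"
      "f (z + ?h n *\<^sub>R v + ?h n *\<^sub>R u) - f (z + ?h n *\<^sub>R v) - f (z + ?h n *\<^sub>R u) + f z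
         = ?h n * ?h n * blinfun_apply (blinfun_apply (f'' b) u) v"
      using second_difference_mean_value[OF f f' p] by blast
    have "f (z + ?h n *\<^sub>R v + ?h n *\<^sub>R u) = f (z + ?h n *\<^sub>R u + ?h n *\<^sub>R v)"
      by (simp only: add.assoc add.commute[of "?h n *\<^sub>R v"])
    then have "?h n * ?h n * blinfun_apply (blinfun_apply (f'' a) v) u
      = ?h n * ?h n * blinfun_apply (blinfun_apply (f'' b) u) v"
      unfolding a(2)[symmetric] b(2)[symmetric] by linarith
    then show ?thesis using a(1) b(1) p
      by (intro exI[of _ a] exI[of _ b]) (simp add: add.commute)
  qed
  then obtain a b where ab: "\<And>n. dist (a n) z \<le> ?h n * ?r" "\<And>n. dist (b n) z \<le> ?h n * ?r"
    "\<And>n. blinfun_apply (blinfun_apply (f'' (a n)) v) u = blinfun_apply (blinfun_apply (f'' (b n)) u) v" by metis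
  have h0: "(\<lambda>n. ?h n * ?r) \<longlonglongrightarrow> 0"
    using tendsto_mult_right[OF LIMSEQ_inverse_real_of_nat, of ?r] by simp
  have lim: "c \<longlonglongrightarrow> z" if "\<And>n. dist (c n) z \<le> ?h n * ?r" for c
  proof (rule tendsto_dist_iff[THEN iffD2], rule Lim_null_comparison[OF _ h0])
    show "\<forall>\<^sub>F n in sequentially. norm (dist (c n) z) \<le> ?h n * ?r"
      using that by (intro always_eventually) simp
  qed
  have lim': "(\<lambda>n. blinfun_apply (blinfun_apply (f'' (c n)) x) y) \<longlonglongrightarrow> blinfun_apply (blinfun_apply (f'' z) x) y"
    if "c \<longlonglongrightarrow> z" for c x y
    by (intro tendsto_intros continuous_on_tendsto_compose[OF f'' that]) auto
  show ?thesis
    using LIMSEQ_unique[OF lim'[OF lim[OF ab(1)], of v u]] lim'[OF lim[OF ab(2)], of u v] unfolding ab(3) by blast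
qed

section \<open>Curves and the induced distance\<close>

text \<open>The derivative is an explicit companion \<open>g'\<close>, so lengths are computed
  without choosing one. Differentiability is two-sided even at the endpoints, in agreement with
  \<open>C1_differentiable_on\<close>, over which \<open>riem_dist\<close> takes its
  infimum.\<close>

definition C1_curve :: "real \<Rightarrow> real \<Rightarrow> (real \<Rightarrow> 'a::real_normed_vector) \<Rightarrow> (real \<Rightarrow> 'a) \<Rightarrow> bool" where
  "C1_curve a b g g' \<longleftrightarrow> a \<le> b \<and> (\<forall>t\<in>{a..b}. (g has_vector_derivative g' t) (at t)) \<and> continuous_on {a..b} g'"

lemma C1_curve_le: "C1_curve a b g g' \<Longrightarrow> a \<le> b"
  by (simp add: C1_curve_def)

lemma C1_curve_deriv: "C1_curve a b g g' \<Longrightarrow> a \<le> t \<Longrightarrow> t \<le> b \<Longrightarrow> (g has_vector_derivative g' t) (at t)"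
  by (simp add: C1_curve_def)

lemma C1_curve_cont_deriv: "C1_curve a b g g' \<Longrightarrow> continuous_on {a..b} g'"
  by (simp add: C1_curve_def)

lemma C1_curve_cont: "C1_curve a b g g' \<Longrightarrow> continuous_on {a..b} g"
  unfolding C1_curve_def
  by (meson continuous_at_imp_continuous_on has_vector_derivative_continuous)

lemma C1_curve_subinterval: "C1_curve a b g g' \<Longrightarrow> a \<le> s \<Longrightarrow> s \<le> t \<Longrightarrow> t \<le> b \<Longrightarrow> C1_curve s t g g'"
  unfolding C1_curve_def by (auto elim: continuous_on_subset)

lemma C1_curve_segment: "C1_curve 0 1 (\<lambda>t. p + t *\<^sub>R (q - p)) (\<lambda>t. q - p)"
  unfolding C1_curve_def by (auto intro!: derivative_eq_intros continuous_intros)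

lemma C1_curve_reparametrize:
  assumes g: "C1_curve c d g g'" and "a \<le> b"
    and \<phi>: "\<And>t. t \<in> {a..b} \<Longrightarrow> (\<phi> has_real_derivative \<phi>' t) (at t)" "continuous_on {a..b} \<phi>'"
    and im: "\<phi> ` {a..b} \<subseteq> {c..d}"
  shows "C1_curve a b (g \<circ> \<phi>) (\<lambda>t. \<phi>' t *\<^sub>R g' (\<phi> t))"
proof -
  have c\<phi>: "continuous_on {a..b} \<phi>"
    using \<phi>(1) by (meson DERIV_isCont continuous_at_imp_continuous_on)
  have "((g \<circ> \<phi>) has_vector_derivative \<phi>' t *\<^sub>R g' (\<phi> t)) (at t)" if "t \<in> {a..b}" for t
  proof (rule vector_diff_chain_at)
    show "(\<phi> has_vector_derivative \<phi>' t) (at t)"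
      using \<phi>(1)[OF that] by (simp add: has_real_derivative_iff_has_vector_derivative)
    have "\<phi> t \<in> {c..d}" using that im by blast
    then show "(g has_vector_derivative g' (\<phi> t)) (at (\<phi> t))"
      by (intro C1_curve_deriv[OF g]) auto
  qed
  moreover have "continuous_on {a..b} (\<lambda>t. \<phi>' t *\<^sub>R g' (\<phi> t))"
    by (intro continuous_on_scaleR \<phi>(2) continuous_on_compose2[OF C1_curve_cont_deriv[OF g] c\<phi> im])
  ultimately show ?thesis using \<open>a \<le> b\<close> by (simp add: C1_curve_def)
qed

text \<open>A reversible speed on tangent vectors in the manner of a Finsler structure. Absolute
  homogeneity makes length invariant under reparametrization and reversal; continuity and positivity
  make it comparable with Euclidean length on compact sets.\<close>

locale speed_structure =
  fixes N :: "'a::euclidean_space \<Rightarrow> 'a \<Rightarrow> real"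
  assumes N_cont: "continuous_on UNIV (\<lambda>(z, v). N z v)"
    and N_pos: "\<And>z v. v \<noteq> 0 \<Longrightarrow> 0 < N z v"
    and N_scale: "\<And>z c v. N z (c *\<^sub>R v) = \<bar>c\<bar> * N z v"
begin

lemma N_zero [simp]: "N z 0 = 0"
  using N_scale[of z 0 0] by simp

lemma N_nonneg: "0 \<le> N z v"
  using N_pos[of v z] by (cases "v = 0") auto

lemma N_minus [simp]: "N z (- v) = N z v"
  using N_scale[of z "-1" v] by simp

lemma continuous_on_N:
  "continuous_on S f \<Longrightarrow> continuous_on S g \<Longrightarrow> continuous_on S (\<lambda>t. N (f t) (g t))"
  using continuous_on_compose2[OF N_cont, of S "\<lambda>t. (f t, g t)"] by (auto intro: continuous_intros)

lemma N_equivalent: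
  assumes "compact K"
  obtains c C where "0 < c" "0 < C" "\<And>z v. z \<in> K \<Longrightarrow> c * norm v \<le> N z v" "\<And>z v. z \<in> K \<Longrightarrow> N z v \<le> C * norm v"
proof (cases "K = {}")
  case True
  then show ?thesis using that[of 1 1] by auto
next
  case False
  let ?S = "K \<times> sphere (0::'a) 1"
  have S: "compact ?S" by (intro compact_Times assms compact_sphere)
  have "sphere (0::'a) 1 \<noteq> {}" by simp
  then have ne: "?S \<noteq> {}" using False by blast
  have cont: "continuous_on ?S (\<lambda>(z, v). N z v)"
    using N_cont continuous_on_subset by blast
  obtain m where m: "m \<in> ?S" "\<forall>y\<in>?S. (\<lambda>(z, v). N z v) m \<le> (\<lambda>(z, v). N z v) y"
    using continuous_attains_inf[OF S ne cont] by blast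
  obtain M where M: "M \<in> ?S" "\<forall>y\<in>?S. (\<lambda>(z, v). N z v) y \<le> (\<lambda>(z, v). N z v) M"
    using continuous_attains_sup[OF S ne cont] by blast
  let ?c = "N (fst m) (snd m)" and ?C = "N (fst M) (snd M)"
  have unit: "?c \<le> N z v \<and> N z v \<le> ?C" if "z \<in> K" "norm v = 1" for z v
    using m(2) M(2) that by (auto simp: split_beta)
  have "?c * norm v \<le> N z v \<and> N z v \<le> ?C * norm v" if z: "z \<in> K" for z v
  proof (cases "v = 0")
    case False
    have e: "N z v = norm v * N z ((1 / norm v) *\<^sub>R v)" using False by (simp add: N_scale)
    have "?c \<le> N z ((1 / norm v) *\<^sub>R v)" "N z ((1 / norm v) *\<^sub>R v) \<le> ?C"
      using unit[OF z, of "(1 / norm v) *\<^sub>R v"] False by auto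
    then show ?thesis unfolding e using False by (simp add: mult.commute)
  qed simp
  moreover have "0 < ?c" "0 < ?C"
    using m(1) M(1) by (auto intro!: N_pos)
  ultimately show ?thesis using that by blast
qed

definition len :: "real \<Rightarrow> real \<Rightarrow> (real \<Rightarrow> 'a) \<Rightarrow> (real \<Rightarrow> 'a) \<Rightarrow> real" where
  "len a b g g' = integral {a..b} (\<lambda>t. N (g t) (g' t))"

definition dst :: "'a \<Rightarrow> 'a \<Rightarrow> real" where
  "dst p q = Inf {len 0 1 g g' | g g'. C1_curve 0 1 g g' \<and> g 0 = p \<and> g 1 = q}"

lemma speed_cont: "C1_curve a b g g' \<Longrightarrow> continuous_on {a..b} (\<lambda>t. N (g t) (g' t))"
  by (intro continuous_on_N C1_curve_cont C1_curve_cont_deriv)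

lemma speed_integrable: "C1_curve a b g g' \<Longrightarrow> (\<lambda>t. N (g t) (g' t)) integrable_on {a..b}"
  by (intro integrable_continuous_real speed_cont)

lemma len_nonneg: "0 \<le> len a b g g'"
  unfolding len_def
  by (cases "(\<lambda>t. N (g t) (g' t)) integrable_on {a..b}")
    (auto intro!: integral_nonneg simp: N_nonneg not_integrable_integral)

lemma len_split: "C1_curve a b g g' \<Longrightarrow> a \<le> c \<Longrightarrow> c \<le> b \<Longrightarrow> len a b g g' = len a c g g' + len c b g g'"
  unfolding len_def by (simp add: Henstock_Kurzweil_Integration.integral_combine speed_integrable)

text \<open>Substitution in the length integral. The derivative of \<open>\<phi>\<close> may vanish,
  which allows two curves to be joined with speed zero at the joint.\<close>

lemma len_reparametrize:
  assumes g: "C1_curve c d g g'" and "a \<le> b"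
    and \<phi>: "\<And>t. t \<in> {a..b} \<Longrightarrow> (\<phi> has_real_derivative \<phi>' t) (at t)" "\<And>t. t \<in> {a..b} \<Longrightarrow> 0 \<le> \<phi>' t"
    and im: "\<phi> ` {a..b} \<subseteq> {c..d}" "\<phi> a \<le> \<phi> b"
  shows "len a b (g \<circ> \<phi>) (\<lambda>t. \<phi>' t *\<^sub>R g' (\<phi> t)) = len (\<phi> a) (\<phi> b) g g'"
proof -
  have "((\<lambda>t. \<phi>' t *\<^sub>R N (g (\<phi> t)) (g' (\<phi> t))) has_integral integral {\<phi> a..\<phi> b} (\<lambda>t. N (g t) (g' t))) {a..b}"
    by (rule has_integral_substitution[OF \<open>a \<le> b\<close> im(2) im(1) speed_cont[OF g]])
      (auto intro: DERIV_subset[OF \<phi>(1)])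
  then have "integral {a..b} (\<lambda>t. \<phi>' t *\<^sub>R N (g (\<phi> t)) (g' (\<phi> t))) = len (\<phi> a) (\<phi> b) g g'"
    unfolding len_def by (rule integral_unique)
  moreover have "len a b (g \<circ> \<phi>) (\<lambda>t. \<phi>' t *\<^sub>R g' (\<phi> t)) = integral {a..b} (\<lambda>t. \<phi>' t *\<^sub>R N (g (\<phi> t)) (g' (\<phi> t)))"
    unfolding len_def by (rule integral_cong) (simp add: N_scale \<phi>)
  ultimately show ?thesis by simp
qed

lemma dst_bdd: "bdd_below {len 0 1 g g' | g g'. C1_curve 0 1 g g' \<and> g 0 = p \<and> g 1 = q}"
  using len_nonneg by (intro bdd_belowI[of _ 0]) auto

lemma dst_nonempty: "{len 0 1 g g' | g g'. C1_curve 0 1 g g' \<and> g 0 = p \<and> g 1 = q} \<noteq> {}"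
proof -
  have "C1_curve 0 1 (\<lambda>t. p + t *\<^sub>R (q - p)) (\<lambda>t. q - p) \<and> p + 0 *\<^sub>R (q - p) = p \<and> p + 1 *\<^sub>R (q - p) = q"
    using C1_curve_segment[of p q] by simp
  then show ?thesis by blast
qed

lemma dst_le_len_unit: "C1_curve 0 1 g g' \<Longrightarrow> dst (g 0) (g 1) \<le> len 0 1 g g'"
  unfolding dst_def by (intro cInf_lower dst_bdd) auto

lemma dst_le_len:
  assumes g: "C1_curve a b g g'"
  shows "dst (g a) (g b) \<le> len a b g g'"
proof -
  let ?\<phi> = "\<lambda>t. a + t * (b - a)" and ?\<phi>' = "\<lambda>t::real. b - a"
  have ab: "a \<le> b" using C1_curve_le[OF g] .
  have d: "(?\<phi> has_real_derivative ?\<phi>' t) (at t)" for t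
    by (auto intro!: derivative_eq_intros)
  have im: "?\<phi> ` {0..1} \<subseteq> {a..b}"
  proof (rule image_subsetI)
    fix t :: real assume "t \<in> {0..1}"
    then have "0 \<le> t * (b - a)" "t * (b - a) \<le> b - a"
      using ab by (auto intro: mult_left_le_one_le)
    then show "a + t * (b - a) \<in> {a..b}" by simp
  qed
  have "C1_curve 0 1 (g \<circ> ?\<phi>) (\<lambda>t. ?\<phi>' t *\<^sub>R g' (?\<phi> t))"
    by (rule C1_curve_reparametrize[OF g _ d _ im]) auto
  from dst_le_len_unit[OF this]
  have "dst (g a) (g b) \<le> len 0 1 (g \<circ> ?\<phi>) (\<lambda>t. ?\<phi>' t *\<^sub>R g' (?\<phi> t))" by simp
  also have "\<dots> = len (?\<phi> 0) (?\<phi> 1) g g'"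
    using ab by (intro len_reparametrize[OF g _ d _ im]) auto
  finally show ?thesis by simp
qed

lemma dst_lessE:
  assumes "dst p q < r"
  obtains g g' where "C1_curve 0 1 g g'" "g 0 = p" "g 1 = q" "len 0 1 g g' < r"
  using assms unfolding dst_def cInf_less_iff[OF dst_nonempty dst_bdd] by blast

lemma dst_nonneg: "0 \<le> dst p q"
  unfolding dst_def by (rule cInf_greatest[OF dst_nonempty]) (auto simp: len_nonneg)

lemma dst_commute_le: "dst q p \<le> dst p q"
proof (rule ccontr)
  assume "\<not> ?thesis"
  then have "dst p q < dst q p" by simp
  then obtain g g' where g: "C1_curve 0 1 g g'" "g 0 = p" "g 1 = q" "len 0 1 g g' < dst q p"
    by (rule dst_lessE)
  let ?k = "g \<circ> uminus" and ?k' = "\<lambda>t. (-1) *\<^sub>R g' (- t)"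
  have k: "C1_curve (-1) 0 ?k ?k'"
    by (rule C1_curve_reparametrize[OF g(1)]) (auto intro!: derivative_eq_intros)
  have "len (-1) 0 ?k ?k' = integral {-1..-0} (\<lambda>t. N (g (-t)) (g' (-t)))"
    unfolding len_def by simp
  also have "\<dots> = len 0 1 g g'"
    unfolding len_def by (rule Henstock_Kurzweil_Integration.integral_reflect_real[of 1 0 "\<lambda>t. N (g t) (g' t)"])
  finally show False using dst_le_len[OF k] g by simp
qed

lemma dst_commute: "dst p q = dst q p"
  using dst_commute_le[of p q] dst_commute_le[of q p] by simp

text \<open>Two curves are joined after reparametrizing both by \<open>3 t\<^sup>2 - 2 t\<^sup>3\<close>, which makes the speed vanish at the joint.\<close>

lemma dst_triangle_len:
  assumes g: "C1_curve 0 1 g g'" and k: "C1_curve 0 1 k k'" and gk: "g 1 = k 0"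
  shows "dst (g 0) (k 1) \<le> len 0 1 g g' + len 0 1 k k'"
proof -
  define \<sigma> :: "real \<Rightarrow> real" where "\<sigma> t = 3 * t^2 - 2 * t^3" for t
  define \<sigma>' :: "real \<Rightarrow> real" where "\<sigma>' t = 6 * t * (1 - t)" for t
  have d\<sigma>: "(\<sigma> has_real_derivative \<sigma>' t) (at t)" for t
    unfolding \<sigma>_def \<sigma>'_def by (auto intro!: derivative_eq_intros simp: power2_eq_square algebra_simps)
  have c\<sigma>: "continuous_on S \<sigma>'" for S
    unfolding \<sigma>'_def by (intro continuous_intros)
  have im: "\<sigma> ` {0..1} \<subseteq> {0..1}"
  proof (rule image_subsetI)
    fix t :: real assume t: "t \<in> {0..1}"
    have "\<sigma> t = t\<^sup>2 * (3 - 2 * t)" "1 - \<sigma> t = (1 - t)\<^sup>2 * (1 + 2 * t)"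
      unfolding \<sigma>_def by (simp_all add: power2_eq_square power3_eq_cube algebra_simps)
    moreover have "0 \<le> t\<^sup>2 * (3 - 2 * t)" "0 \<le> (1 - t)\<^sup>2 * (1 + 2 * t)"
      using t by (intro mult_nonneg_nonneg; simp)+
    ultimately show "\<sigma> t \<in> {0..1}" by simp
  qed
  have nn: "0 \<le> \<sigma>' t" if "t \<in> {0..1}" for t
    using that unfolding \<sigma>'_def by auto
  have [simp]: "\<sigma> 0 = 0" "\<sigma> 1 = 1" "\<sigma>' 0 = 0" "\<sigma>' 1 = 0" unfolding \<sigma>_def \<sigma>'_def by auto
  define g1 where "g1 = g \<circ> \<sigma>"
  define g1' where "g1' t = \<sigma>' t *\<^sub>R g' (\<sigma> t)" for t
  define k1 where "k1 = (k \<circ> \<sigma>) \<circ> (\<lambda>t. t - 1)"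
  define k1' where "k1' t = 1 *\<^sub>R (\<sigma>' (t - 1) *\<^sub>R k' (\<sigma> (t - 1)))" for t
  have g1: "C1_curve 0 1 g1 g1'"
    unfolding g1_def g1'_def by (rule C1_curve_reparametrize[OF g _ d\<sigma> c\<sigma> im]) auto
  have k0: "C1_curve 0 1 (k \<circ> \<sigma>) (\<lambda>t. \<sigma>' t *\<^sub>R k' (\<sigma> t))"
    by (rule C1_curve_reparametrize[OF k _ d\<sigma> c\<sigma> im]) auto
  have k1: "C1_curve 1 2 k1 k1'"
    unfolding k1_def k1'_def by (rule C1_curve_reparametrize[OF k0]) (auto intro!: derivative_eq_intros)
  have lg: "len 0 1 g1 g1' = len 0 1 g g'"
    unfolding g1_def g1'_def using len_reparametrize[OF g _ d\<sigma> nn im] by simp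
  have "len 0 1 (k \<circ> \<sigma>) (\<lambda>t. \<sigma>' t *\<^sub>R k' (\<sigma> t)) = len 0 1 k k'"
    using len_reparametrize[OF k _ d\<sigma> nn im] by simp
  moreover have "len 1 2 k1 k1' = len (1 - 1) (2 - 1) (k \<circ> \<sigma>) (\<lambda>t. \<sigma>' t *\<^sub>R k' (\<sigma> t))"
    unfolding k1_def k1'_def by (rule len_reparametrize[OF k0]) (auto intro!: derivative_eq_intros)
  ultimately have lk: "len 1 2 k1 k1' = len 0 1 k k'" by simp
  have joint: "g1 1 = k1 1" "g1' 1 = 0" "k1' 1 = 0"
    unfolding g1_def k1_def g1'_def k1'_def by (simp_all add: gk)
  define G where "G t = (if t \<in> {..1} then g1 t else k1 t)" for t
  define G' where "G' t = (if t \<in> {..1} then g1' t else k1' t)" for t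
  have cl: "closure {..1::real} \<inter> closure {1<..} = {1}" "{..1} \<union> {1::real} = {..1}" "{1<..} \<union> {1::real} = {1..}"
    by auto
  have "(G has_vector_derivative G' t) (at t)" if t: "t \<in> {0..2}" for t
    unfolding G_def G'_def
  proof (rule has_vector_derivative_If_within_closures[where S="{..1}" and T="{1<..}", unfolded cl])
    show "(g1 has_vector_derivative g1' t) (at t within {..1})" if "t \<in> {..1}"
      using t that C1_curve_deriv[OF g1, of t] by (auto intro: has_vector_derivative_at_within)
    show "(k1 has_vector_derivative k1' t) (at t within {1..})" if "t \<in> {1..}"
      using t that C1_curve_deriv[OF k1, of t] by (auto intro: has_vector_derivative_at_within)
    show "g1 t = k1 t" "g1' t = k1' t" if "t \<in> closure {..1}" "t \<in> closure {1<..}"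
    proof -
      have "t = 1" using that cl(1) by blast
      then show "g1 t = k1 t" "g1' t = k1' t" using joint by auto
    qed
  qed auto
  moreover have "continuous_on ({0..1} \<union> {1..2}) G'"
    unfolding G'_def
    by (rule continuous_on_If) (use C1_curve_cont_deriv[OF g1] C1_curve_cont_deriv[OF k1] joint in
        \<open>auto intro: order_antisym\<close>)
  ultimately have G: "C1_curve 0 2 G G'"
    unfolding C1_curve_def by (simp add: ivl_disj_un_two_touch(4))
  have "len 0 1 G G' = len 0 1 g1 g1'"
    unfolding len_def by (rule integral_cong) (auto simp: G_def G'_def)
  moreover have "len 1 2 G G' = len 1 2 k1 k1'"
    unfolding len_def
  proof (rule integral_cong)
    fix t :: real assume "t \<in> {1..2}"
    then show "N (G t) (G' t) = N (k1 t) (k1' t)"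
      using joint by (cases "t = 1") (auto simp: G_def G'_def)
  qed
  ultimately have "len 0 2 G G' = len 0 1 g g' + len 0 1 k k'"
    using len_split[OF G, of 1] lg lk by simp
  moreover have "G 0 = g 0" "G 2 = k 1"
    by (auto simp: G_def g1_def k1_def)
  ultimately show ?thesis using dst_le_len[OF G] by simp
qed

lemma dst_triangle: "dst p r \<le> dst p q + dst q r"
proof (rule field_le_epsilon)
  fix e :: real assume "0 < e"
  obtain g g' where g: "C1_curve 0 1 g g'" "g 0 = p" "g 1 = q" "len 0 1 g g' < dst p q + e / 2"
    by (rule dst_lessE[of p q "dst p q + e / 2"]) (use \<open>0 < e\<close> in simp)
  obtain k k' where k: "C1_curve 0 1 k k'" "k 0 = q" "k 1 = r" "len 0 1 k k' < dst q r + e / 2"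
    by (rule dst_lessE[of q r "dst q r + e / 2"]) (use \<open>0 < e\<close> in simp)
  show "dst p r \<le> dst p q + dst q r + e"
    using dst_triangle_len[OF g(1) k(1)] g k by simp
qed

lemma dst_le_norm:
  assumes "convex K" and C: "\<And>z v. z \<in> K \<Longrightarrow> N z v \<le> C * norm v" and "p \<in> K" "q \<in> K"
  shows "dst p q \<le> C * norm (q - p)"
proof -
  note c = C1_curve_segment[of p q]
  have K: "p + t *\<^sub>R (q - p) \<in> K" if "t \<in> {0..1}" for t
  proof -
    have "(1 - t) *\<^sub>R p + t *\<^sub>R q \<in> K"
      using that assms by (intro convexD) auto
    then show ?thesis by (simp add: algebra_simps)
  qed
  have "dst p q \<le> len 0 1 (\<lambda>t. p + t *\<^sub>R (q - p)) (\<lambda>t. q - p)"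
    using dst_le_len[OF c] by simp
  also have "\<dots> \<le> integral {0..1::real} (\<lambda>t. C * norm (q - p))"
    unfolding len_def by (rule integral_le[OF speed_integrable[OF c]]) (use C K in auto)
  finally show ?thesis by simp
qed

lemma dst_self [simp]: "dst p p = 0"
proof -
  obtain C where "\<And>z v. z \<in> {p} \<Longrightarrow> N z v \<le> C * norm v"
    using N_equivalent[OF compact_sing] by metis
  from dst_le_norm[OF _ this, of "{p}" p p] show ?thesis using dst_nonneg[of p p] by simp
qed

lemma len_ge_norm:
  assumes g: "C1_curve a b g g'" and c: "\<And>t v. t \<in> {a..b} \<Longrightarrow> c * norm v \<le> N (g t) v" "0 \<le> c"
  shows "c * norm (g b - g a) \<le> len a b g g'"
proof -
  have "(g' has_integral (g b - g a)) {a..b}"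
    using g by (intro fundamental_theorem_of_calculus)
      (auto simp: C1_curve_def intro: has_vector_derivative_at_within)
  then have e: "g b - g a = integral {a..b} g'" by (simp add: integral_unique)
  have "norm (g b - g a) \<le> integral {a..b} (\<lambda>t. norm (g' t))"
    unfolding e using C1_curve_cont_deriv[OF g]
    by (intro integral_norm_bound_integral integrable_continuous_real continuous_intros) auto
  then have "c * norm (g b - g a) \<le> c * integral {a..b} (\<lambda>t. norm (g' t))"
    using c(2) by (rule mult_left_mono)
  also have "\<dots> = integral {a..b} (\<lambda>t. c * norm (g' t))" by simp
  also have "\<dots> \<le> len a b g g'"
    unfolding len_def using C1_curve_cont_deriv[OF g]
    by (intro integral_le speed_integrable[OF g] integrable_continuous_real continuous_intros c(1)) auto
  finally show ?thesis .
qed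

text \<open>A curve from \<open>p\<close> to \<open>q\<close> either stays in the ball, where its
  length is at least \<open>c\<close> times its displacement, or reaches radius \<open>r\<close>,
  which already costs \<open>c * r\<close>. The minimum covers both cases.\<close>

lemma dst_ge_norm:
  assumes c: "\<And>z v. z \<in> cball p r \<Longrightarrow> c * norm v \<le> N z v" "0 \<le> c" and "0 \<le> r"
  shows "c * min r (norm (q - p)) \<le> dst p q"
proof (rule ccontr)
  assume "\<not> ?thesis"
  then have "dst p q < c * min r (norm (q - p))" by simp
  then obtain g g' where g: "C1_curve 0 1 g g'" "g 0 = p" "g 1 = q" "len 0 1 g g' < c * min r (norm (q - p))"
    by (rule dst_lessE)
  have cg: "continuous_on {0..1} (\<lambda>t. norm (g t - p))"
    by (intro continuous_intros C1_curve_cont[OF g(1)])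
  show False
  proof (cases "\<forall>t\<in>{0..1}. norm (g t - p) \<le> r")
    case True
    then have "c * norm (g 1 - g 0) \<le> len 0 1 g g'"
      using c by (intro len_ge_norm[OF g(1)] c) (auto simp: dist_norm norm_minus_commute)
    moreover have "c * min r (norm (q - p)) \<le> c * norm (q - p)" using c(2) by (intro mult_left_mono) auto
    ultimately show False using g by simp
  next
    case False
    \<comment> \<open>The times at distance at least \<open>r\<close> from \<open>p\<close>; by
      compactness there is a first one, \<open>\<tau>\<close>, and the lower speed bound applies up
      to it.\<close>
    let ?T = "{t \<in> {0..1}. r \<le> norm (g t - p)}"
    have "?T = {0..1} \<inter> (\<lambda>t. norm (g t - p)) -` {r..}" by auto
    then have "closed ?T" using continuous_closed_preimage[OF cg] by simp
    moreover have "bounded ?T" by (rule bounded_subset[of "{0..1}"]) auto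
    ultimately have "compact ?T" by (simp add: compact_eq_bounded_closed)
    moreover have "?T \<noteq> {}" using False by force
    ultimately obtain \<tau> where \<tau>: "\<tau> \<in> ?T" "\<forall>t\<in>?T. \<tau> \<le> t"
      using compact_attains_inf by blast
    have "norm (g t - p) \<le> r" if "t \<in> {0..\<tau>}" for t
    proof (cases "t = \<tau>")
      case True
      obtain s where s: "0 \<le> s" "s \<le> \<tau>" "norm (g s - p) = r"
        using IVT'[of "\<lambda>t. norm (g t - p)" 0 r \<tau>] \<tau>(1) g(2) \<open>0 \<le> r\<close> continuous_on_subset[OF cg] by auto
      then have "\<tau> \<le> s" using \<tau> by auto
      then show ?thesis using s True by auto
    next
      case False
      then show ?thesis using \<tau> that by force
    qed
    then have "c * norm (g \<tau> - g 0) \<le> len 0 \<tau> g g'"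
      using \<tau>(1) by (intro len_ge_norm[OF C1_curve_subinterval[OF g(1)]] c) (auto simp: dist_norm norm_minus_commute)
    moreover have "c * min r (norm (q - p)) \<le> c * norm (g \<tau> - g 0)"
      using c(2) \<tau>(1) g(2) by (intro mult_left_mono) auto
    moreover have "len 0 \<tau> g g' \<le> len 0 1 g g'"
      using len_split[OF g(1), of \<tau>] \<tau>(1) len_nonneg[of \<tau> 1 g g'] by auto
    ultimately show False using g by simp
  qed
qed

end

section \<open>The Hopf-Rinow theorem\<close>

context speed_structure begin

lemma dst_continuous: "continuous_on UNIV (dst p)"
proof (rule continuous_at_imp_continuous_on, rule ballI)
  fix q
  obtain C where C: "0 < C" "\<And>z v. z \<in> cball q 1 \<Longrightarrow> N z v \<le> C * norm v"
    using N_equivalent[OF compact_cball[of q 1]] by metis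
  have b: "\<bar>dst p y - dst p q\<bar> \<le> C * norm (y - q)" if "y \<in> cball q 1" for y
  proof -
    have "dst q y \<le> C * norm (y - q)"
      by (rule dst_le_norm[OF convex_cball C(2)]) (use that in auto)
    then show ?thesis
      using dst_triangle[of p y q] dst_triangle[of p q y] dst_commute[of q y] by linarith
  qed
  have "((\<lambda>y. dst p y - dst p q) \<longlongrightarrow> 0) (at q)"
  proof (rule Lim_null_comparison)
    show "\<forall>\<^sub>F y in at q. norm (dst p y - dst p q) \<le> C * norm (y - q)"
      using b by (auto simp: eventually_at dist_commute intro!: exI[of _ 1])
    show "((\<lambda>y. C * norm (y - q)) \<longlongrightarrow> 0) (at q)"
      by (auto intro!: tendsto_eq_intros)
  qed
  then show "isCont (dst p) q"
    unfolding isCont_def by (simp add: LIM_zero_iff)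
qed

text \<open>A local fact: by \<open>dst_ge_norm\<close> with \<open>r = 1\<close>, a
  \<open>dst\<close>-radius \<open>c\<close> is too short to leave the Euclidean unit ball about
  \<open>p\<close>. It supplies the contradiction at the limit point in
  \<open>Hopf_Rinow\<close>.\<close>

lemma dst_ball_bounded: obtains \<rho> where "0 < \<rho>" "bounded {z. dst p z < \<rho>}"
proof -
  obtain c where c: "0 < c" "\<And>z v. z \<in> cball p 1 \<Longrightarrow> c * norm v \<le> N z v"
    using N_equivalent[OF compact_cball[of p 1]] by metis
  have "z \<in> cball p 1" if "dst p z < c" for z
  proof -
    have "c * min 1 (norm (z - p)) < c * 1"
      using dst_ge_norm[where p=p and r=1 and c=c and q=z, OF c(2)] c(1) that by simp
    then have "min 1 (norm (z - p)) < 1" using c(1) by (simp only: mult_less_cancel_left_pos)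
    then show ?thesis by (simp add: dist_norm norm_minus_commute)
  qed
  then have "bounded {z. dst p z < c}" by (intro bounded_subset[OF bounded_cball]) blast
  then show ?thesis using c(1) that by blast
qed

lemma dst_tendsto_0_imp:
  assumes "((\<lambda>x. dst p (f x)) \<longlongrightarrow> 0) F"
  shows "(f \<longlongrightarrow> p) F"
proof (rule tendstoI)
  fix e :: real assume "0 < e"
  obtain c where c: "0 < c" "\<And>z v. z \<in> cball p e \<Longrightarrow> c * norm v \<le> N z v"
    using N_equivalent[OF compact_cball[of p e]] by metis
  have "\<forall>\<^sub>F x in F. dst p (f x) < c * e"
    using \<open>0 < e\<close> c(1) by (intro order_tendstoD(2)[OF assms]) simp
  then show "\<forall>\<^sub>F x in F. dist (f x) p < e"
  proof eventually_elim
    case (elim x)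
    have "c * min e (norm (f x - p)) < c * e"
      using dst_ge_norm[where p=p and r=e and c=c and q="f x", OF c(2)] c(1) \<open>0 < e\<close> elim by simp
    then have "min e (norm (f x - p)) < e" using c(1) by (simp only: mult_less_cancel_left_pos)
    then show ?case by (simp add: dist_norm)
  qed
qed

lemma dst_tendsto_0: "(f \<longlongrightarrow> p) F \<Longrightarrow> ((\<lambda>x. dst p (f x)) \<longlongrightarrow> 0) F"
  using continuous_on_tendsto_compose[OF dst_continuous, of f p F p] by simp

definition unbounded_ball :: "'a \<Rightarrow> real \<Rightarrow> bool" where
  "unbounded_ball p r \<longleftrightarrow> \<not> bounded {z. dst p z < r}"

lemma unbounded_ball_mono: "unbounded_ball p r \<Longrightarrow> r \<le> s \<Longrightarrow> unbounded_ball p s"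
  unfolding unbounded_ball_def by (erule contrapos_nn) (erule bounded_subset, auto)

text \<open>A nearly minimal curve is cut where its length reaches \<open>r\<close>, which the
  intermediate value theorem provides. The cut point plays the part of a point on a minimizing
  geodesic.\<close>

lemma dst_split_point:
  assumes "dst p z < r + \<eta>" "0 < \<eta>" "0 \<le> r"
  obtains y where "dst p y \<le> r" "dst y z \<le> \<eta>"
proof -
  obtain g g' where g: "C1_curve 0 1 g g'" "g 0 = p" "g 1 = z" "len 0 1 g g' < r + \<eta>"
    using assms(1) by (rule dst_lessE)
  show ?thesis
  proof (cases "len 0 1 g g' \<le> r")
    case True
    then have "dst p z \<le> r" using dst_le_len[OF g(1)] g by simp
    then show ?thesis using that[of z] \<open>0 < \<eta>\<close> by simp
  next
    case False
    have "continuous_on {0..1} (\<lambda>s. len 0 s g g')"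
      unfolding len_def by (rule indefinite_integral_continuous_1[OF speed_integrable[OF g(1)]])
    moreover have "len 0 0 g g' \<le> r" using assms(3) by (simp add: len_def)
    ultimately obtain s where s: "0 \<le> s" "s \<le> 1" "len 0 s g g' = r"
      using IVT'[of "\<lambda>s. len 0 s g g'" 0 r 1] False by auto
    have "dst p (g s) \<le> r"
      using dst_le_len[OF C1_curve_subinterval[OF g(1), of 0 s]] s g(2) by simp
    moreover have "dst (g s) z \<le> \<eta>"
      using dst_le_len[OF C1_curve_subinterval[OF g(1), of s 1]] s g len_split[OF g(1), of s] by simp
    ultimately show ?thesis using that by blast
  qed
qed

text \<open>The bounded ball of radius slightly less than the critical one is totally bounded, so finitely
  many small balls cover one of slightly more than critical radius; one of them must be unbounded.\<close>

lemma unbounded_ball_step: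
  assumes bad: "unbounded_ball p r" and "0 < e"
  shows "\<exists>y. dst p y \<le> r \<and> unbounded_ball y e"
proof -
  \<comment> \<open>The critical radius: balls about \<open>p\<close> are bounded below it and
    unbounded above it.\<close>
  define R where "R = Inf {s. unbounded_ball p s}"
  have pos: "0 \<le> s" if "unbounded_ball p s" for s
  proof (rule ccontr)
    assume "\<not> 0 \<le> s"
    then have "{z. dst p z < s} = {}" using dst_nonneg[of p] by (auto simp: not_less intro: order_trans[OF _ dst_nonneg])
    then show False using that by (simp add: unbounded_ball_def)
  qed
  have bdd: "bdd_below {s. unbounded_ball p s}" using pos by (intro bdd_belowI[of _ 0]) auto
  have Rr: "R \<le> r" unfolding R_def by (rule cInf_lower[OF _ bdd]) (simp add: bad)
  have R0: "0 \<le> R" unfolding R_def by (rule cInf_greatest) (use bad pos in auto)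
  have below: "\<not> unbounded_ball p s" if "s < R" for s
    using that cInf_lower[OF _ bdd, of s] unfolding R_def by force
  have above: "unbounded_ball p s" if "R < s" for s
  proof -
    obtain s' where "unbounded_ball p s'" "s' < s"
      using \<open>R < s\<close> bad unfolding R_def by (subst (asm) cInf_less_iff[OF _ bdd]) auto
    then show ?thesis using unbounded_ball_mono by auto
  qed
  \<comment> \<open>The chain below has pieces of length at most \<open>\<eta>\<close> and
    \<open>3 * \<eta>\<close>, well under \<open>e = 8 * \<eta>\<close>; when
    \<open>R < 2 * \<eta>\<close> the centre \<open>p\<close> itself serves.\<close>
  define \<eta> where "\<eta> = e / 8"
  have \<eta>: "0 < \<eta>" "8 * \<eta> = e" using \<open>0 < e\<close> by (auto simp: \<eta>_def)
  show ?thesis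
  proof (cases "R < 2 * \<eta>")
    case True
    then have "unbounded_ball p e" using \<eta> by (intro above) simp
    then show ?thesis using R0 Rr by (intro exI[of _ p]) simp
  next
    case False
    define B where "B = {z. dst p z < R - \<eta>}"
    have "bounded B" using below[of "R - \<eta>"] \<eta> unfolding B_def unbounded_ball_def by simp
    then obtain \<rho> where \<rho>: "B \<subseteq> cball 0 \<rho>"
      unfolding bounded_any_center[of B 0] by (auto simp: subset_eq)
    obtain C where C: "0 < C" "\<And>z v. z \<in> cball 0 \<rho> \<Longrightarrow> N z v \<le> C * norm v"
      using N_equivalent[OF compact_cball[of 0 \<rho>]] by metis
    have cl: "closure B \<subseteq> cball 0 \<rho>" using \<rho> by (simp add: closure_minimal)
    have near: "dst x y \<le> \<eta>" if "x \<in> closure B" "y \<in> closure B" "dist x y < \<eta> / C" for x y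
    proof -
      have "dst x y \<le> C * norm (y - x)" 
        by (rule dst_le_norm[OF convex_cball[of 0 \<rho>] C(2)]) (use that cl in blast)+
      also have "\<dots> \<le> \<eta>" using that(3) C(1) by (simp add: dist_norm norm_minus_commute field_simps)
      finally show ?thesis .
    qed
    have "compact (closure B)" using \<open>bounded B\<close> by (simp add: compact_closure)
    then obtain D where D: "D \<subseteq> closure B" "finite D" "closure B \<subseteq> (\<Union>y\<in>D. ball y (\<eta> / C))"
      by (rule compactE_image[where C="closure B" and f="\<lambda>y. ball y (\<eta> / C)"])
        (use \<eta> C(1) in auto)
    have "{z. dst p z < R + \<eta>} \<subseteq> (\<Union>y\<in>D. {z. dst y z < e})"
    proof
      fix z assume "z \<in> {z. dst p z < R + \<eta>}"
      \<comment> \<open>Cutting at \<open>R - 2 * \<eta>\<close> puts the cut point strictly inside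
        \<open>B\<close>, whose radius is \<open>R - \<eta>\<close>, and leaves at most
        \<open>3 * \<eta>\<close> to \<open>z\<close>.\<close>
      then have "dst p z < (R - 2 * \<eta>) + 3 * \<eta>" by simp
      then obtain y where y: "dst p y \<le> R - 2 * \<eta>" "dst y z \<le> 3 * \<eta>"
        by (rule dst_split_point) (use \<eta> False in auto)
      then have "y \<in> B" using \<eta> by (simp add: B_def)
      then have "y \<in> closure B" using closure_subset by blast
      then obtain x where x: "x \<in> D" "dist x y < \<eta> / C" using D(3) by auto
      then have "dst x y \<le> \<eta>" using D(1) \<open>y \<in> closure B\<close> by (intro near) auto
      then have "dst x z < e" using dst_triangle[of x z y] y(2) \<eta> by linarith
      then show "z \<in> (\<Union>y\<in>D. {z. dst y z < e})" using x(1) by blast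
    qed
    moreover have "\<not> bounded {z. dst p z < R + \<eta>}"
      using above[of "R + \<eta>"] \<eta> by (simp add: unbounded_ball_def)
    ultimately have "\<not> bounded (\<Union>y\<in>D. {z. dst y z < e})" using bounded_subset by blast
    then obtain y where y: "y \<in> D" "unbounded_ball y e"
      using D(2) unfolding unbounded_ball_def by (auto intro!: bounded_UN)
    \<comment> \<open>The centre \<open>y\<close> lies only in the closure of \<open>B\<close>; a
      point of \<open>B\<close> at \<open>dst\<close> at most \<open>\<eta>\<close> from it keeps
      \<open>y\<close> within radius \<open>R\<close>.\<close>
    obtain x where x: "x \<in> B" "dist x y < \<eta> / C"
    proof -
      have "y \<in> closure B" "0 < \<eta> / C" using y(1) D(1) \<eta> C(1) by auto
      then show ?thesis using that unfolding closure_approachable by blast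
    qed
    have "dst x y \<le> \<eta>" using x y(1) D(1) closure_subset by (intro near) auto
    then have "dst p y \<le> R" using dst_triangle[of p y x] x(1) by (simp add: B_def)
    then show ?thesis using y(2) Rr by (intro exI[of _ y]) simp
  qed
qed

text \<open>If some ball were unbounded, \<open>unbounded_ball_step\<close> would give centres of
  unbounded balls with halving radii, each within the preceding radius of its predecessor. These
  centres form a Cauchy sequence, and near its limit the small balls fit into a bounded one.\<close>

theorem Hopf_Rinow:
  assumes complete: "\<And>X :: nat \<Rightarrow> 'a. \<forall>e>0. \<exists>N. \<forall>i\<ge>N. \<forall>j\<ge>N. dst (X i) (X j) < e \<Longrightarrow> convergent X"
  shows "bounded {z. dst p z \<le> r}"
proof (rule ccontr)
  define h :: "nat \<Rightarrow> real" where "h n = (1/2) ^ n" for n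
  have h0: "0 < h n" "h (Suc n) = h n / 2" for n unfolding h_def by auto
  assume "\<not> bounded {z. dst p z \<le> r}"
  \<comment> \<open>\<open>unbounded_ball\<close> speaks of open balls; the one of radius
    \<open>r + 1\<close> contains the closed ball of radius \<open>r\<close>.\<close>
  then have "unbounded_ball p (r + 1)"
    unfolding unbounded_ball_def by (rule contrapos_nn) (erule bounded_subset, auto)
  then obtain p0 where p0: "unbounded_ball p0 (h 0)"
    using unbounded_ball_step[OF _ h0(1)] by blast
  have "\<exists>X. \<forall>n. unbounded_ball (X n) (h n) \<and> dst (X n) (X (Suc n)) \<le> h n"
  proof (rule dependent_nat_choice)
    fix x n assume "unbounded_ball x (h n)"
    then show "\<exists>y. unbounded_ball y (h (Suc n)) \<and> dst x y \<le> h n"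
      using unbounded_ball_step[OF _ h0(1)] by blast
  qed (use p0 in blast)
  then obtain X where X: "\<And>n. unbounded_ball (X n) (h n)" "\<And>n. dst (X n) (X (Suc n)) \<le> h n" by blast
  \<comment> \<open>The step length \<open>h n\<close> equals
    \<open>2 * h n - 2 * h (Suc n)\<close>, so the sum telescopes.\<close>
  have step: "dst (X n) (X (n + k)) \<le> 2 * h n - 2 * h (n + k)" for n k
  proof (induction k)
    case (Suc k)
    then show ?case
      using dst_triangle[of "X n" "X (n + Suc k)" "X (n + k)"] X(2)[of "n + k"] h0(2)[of "n + k"] by simp
  qed simp
  have le: "dst (X i) (X j) \<le> 2 * h n" if "n \<le> i" "n \<le> j" for i j n
  proof -
    have *: "dst (X i) (X j) \<le> 2 * h n" if "i \<le> j" "n \<le> i" for i j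
    proof -
      have "h i \<le> h n" using that unfolding h_def by (simp add: power_decreasing)
      then show ?thesis using step[of i "j - i"] that h0(1)[of j] by simp
    qed
    show ?thesis using *[of i j] *[of j i] that dst_commute[of "X i" "X j"] by (cases "i \<le> j") auto
  qed
  have h_lim: "h \<longlonglongrightarrow> 0" unfolding h_def by (rule LIMSEQ_power_zero) simp
  have small: "\<exists>n. 2 * h n < e" if "0 < e" for e
  proof -
    have "\<forall>\<^sub>F n in sequentially. h n < e / 2"
      by (rule order_tendstoD(2)[OF h_lim]) (use that in simp)
    then show ?thesis by (auto simp: eventually_sequentially field_simps)
  qed
  have "convergent X"
  proof (intro complete allI impI)
    fix e :: real assume "0 < e"
    then obtain n where "2 * h n < e" using small by blast
    then show "\<exists>N. \<forall>i\<ge>N. \<forall>j\<ge>N. dst (X i) (X j) < e" using le[of n] by (meson order_le_less_trans)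
  qed
  then obtain q where q: "X \<longlonglongrightarrow> q" by (auto simp: convergent_def)
  obtain \<rho> where \<rho>: "0 < \<rho>" "bounded {z. dst q z < \<rho>}" by (rule dst_ball_bounded)
  have "\<forall>\<^sub>F n in sequentially. dst q (X n) < \<rho> / 2 \<and> h n < \<rho> / 2"
    using \<rho>(1) by (intro eventually_conj order_tendstoD(2)[OF dst_tendsto_0[OF q]] order_tendstoD(2)[OF h_lim]) auto
  then obtain n where n: "dst q (X n) < \<rho> / 2" "h n < \<rho> / 2"
    by (auto simp: eventually_sequentially)
  have "{z. dst (X n) z < h n} \<subseteq> {z. dst q z < \<rho>}"
  proof clarify
    fix z assume "dst (X n) z < h n"
    then show "dst q z < \<rho>" using n dst_triangle[of q z "X n"] by simp
  qed
  then have "bounded {z. dst (X n) z < h n}" using \<rho>(2) bounded_subset by blast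
  then show False using X(1)[of n] by (simp add: unbounded_ball_def)
qed

end

section \<open>Global solutions of Lipschitz equations\<close>

lemma has_vector_derivative_integral_from_0:
  fixes g :: "real \<Rightarrow> 'a::banach"
  assumes g: "continuous_on UNIV g" and "0 \<le> t"
  shows "((\<lambda>u. integral {0..u} g) has_vector_derivative g t) (at t within {0..})"
proof -
  have "((\<lambda>u. integral {0..u} g) has_vector_derivative g t) (at t within {0..t + 1})"
    using assms by (intro integral_has_vector_derivative continuous_on_subset[OF g]) auto
  moreover have "at t within {0..t + 1} = at t within {0..}"
    by (rule at_within_nhd[of _ "{..<t + 1}"]) auto
  ultimately show ?thesis by simp
qed

text \<open>Picard iteration for \<open>v t = exp (- 2 M t) *\<^sub>R y t\<close>: the weight turns the Picard map into a
  contraction on the whole half-line, and \<open>max 0\<close> makes it act on functions on the real line.\<close>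

lemma global_solution_of_bounded_lipschitz:
  fixes F :: "'a::euclidean_space \<Rightarrow> 'a"
  assumes lip: "\<And>x y. norm (F x - F y) \<le> M * norm (x - y)" and M: "0 < M"
    and bnd: "\<And>x. norm (F x) \<le> K"
  shows "\<exists>y. y 0 = z \<and> (\<forall>t\<ge>0. (y has_vector_derivative F (y t)) (at t within {0..}))"
proof -
  have K: "0 \<le> K" using bnd[of 0] norm_ge_zero order_trans by blast
  have "continuous (at x) F" for x
  proof -
    have "((\<lambda>y. F y - F x) \<longlongrightarrow> 0) (at x)"
    proof (rule Lim_null_comparison)
      show "\<forall>\<^sub>F y in at x. norm (F y - F x) \<le> M * norm (y - x)"
        by (intro always_eventually allI lip)
      show "((\<lambda>y. M * norm (y - x)) \<longlongrightarrow> 0) (at x)" by (auto intro!: tendsto_eq_intros)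
    qed
    then show ?thesis by (simp add: continuous_at LIM_zero_iff)
  qed
  then have cF: "continuous_on UNIV F" by (simp add: continuous_at_imp_continuous_on)
  define S where "S v s = F (exp (2 * M * s) *\<^sub>R v s)" for v :: "real \<Rightarrow> 'a" and s
  define Y where "Y v t = z + integral {0..t} (S v)" for v t
  define P where "P v t = exp (- (2 * M * max 0 t)) *\<^sub>R Y v (max 0 t)" for v t
  have cS: "continuous_on UNIV (S v)" if "continuous_on UNIV v" for v
    unfolding S_def by (intro continuous_on_compose2[OF cF] continuous_intros that) auto
  have iS: "S v integrable_on {a..b}" if "continuous_on UNIV v" for v a b
    by (intro integrable_continuous_real continuous_on_subset[OF cS[OF that]]) auto
  have dY: "(Y v has_vector_derivative S v t) (at t within {0..})" if "continuous_on UNIV v" "0 \<le> t" for v t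
    unfolding Y_def using has_vector_derivative_integral_from_0[OF cS[OF that(1)] that(2)]
    by (auto intro!: derivative_eq_intros)
  have cY: "continuous_on {0..} (Y v)" if "continuous_on UNIV v" for v
    using dY[OF that] has_vector_derivative_continuous
    by (force simp: continuous_on_eq_continuous_within)
  have cP: "continuous_on UNIV (P v)" if "continuous_on UNIV v" for v
    unfolding P_def by (intro continuous_intros continuous_on_compose2[OF cY[OF that]]) auto
  \<comment> \<open>For a bounded field \<open>Y v\<close> grows at most linearly and the decaying
    weight absorbs this, so \<open>P\<close> takes values in the bounded continuous
    functions.\<close>
  have bP: "norm (P v t) \<le> norm z + K / (2 * M)" if v: "continuous_on UNIV v" for v t
  proof -
    let ?u = "max 0 t" and ?E = "exp (- (2 * M * max 0 t))"
    have E: "0 < ?E" "?E \<le> 1" using M by auto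
    have "norm (integral {0..?u} (S v)) \<le> K * (?u - 0)"
    proof (rule integral_bound)
      show "continuous_on {0..?u} (S v)" by (rule continuous_on_subset[OF cS[OF v]]) simp
    qed (simp_all add: S_def bnd)
    then have "norm (Y v ?u) \<le> norm z + K * ?u"
      unfolding Y_def using norm_triangle_ineq[of z "integral {0..?u} (S v)"] by simp
    then have "norm (P v t) \<le> ?E * (norm z + K * ?u)"
      unfolding P_def using E by simp
    also have "\<dots> = ?E * norm z + K * (?u * ?E)" by (simp add: algebra_simps)
    also have "\<dots> \<le> norm z + K * (1 / (2 * M))"
    proof (rule add_mono)
      show "?E * norm z \<le> norm z" using E by (intro mult_left_le_one_le) auto
      have "2 * M * ?u \<le> exp (2 * M * ?u)" using exp_ge_add_one_self[of "2 * M * ?u"] by linarith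
      then have "?u * ?E \<le> 1 / (2 * M)" using M by (simp add: exp_minus field_simps)
      then show "K * (?u * ?E) \<le> K * (1 / (2 * M))" using K by (rule mult_left_mono)
    qed
    finally show ?thesis by simp
  qed
  define T :: "(real \<Rightarrow>\<^sub>C 'a) \<Rightarrow> (real \<Rightarrow>\<^sub>C 'a)" where "T v = Bcontfun (P v)" for v
  have T: "apply_bcontfun (T v) = P v" for v
    unfolding T_def by (intro Bcontfun_inverse bcontfun_normI[OF cP bP]) auto
  \<comment> \<open>The integral of \<open>M * exp (2 * M * s)\<close> over \<open>{0..?u}\<close>
    is at most \<open>exp (2 * M * ?u) / 2\<close>; the weight removes the exponential and leaves
    the factor 1/2 at every time.\<close>
  have "dist (T v) (T w) \<le> 1 / 2 * dist v w" for v w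
  proof (rule dist_bound)
    fix t :: real
    let ?u = "max 0 t" and ?d = "dist v w"
    have "norm (S v s - S w s) \<le> M * ?d * exp (2 * M * s)" for s
    proof -
      have "norm (S v s - S w s) \<le> M * norm (exp (2 * M * s) *\<^sub>R v s - exp (2 * M * s) *\<^sub>R w s)"
        unfolding S_def by (rule lip)
      also have "norm (exp (2 * M * s) *\<^sub>R v s - exp (2 * M * s) *\<^sub>R w s) = exp (2 * M * s) * dist (v s) (w s)"
        by (simp add: scaleR_diff_right[symmetric] dist_norm)
      also have "M * \<dots> \<le> M * (exp (2 * M * s) * ?d)"
        using M by (intro mult_left_mono dist_bounded) auto
      finally show ?thesis by (simp add: mult_ac)
    qed
    moreover have i: "((\<lambda>s. M * ?d * exp (2 * M * s)) has_integral (?d / 2 * exp (2 * M * ?u) - ?d / 2 * exp (2 * M * 0))) {0..?u}"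
      by (rule fundamental_theorem_of_calculus)
        (auto intro!: derivative_eq_intros simp: has_real_derivative_iff_has_vector_derivative[symmetric])
    ultimately have "norm (integral {0..?u} (\<lambda>s. S v s - S w s)) \<le> ?d / 2 * exp (2 * M * ?u) - ?d / 2"
      using integral_norm_bound_integral[OF integrable_diff[OF iS iS, of v w 0 ?u] has_integral_integrable[OF i]]
        integral_unique[OF i] by simp
    moreover have e: "Y v ?u - Y w ?u = integral {0..?u} (\<lambda>s. S v s - S w s)"
      unfolding Y_def by (simp add: integral_diff iS)
    ultimately have "norm (Y v ?u - Y w ?u) \<le> ?d / 2 * exp (2 * M * ?u)"
      unfolding e using zero_le_dist[of v w] by linarith
    then have "exp (- (2 * M * ?u)) * norm (Y v ?u - Y w ?u) \<le> exp (- (2 * M * ?u)) * (?d / 2 * exp (2 * M * ?u))"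
      by (intro mult_left_mono) auto
    also have "\<dots> = 1 / 2 * ?d" by (simp add: exp_minus field_simps)
    finally show "dist (T v t) (T w t) \<le> 1 / 2 * ?d"
      unfolding T P_def dist_norm by (simp add: scaleR_diff_right[symmetric])
  qed
  then obtain v where v: "T v = v"
    using banach_fix_type[of "1 / 2" T] by auto
  define y where "y t = exp (2 * M * t) *\<^sub>R v t" for t
  have y: "y t = Y v t" if "0 \<le> t" for t
  proof -
    have "y t = exp (2 * M * t) *\<^sub>R P v t" unfolding y_def T[symmetric] v ..
    also have "\<dots> = Y v t" using that unfolding P_def by (simp add: max_absorb2 exp_minus)
    finally show ?thesis .
  qed
  have "(y has_vector_derivative F (y t)) (at t within {0..})" if "0 \<le> t" for t
  proof -
    have "S v t = F (y t)" by (simp add: S_def y_def)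
    then have "(Y v has_vector_derivative F (y t)) (at t within {0..})" using dY[of v t] that by simp
    then show ?thesis
      by (rule has_vector_derivative_transform[rotated 2]) (use that y in auto)
  qed
  moreover have "y 0 = z" using y[of 0] by (simp add: Y_def)
  ultimately show ?thesis by blast
qed

section \<open>Contracting vector fields\<close>

text \<open>The times with \<open>f t \<le> f a + e * (t - a)\<close> form a compact set whose last
  element must be \<open>b\<close>, because the step available at an earlier element leads to a
  later one. One step per time and slope suffices, which suits a distance that need not be
  differentiable.\<close>

lemma nonincreasing_if_upper_right_derivative_nonpos:
  fixes f :: "real \<Rightarrow> real"
  assumes "a \<le> b" and f: "continuous_on {a..b} f"
    and step: "\<And>t e. a \<le> t \<Longrightarrow> t < b \<Longrightarrow> 0 < e \<Longrightarrow> \<exists>h>0. t + h \<le> b \<and> f (t + h) \<le> f t + e * h"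
  shows "f b \<le> f a"
proof (rule field_le_epsilon)
  fix d :: real assume "0 < d"
  \<comment> \<open>The total drift \<open>e * (b - a)\<close> is at most \<open>d\<close>; the
    summand 1 keeps the quotient meaningful for \<open>a = b\<close>.\<close>
  define e where "e = d / (b - a + 1)"
  have e: "0 < e" "e * (b - a) \<le> d" using \<open>0 < d\<close> \<open>a \<le> b\<close> by (auto simp: e_def field_simps)
  let ?S = "{t \<in> {a..b}. f t - e * (t - a) \<le> f a}"
  have "continuous_on {a..b} (\<lambda>t. f t - e * (t - a))" by (intro continuous_intros f)
  then have "closed ({a..b} \<inter> (\<lambda>t. f t - e * (t - a)) -` {..f a})"
    by (intro continuous_closed_preimage) auto
  also have "{a..b} \<inter> (\<lambda>t. f t - e * (t - a)) -` {..f a} = ?S" by auto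
  finally have "closed ?S" .
  moreover have "bounded ?S" by (rule bounded_subset[of "{a..b}"]) auto
  ultimately have "compact ?S" by (simp add: compact_eq_bounded_closed)
  moreover have "?S \<noteq> {}" using \<open>a \<le> b\<close> by (auto intro!: exI[of _ a])
  ultimately obtain m where m: "m \<in> ?S" "\<forall>t\<in>?S. t \<le> m" using compact_attains_sup by blast
  have "m = b"
  proof (rule ccontr)
    assume "m \<noteq> b"
    then obtain h where h: "0 < h" "m + h \<le> b" "f (m + h) \<le> f m + e * h"
      using step[of m e] m(1) e(1) by auto
    then have "m + h \<in> ?S" using m(1) by (auto simp: algebra_simps)
    then show False using m(2) h(1) by auto
  qed
  then show "f b \<le> f a + d" using m(1) e(2) by auto
qed

text \<open>Uses \<open>sqrt (b\<^sup>2 + r) \<le> b + r / (2 b)\<close> and \<open>a\<^sup>2 / b \<ge> 2 c a - c\<^sup>2 b\<close>; the free parameter \<open>c\<close>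
  avoids the quotient \<open>a\<^sup>2 / b\<close>, which is singular where the speed vanishes.\<close>

lemma sqrt_perturbation_le:
  fixes a b c e h y \<beta> :: real
  assumes y: "0 \<le> y" "y\<^sup>2 \<le> b\<^sup>2 + h * (e * b\<^sup>2 - 2 * \<beta> * a\<^sup>2)" and "0 < b" "0 \<le> h" "0 \<le> e" "0 \<le> \<beta>"
  shows "y \<le> (1 + e * h) * b - h * \<beta> * (2 * c * a - c\<^sup>2 * b)"
proof -
  have "0 \<le> (y - b)\<^sup>2" by simp
  then have "2 * b * y \<le> y\<^sup>2 + b\<^sup>2" by (simp add: power2_eq_square algebra_simps)
  also have "\<dots> \<le> 2 * b\<^sup>2 + h * e * b\<^sup>2 - 2 * (h * \<beta>) * a\<^sup>2" using y(2) by (simp add: algebra_simps)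
  also have "\<dots> \<le> 2 * b\<^sup>2 + 2 * (h * e) * b\<^sup>2 - 2 * (h * \<beta>) * (b * (2 * c * a - c\<^sup>2 * b))"
  proof -
    have "0 \<le> (a - c * b)\<^sup>2" by simp
    then have "b * (2 * c * a - c\<^sup>2 * b) \<le> a\<^sup>2" by (simp add: power2_eq_square algebra_simps)
    then have "(h * \<beta>) * (b * (2 * c * a - c\<^sup>2 * b)) \<le> (h * \<beta>) * a\<^sup>2"
      using assms by (intro mult_left_mono) auto
    moreover have "0 \<le> (h * e) * b\<^sup>2" using assms by simp
    ultimately show ?thesis by linarith
  qed
  also have "\<dots> = 2 * b * ((1 + e * h) * b - h * \<beta> * (2 * c * a - c\<^sup>2 * b))"
    by (simp add: power2_eq_square algebra_simps)
  finally show ?thesis using \<open>0 < b\<close> by simp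
qed

text \<open>The squared norm is differentiated jointly in base point and vector, so
  \<open>q'\<close> also records the variation of the metric. Its square root, the speed, is not
  differentiable at zero vectors, which is why derivatives are taken of \<open>q\<close>.\<close>

locale quadratic_form_field =
  fixes q :: "'a::euclidean_space \<Rightarrow> 'a \<Rightarrow> real" and q' :: "'a \<times> 'a \<Rightarrow> ('a \<times> 'a) \<Rightarrow>\<^sub>L real"
  assumes q_deriv: "\<And>w. ((\<lambda>(z, v). q z v) has_derivative blinfun_apply (q' w)) (at w)"
    and q'_cont: "continuous_on UNIV q'"
    and q_pos: "\<And>z v. v \<noteq> 0 \<Longrightarrow> 0 < q z v"
    and q_scale: "\<And>z c v. q z (c *\<^sub>R v) = c\<^sup>2 * q z v"
begin

lemma q_cont: "continuous_on UNIV (\<lambda>(z, v). q z v)"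
  using q_deriv by (meson continuous_at_imp_continuous_on has_derivative_continuous)

lemma q_zero [simp]: "q z 0 = 0"
  using q_scale[of z 0 0] by simp

lemma q_nonneg: "0 \<le> q z v"
  using q_pos[of v z] by (cases "v = 0") auto

sublocale speed_structure "\<lambda>z v. sqrt (q z v)"
proof
  show "continuous_on UNIV (\<lambda>(z, v). sqrt (q z v))"
    using continuous_on_real_sqrt[OF q_cont] by (simp add: case_prod_unfold)
qed (simp_all add: q_pos q_scale real_sqrt_mult)

end

text \<open>\<open>(F z, F' z v)\<close> is the velocity of \<open>(z, v)\<close> under the flow
  together with its linearization, so \<open>contraction\<close> bounds the rate of change of the
  squared norm of a variation. \<open>p\<close> measures the directions with strict decrease and may
  vanish on nonzero vectors.\<close>

locale contracting_field = quadratic_form_field q q'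
  for q :: "'a::euclidean_space \<Rightarrow> 'a \<Rightarrow> real" and q' +
  fixes F :: "'a \<Rightarrow> 'a" and F' :: "'a \<Rightarrow> 'a \<Rightarrow>\<^sub>L 'a" and p :: "'a \<Rightarrow> 'a \<Rightarrow> real" and \<alpha> :: real
  assumes dst_Cauchy_convergent: "\<And>X :: nat \<Rightarrow> 'a. \<forall>e>0. \<exists>N. \<forall>i\<ge>N. \<forall>j\<ge>N. dst (X i) (X j) < e \<Longrightarrow> convergent X"
    and F_deriv: "\<And>z. (F has_derivative blinfun_apply (F' z)) (at z)"
    and F'_cont: "continuous_on UNIV F'"
    and \<alpha>_pos: "0 < \<alpha>"
    and p_cont: "continuous_on UNIV (\<lambda>(z, v). p z v)"
    and p_scale: "\<And>z c v. p z (c *\<^sub>R v) = \<bar>c\<bar> * p z v"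
    and contraction: "\<And>z v. blinfun_apply (q' (z, v)) (F z, blinfun_apply (F' z) v) \<le> - 2 * \<alpha> * (p z v)\<^sup>2"
begin

section \<open>Euler-step estimates, uniform on compact sets\<close>

lemma F_cont: "continuous_on S F"
  using F_deriv by (meson continuous_at_imp_continuous_on has_derivative_continuous)

text \<open>The mean value theorem evaluates the derivative at an intermediate step, uniform
  continuity on a compact set compares it with the derivative at step 0, and there
  \<open>contraction\<close> applies. Unit vectors decide the matter, as both sides are homogeneous
  of degree 2 in \<open>v\<close>.\<close>

lemma euler_step_form:
  assumes K: "compact K" and e: "0 < e"
  shows "\<exists>h0>0. \<forall>h z v. 0 < h \<longrightarrow> h \<le> h0 \<longrightarrow> z \<in> K \<longrightarrow>
    q (z + h *\<^sub>R F z) (v + h *\<^sub>R F' z v) \<le> q z v + h * (e * q z v - 2 * \<alpha> * (p z v)\<^sup>2)"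
proof -
  obtain c where c: "0 < c" "\<And>z v. z \<in> K \<Longrightarrow> c * norm v \<le> sqrt (q z v)"
    using N_equivalent[OF K] by metis
  define \<psi> where "\<psi> = (\<lambda>(z, v, h). blinfun_apply (q' (z + h *\<^sub>R F z, v + h *\<^sub>R F' z v)) (F z, F' z v))"
  let ?D = "K \<times> sphere (0::'a) 1 \<times> {0..1::real}"
  have "compact ?D" by (intro compact_Times K compact_sphere compact_Icc)
  have cz: "continuous_on ?D (\<lambda>w. F (fst w))"
    by (rule continuous_on_compose2[OF F_cont[of UNIV] continuous_on_fst[OF continuous_on_id]]) simp
  have cz': "continuous_on ?D (\<lambda>w. F' (fst w))"
    by (rule continuous_on_compose2[OF F'_cont continuous_on_fst[OF continuous_on_id]]) simp
  have cq: "continuous_on ?D (\<lambda>w. q' (fst w + snd (snd w) *\<^sub>R F (fst w), fst (snd w) + snd (snd w) *\<^sub>R F' (fst w) (fst (snd w))))"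
    by (rule continuous_on_compose2[OF q'_cont]) (auto intro!: continuous_intros cz cz')
  have "continuous_on ?D \<psi>"
    unfolding \<psi>_def case_prod_unfold by (intro continuous_intros cz cz' cq)
  then have "uniformly_continuous_on ?D \<psi>" using \<open>compact ?D\<close> by (rule compact_uniformly_continuous)
  \<comment> \<open>On unit vectors \<open>q z v\<close> is at least \<open>c\<^sup>2\<close>, which
    converts the absolute tolerance \<open>e * c\<^sup>2\<close> into the relative one
    \<open>e * q z v\<close>.\<close>
  moreover have "0 < e * c\<^sup>2" using e c(1) by simp
  ultimately obtain d where d: "0 < d"
    "\<And>w w'. w \<in> ?D \<Longrightarrow> w' \<in> ?D \<Longrightarrow> dist w' w < d \<Longrightarrow> dist (\<psi> w') (\<psi> w) < e * c\<^sup>2"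
    unfolding uniformly_continuous_on_def by metis
  define h0 where "h0 = min 1 (d / 2)"
  have h0: "0 < h0" "h0 \<le> 1" "h0 < d" using d(1) by (auto simp: h0_def)
  have unit: "q (z + h *\<^sub>R F z) (v + h *\<^sub>R F' z v) \<le> q z v + h * (e * q z v - 2 * \<alpha> * (p z v)\<^sup>2)"
    if h: "0 < h" "h \<le> h0" and z: "z \<in> K" and v: "norm v = 1" for h z v
  proof -
    let ?\<phi> = "\<lambda>s. q (z + s *\<^sub>R F z) (v + s *\<^sub>R F' z v)"
    have "(?\<phi> has_real_derivative \<psi> (z, v, s)) (at s)" for s
    proof -
      have "((\<lambda>s. (z + s *\<^sub>R F z, v + s *\<^sub>R F' z v)) has_derivative (\<lambda>s. (s *\<^sub>R F z, s *\<^sub>R F' z v))) (at s)"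
        by (auto intro!: derivative_eq_intros)
      from has_derivative_compose[OF this q_deriv]
      have "(?\<phi> has_derivative (\<lambda>t. q' (z + s *\<^sub>R F z, v + s *\<^sub>R F' z v) (t *\<^sub>R F z, t *\<^sub>R F' z v))) (at s)"
        by simp
      moreover have "(\<lambda>t. blinfun_apply (q' (z + s *\<^sub>R F z, v + s *\<^sub>R F' z v)) (t *\<^sub>R F z, t *\<^sub>R F' z v)) = (*) (\<psi> (z, v, s))"
        unfolding \<psi>_def using blinfun.scaleR_right[of "q' (z + s *\<^sub>R F z, v + s *\<^sub>R F' z v)" _ "(F z, F' z v)"]
        by (auto simp: mult.commute)
      ultimately show ?thesis by (simp add: has_field_derivative_def)
    qed
    then obtain s where s: "0 < s" "s < h" "?\<phi> h - ?\<phi> 0 = (h - 0) * \<psi> (z, v, s)"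
      using MVT2[OF h(1), of ?\<phi> "\<lambda>s. \<psi> (z, v, s)"] by blast
    have "dist (\<psi> (z, v, s)) (\<psi> (z, v, 0)) < e * c\<^sup>2"
      using s h h0 z v by (intro d(2)) (auto simp: dist_Pair_Pair)
    moreover have "\<psi> (z, v, 0) \<le> - 2 * \<alpha> * (p z v)\<^sup>2" using contraction by (simp add: \<psi>_def)
    ultimately have "\<psi> (z, v, s) \<le> e * c\<^sup>2 - 2 * \<alpha> * (p z v)\<^sup>2" by (simp add: dist_real_def)
    also have "c\<^sup>2 \<le> q z v"
      using power_mono[of c "sqrt (q z v)" 2] c(2)[OF z, of v] c(1) v q_nonneg[of z v] by simp
    finally have "\<psi> (z, v, s) \<le> e * q z v - 2 * \<alpha> * (p z v)\<^sup>2" using e by simp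
    then have "h * \<psi> (z, v, s) \<le> h * (e * q z v - 2 * \<alpha> * (p z v)\<^sup>2)" using h by (intro mult_left_mono) auto
    then show ?thesis using s(3) by simp
  qed
  have "q (z + h *\<^sub>R F z) (v + h *\<^sub>R F' z v) \<le> q z v + h * (e * q z v - 2 * \<alpha> * (p z v)\<^sup>2)"
    if h: "0 < h" "h \<le> h0" and z: "z \<in> K" for h z v
  proof (cases "v = 0")
    case True
    then show ?thesis using p_scale[of z 0 0] by (simp add: blinfun.zero_right)
  next
    case False
    define u where "u = (1 / norm v) *\<^sub>R v"
    have u: "norm u = 1" "v = norm v *\<^sub>R u" using False by (auto simp: u_def)
    have "v + h *\<^sub>R F' z v = norm v *\<^sub>R (u + h *\<^sub>R F' z u)"
      by (subst (1 2) u(2)) (simp add: blinfun.scaleR_right scaleR_add_right mult.commute)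
    then have "q (z + h *\<^sub>R F z) (v + h *\<^sub>R F' z v) = (norm v)\<^sup>2 * q (z + h *\<^sub>R F z) (u + h *\<^sub>R F' z u)"
      by (simp only: q_scale)
    also have "\<dots> \<le> (norm v)\<^sup>2 * (q z u + h * (e * q z u - 2 * \<alpha> * (p z u)\<^sup>2))"
      by (intro mult_left_mono unit h z u) simp
    also have "\<dots> = q z (norm v *\<^sub>R u) + h * (e * q z (norm v *\<^sub>R u) - 2 * \<alpha> * (p z (norm v *\<^sub>R u))\<^sup>2)"
      by (simp only: q_scale p_scale) (simp add: algebra_simps power_mult_distrib)
    finally show ?thesis unfolding u(2)[symmetric] .
  qed
  then show ?thesis by (intro exI[of _ h0] conjI h0(1) allI impI)
qed

text \<open>The Euler map moves the whole curve. For fixed \<open>c\<close> the bound of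
  \<open>sqrt_perturbation_le\<close> is linear in the speed and in \<open>p\<close>, hence passes
  to the integrals. With \<open>c = 0\<close> it expresses non-expansion up to a small factor, with
  a tuned \<open>c\<close> a strict gain.\<close>

lemma euler_step_len:
  assumes K: "compact K" and e: "0 < e"
  shows "\<exists>h0>0. \<forall>h g g' c. 0 < h \<longrightarrow> h \<le> h0 \<longrightarrow> C1_curve 0 1 g g' \<longrightarrow> g ` {0..1} \<subseteq> K \<longrightarrow>
    dst (g 0 + h *\<^sub>R F (g 0)) (g 1 + h *\<^sub>R F (g 1))
    \<le> (1 + e * h) * len 0 1 g g' - h * \<alpha> * (2 * c * integral {0..1} (\<lambda>t. p (g t) (g' t)) - c\<^sup>2 * len 0 1 g g')"
proof -
  obtain h0 where h0: "0 < h0" and step: "\<And>h z v. 0 < h \<Longrightarrow> h \<le> h0 \<Longrightarrow> z \<in> K \<Longrightarrow>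
    q (z + h *\<^sub>R F z) (v + h *\<^sub>R F' z v) \<le> q z v + h * (e * q z v - 2 * \<alpha> * (p z v)\<^sup>2)"
    using euler_step_form[OF K e] by blast
  have "dst (g 0 + h *\<^sub>R F (g 0)) (g 1 + h *\<^sub>R F (g 1))
    \<le> (1 + e * h) * len 0 1 g g' - h * \<alpha> * (2 * c * integral {0..1} (\<lambda>t. p (g t) (g' t)) - c\<^sup>2 * len 0 1 g g')"
    if h: "0 < h" "h \<le> h0" and g: "C1_curve 0 1 g g'" "g ` {0..1} \<subseteq> K" for h g g' c
  proof -
    let ?G = "\<lambda>t. g t + h *\<^sub>R F (g t)" and ?G' = "\<lambda>t. g' t + h *\<^sub>R F' (g t) (g' t)"
    have "(?G has_vector_derivative ?G' t) (at t)" if "t \<in> {0..1}" for t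
    proof -
      have d: "(g has_vector_derivative g' t) (at t)" using C1_curve_deriv[OF g(1)] that by simp
      have "((\<lambda>t. F (g t)) has_vector_derivative F' (g t) (g' t)) (at t)"
        using has_derivative_compose[OF d[unfolded has_vector_derivative_def] F_deriv]
        by (simp add: has_vector_derivative_def blinfun.scaleR_right)
      then show ?thesis using d by (auto intro!: derivative_eq_intros)
    qed
    moreover have cF': "continuous_on {0..1} (\<lambda>t. F' (g t))"
      by (rule continuous_on_compose2[OF F'_cont C1_curve_cont[OF g(1)]]) simp
    ultimately have G: "C1_curve 0 1 ?G ?G'"
      unfolding C1_curve_def by (intro conjI ballI continuous_intros C1_curve_cont_deriv[OF g(1)]) auto
    have i1: "(\<lambda>t. sqrt (q (g t) (g' t))) integrable_on {0..1}" by (rule speed_integrable[OF g(1)])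
    have "continuous_on {0..1} (\<lambda>t. p (g t) (g' t))"
      using continuous_on_compose2[OF p_cont, of "{0..1}" "\<lambda>t. (g t, g' t)"]
      by (auto intro!: continuous_intros C1_curve_cont[OF g(1)] C1_curve_cont_deriv[OF g(1)])
    then have i2: "(\<lambda>t. p (g t) (g' t)) integrable_on {0..1}" by (rule integrable_continuous_real)
    let ?rhs = "\<lambda>t. (1 + e * h) * sqrt (q (g t) (g' t)) - h * \<alpha> * (2 * c * p (g t) (g' t) - c\<^sup>2 * sqrt (q (g t) (g' t)))"
    have pt: "sqrt (q (?G t) (?G' t)) \<le> ?rhs t" if "t \<in> {0..1}" for t
    proof (cases "g' t = 0")
      case True
      then show ?thesis using p_scale[of "g t" 0 0] by (simp add: blinfun.zero_right)
    next
      case False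
      have "q (?G t) (?G' t) \<le> q (g t) (g' t) + h * (e * q (g t) (g' t) - 2 * \<alpha> * (p (g t) (g' t))\<^sup>2)"
        using that g(2) by (intro step h) auto
      then show ?thesis
        using h e \<alpha>_pos q_pos[OF False, of "g t"] by (intro sqrt_perturbation_le) (auto simp: q_nonneg)
    qed
    have "len 0 1 ?G ?G' \<le> integral {0..1} ?rhs"
      unfolding len_def using pt
      by (intro integral_le speed_integrable[OF G] integrable_diff integrable_on_mult_right i1 i2) auto
    also have "\<dots> = (1 + e * h) * len 0 1 g g' - h * \<alpha> * (2 * c * integral {0..1} (\<lambda>t. p (g t) (g' t)) - c\<^sup>2 * len 0 1 g g')"
      unfolding len_def using i1 i2 by (simp add: integral_diff integrable_diff integrable_on_mult_right)
    finally show ?thesis using dst_le_len[OF G] by simp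
  qed
  then show ?thesis by (intro exI[of _ h0] conjI h0 allI impI)
qed

text \<open>Nearly minimal curves from a fixed point all lie in one set, compact by
  \<open>compact_closure_dst_ball\<close>, so a single step size from \<open>euler_step_len\<close>
  serves all of them.\<close>

lemma curve_subset_dst_ball:
  assumes g: "C1_curve 0 1 g g'" "len 0 1 g g' \<le> r"
  shows "g ` {0..1} \<subseteq> closure {z. dst (g 0) z \<le> r}"
proof (rule image_subsetI)
  fix t :: real assume t: "t \<in> {0..1}"
  then have "dst (g 0) (g t) \<le> len 0 t g g'"
    using dst_le_len[OF C1_curve_subinterval[OF g(1), of 0 t]] by simp
  also have "\<dots> \<le> r" using len_split[OF g(1), of t] t len_nonneg[of t 1 g g'] g(2) by simp
  finally show "g t \<in> closure {z. dst (g 0) z \<le> r}" by (intro subsetD[OF closure_subset]) simp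
qed

lemma compact_closure_dst_ball: "compact (closure {z. dst x z \<le> r})"
  unfolding compact_closure by (rule Hopf_Rinow[OF dst_Cauchy_convergent])

end

lemma lipschitz_on_cball_of_C1:
  fixes F :: "'a::euclidean_space \<Rightarrow> 'b::real_normed_vector" and F' :: "'a \<Rightarrow> 'a \<Rightarrow>\<^sub>L 'b"
  assumes F: "\<And>z. (F has_derivative blinfun_apply (F' z)) (at z)" and F': "continuous_on UNIV F'"
  obtains M where "0 < M" "\<And>x y. x \<in> cball c R \<Longrightarrow> y \<in> cball c R \<Longrightarrow> norm (F x - F y) \<le> M * norm (x - y)"
proof -
  have "compact (F' ` cball c R)"
    by (intro compact_continuous_image continuous_on_subset[OF F'] compact_cball) simp
  then obtain B where B: "0 < B" "\<And>z. z \<in> cball c R \<Longrightarrow> norm (F' z) \<le> B"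
    using compact_imp_bounded bounded_pos by (metis (no_types, lifting) imageI)
  have "norm (F x - F y) \<le> B * norm (x - y)" if "x \<in> cball c R" "y \<in> cball c R" for x y
    by (rule differentiable_bound[OF convex_cball _ _ that(1) that(2)])
      (use F B in \<open>auto simp: norm_blinfun.rep_eq[symmetric] intro: has_derivative_at_withinI\<close>)
  then show ?thesis using B(1) that by blast
qed

section \<open>Solutions in the presence of an equilibrium\<close>

context contracting_field begin

definition solution_from :: "'a \<Rightarrow> (real \<Rightarrow> 'a) \<Rightarrow> bool" where
  "solution_from z w \<longleftrightarrow> w 0 = z \<and> (\<forall>t\<ge>0. (w has_vector_derivative F (w t)) (at t within {0..}))"

text \<open>The Euler step fixes \<open>e\<close>, so moving a nearly minimal curve from
  \<open>e\<close> to \<open>w t\<close> yields one from \<open>e\<close> to the Euler point. Excess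
  length, growth factor and the deviation of \<open>w\<close> from its tangent each cost at most
  \<open>\<epsilon> * h / 4\<close>.\<close>

lemma dst_equilibrium_step:
  assumes e0: "F e = 0" and "0 < \<epsilon>"
    and w: "(w has_vector_derivative F (w t)) (at t within {t..})"
  shows "\<exists>\<delta>>0. \<forall>h. 0 < h \<longrightarrow> h < \<delta> \<longrightarrow> dst e (w (t + h)) \<le> dst e (w t) + \<epsilon> * h"
proof -
  let ?D = "dst e (w t)" and ?K = "closure {z. dst e z \<le> dst e (w t) + 1}"
  have D: "0 \<le> ?D" by (rule dst_nonneg)
  \<comment> \<open>The curves considered have length at most \<open>?D + 1\<close>, so a growth
    rate \<open>\<eta>\<close> costs at most \<open>\<epsilon> / 4\<close> per unit of time.\<close>
  define \<eta> where "\<eta> = \<epsilon> / (4 * (?D + 1))"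
  have \<eta>: "0 < \<eta>" "\<eta> * (?D + 1) = \<epsilon> / 4" using \<open>0 < \<epsilon>\<close> D by (auto simp: \<eta>_def field_simps)
  obtain h0 where h0: "0 < h0" and step: "\<And>h g g' c. 0 < h \<Longrightarrow> h \<le> h0 \<Longrightarrow> C1_curve 0 1 g g' \<Longrightarrow> g ` {0..1} \<subseteq> ?K \<Longrightarrow>
    dst (g 0 + h *\<^sub>R F (g 0)) (g 1 + h *\<^sub>R F (g 1))
    \<le> (1 + \<eta> * h) * len 0 1 g g' - h * \<alpha> * (2 * c * integral {0..1} (\<lambda>t. p (g t) (g' t)) - c\<^sup>2 * len 0 1 g g')"
    using euler_step_len[OF compact_closure_dst_ball \<eta>(1), of e "?D + 1"] by blast
  obtain C where C: "0 < C" "\<And>z v. z \<in> cball (w t) 1 \<Longrightarrow> sqrt (q z v) \<le> C * norm v"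
    using N_equivalent[OF compact_cball[of "w t" 1]] by metis
  let ?B = "norm (F (w t)) + 1"
  have B: "0 < ?B" by (simp add: add_nonneg_pos)
  obtain h1 where h1: "0 < h1" and lin: "\<And>h. 0 < h \<Longrightarrow> h < h1 \<Longrightarrow>
    norm (w (t + h) - w t - h *\<^sub>R F (w t)) \<le> min 1 (\<epsilon> / (4 * C)) * h"
  proof -
    have "0 < min 1 (\<epsilon> / (4 * C))" using \<open>0 < \<epsilon>\<close> C(1) by simp
    then obtain d where d: "0 < d" "\<And>s. s \<in> {t..} \<Longrightarrow> norm (s - t) < d \<Longrightarrow>
      norm (w s - w t - (s - t) *\<^sub>R F (w t)) \<le> min 1 (\<epsilon> / (4 * C)) * norm (s - t)"
      using w unfolding has_vector_derivative_def has_derivative_within_alt by blast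
    show ?thesis
    proof (rule that[OF d(1)])
      fix h :: real assume "0 < h" "h < d"
      then show "norm (w (t + h) - w t - h *\<^sub>R F (w t)) \<le> min 1 (\<epsilon> / (4 * C)) * h"
        using d(2)[of "t + h"] by simp
    qed
  qed
  \<comment> \<open>\<open>h0\<close> admits the Euler estimate and \<open>h1\<close> the
    linearization; \<open>1 / ?B\<close> keeps the Euler point and \<open>w (t + h)\<close> in the
    unit ball about \<open>w t\<close>, where \<open>C\<close> is valid;
    \<open>1 / \<epsilon>\<close> keeps the curve shorter than \<open>?D + 1\<close>.\<close>
  define \<delta> where "\<delta> = min (min h0 h1) (min (1 / ?B) (1 / \<epsilon>))"
  have "0 < \<delta>" using h0 h1 B \<open>0 < \<epsilon>\<close> by (simp add: \<delta>_def)
  moreover have "dst e (w (t + h)) \<le> ?D + \<epsilon> * h" if h: "0 < h" "h < \<delta>" for h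
  proof -
    have hb: "h \<le> h0" "h < h1" "h * ?B < 1" "h * \<epsilon> < 1"
      using h B \<open>0 < \<epsilon>\<close> by (auto simp: \<delta>_def field_simps)
    have "?D < ?D + h * \<epsilon> / 4" using h \<open>0 < \<epsilon>\<close> by simp
    then obtain g g' where g: "C1_curve 0 1 g g'" "g 0 = e" "g 1 = w t" "len 0 1 g g' < ?D + h * \<epsilon> / 4"
      by (rule dst_lessE)
    have "len 0 1 g g' \<le> ?D + 1" using g(4) hb(4) by simp
    then have "g ` {0..1} \<subseteq> ?K" using curve_subset_dst_ball[OF g(1)] g(2) by simp
    \<comment> \<open>The choice \<open>c = 0\<close> removes the contraction term and leaves
      non-expansion up to the factor \<open>1 + \<eta> * h\<close>.\<close>
    then have "dst e (w t + h *\<^sub>R F (w t)) \<le> (1 + \<eta> * h) * len 0 1 g g'"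
      using step[OF h(1) hb(1) g(1), of 0] g(2,3) e0 by simp
    also have "\<dots> \<le> len 0 1 g g' + h * (\<eta> * (?D + 1))"
      using mult_left_mono[OF \<open>len 0 1 g g' \<le> ?D + 1\<close>, of "\<eta> * h"] \<eta>(1) h(1) by (simp add: algebra_simps)
    also have "\<dots> \<le> ?D + h * \<epsilon> / 2" using g(4) unfolding \<eta>(2) by simp
    finally have 1: "dst e (w t + h *\<^sub>R F (w t)) \<le> ?D + h * \<epsilon> / 2" .
    have l: "norm (w (t + h) - w t - h *\<^sub>R F (w t)) \<le> min 1 (\<epsilon> / (4 * C)) * h" using lin[OF h(1) hb(2)] .
    have nF: "norm (h *\<^sub>R F (w t)) \<le> 1" using hb(3) h(1) by (simp add: algebra_simps)
    have "norm (w (t + h) - w t) \<le> norm (w (t + h) - w t - h *\<^sub>R F (w t)) + norm (h *\<^sub>R F (w t))"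
      using norm_triangle_ineq[of "w (t + h) - w t - h *\<^sub>R F (w t)" "h *\<^sub>R F (w t)"] by simp
    also have "\<dots> \<le> 1 * h + h * norm (F (w t))"
      using l h(1) by (intro add_mono order_trans[OF l] mult_right_mono) auto
    also have "\<dots> \<le> 1" using hb(3) by (simp add: algebra_simps)
    finally have n1: "norm (w (t + h) - w t) \<le> 1" .
    have "dst (w t + h *\<^sub>R F (w t)) (w (t + h)) \<le> C * norm (w (t + h) - (w t + h *\<^sub>R F (w t)))"
      using nF n1 by (intro dst_le_norm[OF convex_cball[of "w t" 1] C(2)])
        (auto simp: dist_norm norm_minus_commute)
    also have "\<dots> \<le> C * (\<epsilon> / (4 * C) * h)"
    proof (rule mult_left_mono)
      have "norm (w (t + h) - (w t + h *\<^sub>R F (w t))) \<le> min 1 (\<epsilon> / (4 * C)) * h"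
        using l by (simp add: algebra_simps)
      also have "\<dots> \<le> \<epsilon> / (4 * C) * h" using h(1) by (intro mult_right_mono) auto
      finally show "norm (w (t + h) - (w t + h *\<^sub>R F (w t))) \<le> \<epsilon> / (4 * C) * h" .
    qed (use C in simp)
    also have "\<dots> = h * \<epsilon> / 4" using C(1) by simp
    finally have "dst e (w (t + h)) \<le> ?D + h * \<epsilon> / 2 + h * \<epsilon> / 4"
      using 1 dst_triangle[of e "w (t + h)" "w t + h *\<^sub>R F (w t)"] by linarith
    also have "\<dots> \<le> ?D + \<epsilon> * h" using h(1) \<open>0 < \<epsilon>\<close> by (simp add: mult.commute)
    finally show ?thesis .
  qed
  ultimately show ?thesis by blast
qed

text \<open>Formulated on a compact interval, since \<open>solution_exists_if_equilibrium\<close>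
  applies it up to an exit time, before a global solution of the original equation is at
  hand.\<close>

lemma dst_equilibrium_antimono:
  assumes e0: "F e = 0" and "a \<le> b"
    and w: "\<And>t. t \<in> {a..b} \<Longrightarrow> (w has_vector_derivative F (w t)) (at t within {a..b})"
  shows "dst e (w b) \<le> dst e (w a)"
proof (rule nonincreasing_if_upper_right_derivative_nonpos[OF \<open>a \<le> b\<close>, of "\<lambda>t. dst e (w t)"])
  have cw: "continuous_on {a..b} w"
    using w has_vector_derivative_continuous by (force simp: continuous_on_eq_continuous_within)
  show "continuous_on {a..b} (\<lambda>t. dst e (w t))"
    by (rule continuous_on_compose2[OF dst_continuous cw]) simp
  fix t \<epsilon> :: real assume t: "a \<le> t" "t < b" "0 < \<epsilon>"
  have "(w has_vector_derivative F (w t)) (at t within {t..b})"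
    using t by (intro has_vector_derivative_within_subset[OF w]) auto
  moreover have "at t within {t..b} = at t within {t..}"
    using t by (intro at_within_nhd[of _ "{..<b}"]) auto
  ultimately obtain \<delta> where \<delta>: "0 < \<delta>" "\<And>h. 0 < h \<Longrightarrow> h < \<delta> \<Longrightarrow> dst e (w (t + h)) \<le> dst e (w t) + \<epsilon> * h"
    using dst_equilibrium_step[OF e0 t(3), of w t] by auto
  then show "\<exists>h>0. t + h \<le> b \<and> dst e (w (t + h)) \<le> dst e (w t) + \<epsilon> * h"
    using t by (intro exI[of _ "min (\<delta> / 2) (b - t)"]) auto
qed

lemma solution_dst_antimono:
  assumes "F e = 0" "solution_from z w" "0 \<le> s" "s \<le> t"
  shows "dst e (w t) \<le> dst e (w s)"
proof (rule dst_equilibrium_antimono)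
  fix r assume r: "r \<in> {s..t}"
  then have "(w has_vector_derivative F (w r)) (at r within {0..})"
    using assms(2,3) by (simp add: solution_from_def)
  then show "(w has_vector_derivative F (w r)) (at r within {s..t})"
    by (rule has_vector_derivative_within_subset) (use assms(3) in auto)
qed fact+

lemma bounded_solution_if_equilibrium:
  assumes "F e = 0" "solution_from z w"
  shows "bounded (w ` {0..})"
proof (rule bounded_subset[OF Hopf_Rinow[OF dst_Cauchy_convergent]])
  show "w ` {0..} \<subseteq> {y. dst e y \<le> dst e (w 0)}"
    using solution_dst_antimono[OF assms] by auto
qed

lemma solution_tendsto_equilibrium:
  assumes e0: "F e = 0" and w: "solution_from z w" and cl: "e \<in> closure (w ` {0..})"
  shows "(w \<longlongrightarrow> e) at_top"
proof (rule dst_tendsto_0_imp, rule tendstoI)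
  fix r :: real assume "0 < r"
  have "((\<lambda>y. dst e y) \<longlongrightarrow> 0) (nhds e)"
    using dst_tendsto_0[OF filterlim_ident] by simp
  then have "\<forall>\<^sub>F y in nhds e. dst e y < r" using \<open>0 < r\<close> by (rule order_tendstoD)
  then obtain d where d: "0 < d" "\<And>y. dist y e < d \<Longrightarrow> dst e y < r"
    by (auto simp: eventually_nhds_metric)
  then obtain s where s: "0 \<le> s" "dist (w s) e < d" using cl by (force simp: closure_approachable)
  have "dst e (w t) < r" if "s \<le> t" for t
    using solution_dst_antimono[OF e0 w s(1) that] d(2)[OF s(2)] by linarith
  then show "\<forall>\<^sub>F t in at_top. dist (dst e (w t)) 0 < r"
    unfolding eventually_at_top_linorder using dst_nonneg by (auto intro!: exI[of _ s])
qed

text \<open>The equilibrium bounds both solutions, so one Lipschitz constant serves them. Then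
  Gronwall's argument applies: \<open>exp (- (2 * M * s))\<close> times the squared difference has
  nonpositive derivative and starts at 0.\<close>

lemma solution_unique:
  assumes e0: "F e = 0" and u: "solution_from z u" and w: "solution_from z w" and "0 \<le> t"
  shows "u t = w t"
proof -
  have "bounded (u ` {0..} \<union> w ` {0..})"
    using bounded_solution_if_equilibrium[OF e0] u w by simp
  then obtain R where R: "\<And>s. 0 \<le> s \<Longrightarrow> u s \<in> cball 0 R \<and> w s \<in> cball 0 R"
    by (auto simp: bounded_iff)
  obtain M where M: "0 < M" "\<And>x y. x \<in> cball 0 R \<Longrightarrow> y \<in> cball 0 R \<Longrightarrow> norm (F x - F y) \<le> M * norm (x - y)"
    using lipschitz_on_cball_of_C1[OF F_deriv F'_cont] by metis
  let ?d = "\<lambda>s. u s - w s"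
  let ?h = "\<lambda>s. exp (- (2 * M * s)) * (?d s \<bullet> ?d s)"
  have d: "(?d has_vector_derivative F (u s) - F (w s)) (at s within {0..})" if "0 \<le> s" for s
    using u w that by (auto simp: solution_from_def intro: has_vector_derivative_diff)
  then have cd: "continuous_on {0..} ?d"
    unfolding continuous_on_eq_continuous_within by (auto intro: has_vector_derivative_continuous)
  have "?h t \<le> ?h 0"
  proof (rule DERIV_nonpos_imp_decreasing_open[OF \<open>0 \<le> t\<close>, of ?h])
    have "continuous_on {0..t} ?d" by (rule continuous_on_subset[OF cd]) auto
    then show "continuous_on {0..t} ?h"
      by (intro continuous_on_mult[OF _ continuous_on_inner] continuous_on_exp continuous_on_minus continuous_on_mult_left continuous_on_id)
    fix s assume s: "0 < s" "s < t"
    have "(?d has_vector_derivative F (u s) - F (w s)) (at s)"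
      using d[of s] s at_within_interior[of s "{0..}"] by simp
    then have "(?d has_derivative (\<lambda>h. h *\<^sub>R (F (u s) - F (w s)))) (at s)"
      by (simp add: has_vector_derivative_def)
    from has_derivative_inner[OF this this]
    have "((\<lambda>s. ?d s \<bullet> ?d s) has_real_derivative 2 * (?d s \<bullet> (F (u s) - F (w s)))) (at s)"
      unfolding has_field_derivative_def by (rule has_derivative_eq_rhs) (simp add: fun_eq_iff inner_commute algebra_simps)
    moreover have "((\<lambda>s. exp (- (2 * M * s))) has_real_derivative exp (- (2 * M * s)) * - (2 * M)) (at s)"
      by (auto intro!: derivative_eq_intros)
    ultimately have "(?h has_real_derivative exp (- (2 * M * s)) * - (2 * M) * (?d s \<bullet> ?d s)
        + 2 * (?d s \<bullet> (F (u s) - F (w s))) * exp (- (2 * M * s))) (at s)"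
      by (rule DERIV_mult[rotated])
    moreover have ring: "x * - (2 * M) * y + 2 * r * x = x * (2 * r - 2 * M * y)" for x y r :: real
      by (simp add: algebra_simps)
    ultimately have "(?h has_real_derivative exp (- (2 * M * s)) * (2 * (?d s \<bullet> (F (u s) - F (w s))) - 2 * M * (?d s \<bullet> ?d s))) (at s)"
      by simp
    moreover have "?d s \<bullet> (F (u s) - F (w s)) \<le> M * (?d s \<bullet> ?d s)"
    proof -
      have "?d s \<bullet> (F (u s) - F (w s)) \<le> norm (?d s) * norm (F (u s) - F (w s))" by (rule norm_cauchy_schwarz)
      also have "\<dots> \<le> norm (?d s) * (M * norm (?d s))"
        using R[of s] s by (intro mult_left_mono M) auto
      finally show ?thesis by (simp add: dot_square_norm power2_eq_square mult_ac)
    qed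
    ultimately show "\<exists>y. (?h has_real_derivative y) (at s) \<and> y \<le> 0"
      by (intro exI conjI) (assumption, auto intro!: mult_nonneg_nonpos)
  qed
  also have "?h 0 = 0" using u w by (simp add: solution_from_def)
  finally have "?d t \<bullet> ?d t \<le> 0" by (simp add: mult_le_0_iff)
  then have "?d t \<bullet> ?d t = 0" using inner_ge_zero by (rule order_antisym)
  then show ?thesis by simp
qed

text \<open>The field is truncated outside a ball containing a \<open>dst\<close>-ball around the equilibrium;
  the solution of the truncated equation never leaves the latter.\<close>

lemma solution_exists_if_equilibrium:
  assumes e0: "F e = 0"
  shows "\<exists>w. solution_from z w"
proof -
  have "bounded {y. dst e y \<le> dst e z}" by (rule Hopf_Rinow[OF dst_Cauchy_convergent])
  then obtain R0 where R0: "\<And>y. dst e y \<le> dst e z \<Longrightarrow> norm y \<le> R0"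
    by (auto simp: bounded_iff)
  \<comment> \<open>The margin 1 places the \<open>dst\<close>-ball strictly inside the Euclidean
    ball, so reaching the sphere of radius \<open>R\<close> will contradict the monotonicity of
    \<open>dst\<close>.\<close>
  define R where "R = \<bar>R0\<bar> + 1"
  have R: "norm y < R" if "dst e y \<le> dst e z" for y using R0[OF that] by (simp add: R_def)
  have "0 < R" by (simp add: R_def)
  let ?B = "cball (0::'a) R"
  \<comment> \<open>The nearest-point projection is 1-Lipschitz, so the composition is bounded,
    globally Lipschitz and equal to \<open>F\<close> on the ball.\<close>
  let ?F = "\<lambda>y. F (closest_point ?B y)"
  have B: "closed ?B" "convex ?B" "?B \<noteq> {}" using \<open>0 < R\<close> by auto
  obtain M where M: "0 < M" "\<And>x y. x \<in> ?B \<Longrightarrow> y \<in> ?B \<Longrightarrow> norm (F x - F y) \<le> M * norm (x - y)"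
    using lipschitz_on_cball_of_C1[OF F_deriv F'_cont] by metis
  have "compact (F ` ?B)" by (intro compact_continuous_image F_cont compact_cball)
  then obtain K where K: "\<And>y. y \<in> ?B \<Longrightarrow> norm (F y) \<le> K"
    using compact_imp_bounded bounded_iff by (metis imageI)
  have lip: "norm (?F x - ?F y) \<le> M * norm (x - y)" for x y
  proof -
    have "norm (?F x - ?F y) \<le> M * norm (closest_point ?B x - closest_point ?B y)"
      by (intro M closest_point_in_set B)
    also have "\<dots> \<le> M * norm (x - y)"
      using closest_point_lipschitz[OF B(2,1,3), of x y] M(1) by (intro mult_left_mono) (auto simp: dist_norm)
    finally show ?thesis .
  qed
  obtain w where w: "w 0 = z" "\<And>t. 0 \<le> t \<Longrightarrow> (w has_vector_derivative ?F (w t)) (at t within {0..})"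
    using global_solution_of_bounded_lipschitz[of ?F M K z, OF lip M(1)] K closest_point_in_set[OF B(1,3)] by blast
  have cw: "continuous_on {0..} (\<lambda>t. norm (w t))"
    using w(2) has_vector_derivative_continuous by (force simp: continuous_on_eq_continuous_within intro: continuous_norm)
  have inB: "norm (w t) < R" if "0 \<le> t" for t
  proof (rule ccontr)
    assume far: "\<not> norm (w t) < R"
    let ?T = "{s \<in> {0..t}. R \<le> norm (w s)}"
    have ct: "continuous_on {0..t} (\<lambda>t. norm (w t))" by (rule continuous_on_subset[OF cw]) auto
    have "closed ({0..t} \<inter> (\<lambda>t. norm (w t)) -` {R..})" by (intro continuous_closed_preimage ct) auto
    also have "{0..t} \<inter> (\<lambda>t. norm (w t)) -` {R..} = ?T" by auto
    finally have "closed ?T" .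
    moreover have "bounded ?T" by (rule bounded_subset[of "{0..t}"]) auto
    ultimately have "compact ?T" by (simp add: compact_eq_bounded_closed)
    moreover have "?T \<noteq> {}" using far that by force
    ultimately obtain \<tau> where \<tau>: "\<tau> \<in> ?T" "\<forall>s\<in>?T. \<tau> \<le> s" using compact_attains_inf by blast
    have "norm (w 0) < R" using R[of z] w(1) by simp
    then obtain s where s: "0 \<le> s" "s \<le> \<tau>" "norm (w s) = R"
      using IVT'[of "\<lambda>t. norm (w t)" 0 R \<tau>] \<tau>(1) continuous_on_subset[OF ct, of "{0..\<tau>}"] by auto
    \<comment> \<open>The level \<open>R\<close> is attained no later than the first time
      \<open>\<tau>\<close> at which the norm is at least \<open>R\<close>, hence at
      \<open>\<tau>\<close> itself; until then the truncated field equals \<open>F\<close>.\<close>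
    then have "s = \<tau>" using \<tau> by force
    have inside: "w r \<in> ?B" if "r \<in> {0..\<tau>}" for r
    proof (cases "r = \<tau>")
      case True
      then show ?thesis using s \<open>s = \<tau>\<close> by simp
    next
      case False
      then show ?thesis using \<tau> that by force
    qed
    have "dst e (w \<tau>) \<le> dst e (w 0)"
    proof (rule dst_equilibrium_antimono[OF e0])
      fix r assume r: "r \<in> {0..\<tau>}"
      then have "(w has_vector_derivative ?F (w r)) (at r within {0..\<tau>})"
        by (intro has_vector_derivative_within_subset[OF w(2)]) auto
      then show "(w has_vector_derivative F (w r)) (at r within {0..\<tau>})"
        using closest_point_self[OF inside[OF r]] by simp
    qed (use \<tau> in auto)
    then show False using R[of "w \<tau>"] w(1) s \<open>s = \<tau>\<close> by simp
  qed
  have "(w has_vector_derivative F (w t)) (at t within {0..})" if "0 \<le> t" for t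
    using w(2)[OF that] closest_point_self[of "w t" ?B] inB[OF that] by simp
  then show ?thesis using w(1) unfolding solution_from_def by blast
qed

text \<open>Along solutions \<open>\<phi> - V / \<alpha>\<close>, where \<open>V z = q z (F z)\<close>, grows at rate at least \<open>V\<close>, because
  contraction bounds the derivative of \<open>V\<close> by \<open>- 2 \<alpha> p\<^sup>2\<close>. So \<open>V\<close> has no positive lower bound.\<close>

lemma equilibrium_in_closure_of_bounded_solution:
  assumes \<phi>: "\<And>z. (\<phi> has_derivative \<phi>' z) (at z)"
    and \<phi>': "\<And>z. \<phi>' z (F z) = q z (F z) - 2 * (p z (F z))\<^sup>2"
    and w: "solution_from z w" and bnd: "bounded (w ` {0..})"
  shows "\<exists>e\<in>closure (w ` {0..}). F e = 0"
proof -
  let ?K = "closure (w ` {0..})"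
  define V where "V z = q z (F z)" for z
  have cV: "continuous_on S V" for S
  proof -
    have "continuous_on S (\<lambda>z. (z, F z))" by (intro continuous_intros F_cont)
    from continuous_on_compose2[OF q_cont this] show ?thesis by (simp add: V_def)
  qed
  have K: "compact ?K" "?K \<noteq> {}" using bnd by (auto simp: compact_closure closure_eq_empty)
  obtain e where e: "e \<in> ?K" "\<And>y. y \<in> ?K \<Longrightarrow> V e \<le> V y"
    using continuous_attains_inf[OF K cV] by blast
  have "\<not> 0 < V e"
  proof
    assume pos: "0 < V e"
    define G where "G z = \<phi> z - V z / \<alpha>" for z
    have c\<phi>: "continuous_on UNIV \<phi>"
      using \<phi> by (meson continuous_at_imp_continuous_on has_derivative_continuous)
    have cG: "continuous_on UNIV G" unfolding G_def using \<alpha>_pos by (intro continuous_intros c\<phi> cV) auto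
    have "bounded (G ` ?K)"
      by (intro compact_imp_bounded compact_continuous_image K continuous_on_subset[OF cG] subset_UNIV)
    then obtain B where B: "\<And>y. y \<in> ?K \<Longrightarrow> \<bar>G y\<bar> \<le> B" by (auto simp: bounded_iff)
    have cw: "continuous_on {0..} w"
      unfolding continuous_on_eq_continuous_within using w
      by (auto simp: solution_from_def intro: has_vector_derivative_continuous)
    have wK: "w t \<in> ?K" if "0 \<le> t" for t using that closure_subset by force
    have grow: "G (w 0) + V e * t \<le> G (w t)" if "0 \<le> t" for t
    proof -
      have "G (w 0) - V e * 0 \<le> G (w t) - V e * t"
      proof (rule DERIV_nonneg_imp_increasing_open[OF that, of "\<lambda>t. G (w t) - V e * t"])
        have "continuous_on {0..t} w"
          using cw by (rule continuous_on_subset) auto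
        then have "continuous_on {0..t} (\<lambda>t. G (w t))"
          by (rule continuous_on_compose2[OF cG]) simp
        then show "continuous_on {0..t} (\<lambda>t. G (w t) - V e * t)" by (intro continuous_intros)
        fix s assume s: "0 < s" "s < t"
        have "(w has_vector_derivative F (w s)) (at s within {0..})" using w s by (simp add: solution_from_def)
        then have "(w has_vector_derivative F (w s)) (at s)" using s at_within_interior[of s "{0..}"] by simp
        then have dw: "(w has_derivative (\<lambda>h. h *\<^sub>R F (w s))) (at s)" by (simp add: has_vector_derivative_def)
        have d1: "((\<lambda>t. \<phi> (w t)) has_derivative (\<lambda>h. \<phi>' (w s) (h *\<^sub>R F (w s)))) (at s)"
          by (rule has_derivative_compose[OF dw \<phi>])
        have "((\<lambda>t. (w t, F (w t))) has_derivative (\<lambda>h. (h *\<^sub>R F (w s), F' (w s) (h *\<^sub>R F (w s))))) (at s)"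
          by (rule has_derivative_Pair[OF dw has_derivative_compose[OF dw F_deriv]])
        from has_derivative_compose[OF this q_deriv]
        have d2: "((\<lambda>t. V (w t)) has_derivative
          (\<lambda>h. q' (w s, F (w s)) (h *\<^sub>R F (w s), F' (w s) (h *\<^sub>R F (w s))))) (at s)"
          by (simp add: V_def)
        let ?q = "blinfun_apply (q' (w s, F (w s))) (F (w s), F' (w s) (F (w s)))"
        have "linear (\<phi>' (w s))" using \<phi> has_derivative_linear by blast
        then have l1: "\<phi>' (w s) (h *\<^sub>R F (w s)) = h * \<phi>' (w s) (F (w s))" for h by (simp add: linear_cmul)
        have l2: "blinfun_apply (q' (w s, F (w s))) (h *\<^sub>R F (w s), F' (w s) (h *\<^sub>R F (w s))) = h * ?q" for h
          using blinfun.scaleR_right[of "q' (w s, F (w s))" h "(F (w s), F' (w s) (F (w s)))"]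
          by (simp add: blinfun.scaleR_right)
        have "((\<lambda>t. G (w t) - V e * t) has_real_derivative (\<phi>' (w s) (F (w s)) - ?q / \<alpha> - V e)) (at s)"
          unfolding G_def has_field_derivative_def
          by (rule has_derivative_eq_rhs[OF has_derivative_diff[OF has_derivative_diff[OF d1
                bounded_linear.has_derivative[OF bounded_linear_divide d2]]
                bounded_linear_imp_has_derivative[OF bounded_linear_mult_right]]])
            (simp add: l1 l2 fun_eq_iff algebra_simps)
        moreover have "0 \<le> \<phi>' (w s) (F (w s)) - ?q / \<alpha> - V e"
        proof -
          have "?q / \<alpha> \<le> - 2 * (p (w s) (F (w s)))\<^sup>2"
            using contraction[of "w s" "F (w s)"] \<alpha>_pos by (simp add: field_simps)
          then show ?thesis using e(2)[OF wK[of s]] s(1) by (simp add: \<phi>' V_def)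
        qed
        ultimately show "\<exists>y. ((\<lambda>t. G (w t) - V e * t) has_real_derivative y) (at s) \<and> 0 \<le> y" by blast
      qed
      then show ?thesis by simp
    qed
    \<comment> \<open>By this time \<open>G\<close> would rise by \<open>2 * B + 1\<close>, more
      than the range \<open>2 * B\<close> available on the closure of the orbit.\<close>
    define t where "t = (2 * B + 1) / V e"
    have "0 \<le> B" using B[OF e(1)] by linarith
    then have "0 \<le> t" "V e * t = 2 * B + 1" using pos by (auto simp: t_def)
    then show False using grow[of t] B[OF wK[of 0]] B[OF wK[of t]] by simp
  qed
  then have "F e = 0" using q_pos[of "F e" e] by (auto simp: V_def)
  then show ?thesis using e(1) by blast
qed

text \<open>A strictly contracted displacement between two equilibria would make their distance decrease,
  although the flow fixes both.\<close>

lemma equilibria_agree: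
  fixes L :: "'a \<Rightarrow> 'b::euclidean_space"
  assumes e0: "F e1 = 0" "F e2 = 0" and L: "bounded_linear L"
    and Lp: "\<And>K. compact K \<Longrightarrow> \<exists>\<kappa>>0. \<forall>z\<in>K. \<forall>v. \<kappa> * norm (L v) \<le> p z v"
  shows "L e1 = L e2"
proof (rule ccontr)
  assume ne: "L e1 \<noteq> L e2"
  interpret L: bounded_linear L by (rule L)
  let ?D = "dst e1 e2"
  define l where "l = ?D + 1"
  have l: "1 \<le> l" using dst_nonneg[of e1 e2] by (simp add: l_def)
  let ?K = "closure {z. dst e1 z \<le> l}"
  have K: "compact ?K" by (rule compact_closure_dst_ball)
  obtain \<kappa> where \<kappa>: "0 < \<kappa>" "\<And>z v. z \<in> ?K \<Longrightarrow> \<kappa> * norm (L v) \<le> p z v" using Lp[OF K] by blast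
  define d where "d = \<kappa> * norm (L e2 - L e1)"
  have d: "0 < d" using \<kappa>(1) ne by (simp add: d_def)
  \<comment> \<open>The rate at which contraction shortens a curve of length at most
    \<open>l\<close> along which \<open>p\<close> has integral at least \<open>d\<close>;
    \<open>\<epsilon>\<close> below lets the Euler error use up half of it.\<close>
  define \<eta> where "\<eta> = \<alpha> * d\<^sup>2 / l"
  have \<eta>: "0 < \<eta>" using \<alpha>_pos d l by (simp add: \<eta>_def)
  define \<epsilon> where "\<epsilon> = \<eta> / (2 * l)"
  have \<epsilon>: "0 < \<epsilon>" "\<epsilon> * l = \<eta> / 2" using \<eta> l by (auto simp: \<epsilon>_def)
  \<comment> \<open>The step \<open>h\<close> is fixed before the curve, because the excess length
    permitted to the curve depends on \<open>h\<close>.\<close>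
  obtain h where h: "0 < h" and step: "\<And>g g' c. C1_curve 0 1 g g' \<Longrightarrow> g ` {0..1} \<subseteq> ?K \<Longrightarrow>
    dst (g 0 + h *\<^sub>R F (g 0)) (g 1 + h *\<^sub>R F (g 1))
    \<le> (1 + \<epsilon> * h) * len 0 1 g g' - h * \<alpha> * (2 * c * integral {0..1} (\<lambda>t. p (g t) (g' t)) - c\<^sup>2 * len 0 1 g g')"
    using euler_step_len[OF K \<epsilon>(1)] by blast
  \<comment> \<open>The bound 1 keeps the curve within length \<open>l\<close>, and
    \<open>h * \<eta> / 2\<close> is the net shortening achieved by the step.\<close>
  have "?D < ?D + min 1 (h * \<eta> / 2)" using h \<eta> by simp
  then obtain g g' where g: "C1_curve 0 1 g g'" "g 0 = e1" "g 1 = e2" "len 0 1 g g' < ?D + min 1 (h * \<eta> / 2)"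
    by (rule dst_lessE)
  let ?len = "len 0 1 g g'" and ?p = "integral {0..1} (\<lambda>t. p (g t) (g' t))"
  have gl: "?len \<le> l" using g(4) by (simp add: l_def)
  have gK: "g ` {0..1} \<subseteq> ?K" using curve_subset_dst_ball[OF g(1) gl] g(2) by simp
  have "d \<le> ?p"
  proof -
    have "((\<lambda>t. L (g' t)) has_integral (L (g 1) - L (g 0))) {0..1}"
    proof (rule fundamental_theorem_of_calculus[where f="\<lambda>t. L (g t)"])
      fix t :: real assume "t \<in> {0..1}"
      then have "(g has_vector_derivative g' t) (at t)" using C1_curve_deriv[OF g(1)] by simp
      then show "((\<lambda>t. L (g t)) has_vector_derivative L (g' t)) (at t within {0..1})"
        by (intro has_vector_derivative_at_within[OF L.has_vector_derivative])
    qed simp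
    then have e: "L e2 - L e1 = integral {0..1} (\<lambda>t. L (g' t))" using g(2,3) by (simp add: integral_unique)
    have cg': "continuous_on {0..1} (\<lambda>t. L (g' t))" by (rule L.continuous_on[OF C1_curve_cont_deriv[OF g(1)]])
    have "continuous_on {0..1} (\<lambda>t. p (g t) (g' t))"
      using continuous_on_compose2[OF p_cont, of "{0..1}" "\<lambda>t. (g t, g' t)"]
      by (auto intro!: continuous_intros C1_curve_cont[OF g(1)] C1_curve_cont_deriv[OF g(1)])
    then have ip: "(\<lambda>t. p (g t) (g' t)) integrable_on {0..1}" by (rule integrable_continuous_real)
    have in': "(\<lambda>t. norm (L (g' t))) integrable_on {0..1}"
      by (intro integrable_continuous_real continuous_on_norm cg')
    have "norm (L e2 - L e1) \<le> integral {0..1} (\<lambda>t. norm (L (g' t)))"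
      unfolding e by (rule integral_norm_bound_integral[OF integrable_continuous_real[OF cg'] in']) simp
    then have "d \<le> integral {0..1} (\<lambda>t. \<kappa> * norm (L (g' t)))"
      unfolding d_def using \<kappa>(1) by (simp add: mult_left_mono)
    also have "\<dots> \<le> ?p"
    proof (rule integral_le[OF integrable_on_mult_right[OF in'] ip])
      fix t :: real assume "t \<in> {0..1}"
      then have "g t \<in> ?K" using gK by blast
      then show "\<kappa> * norm (L (g' t)) \<le> p (g t) (g' t)" by (rule \<kappa>(2))
    qed
    finally show ?thesis .
  qed
  \<comment> \<open>The maximizer of \<open>2 * c * d - c\<^sup>2 * l\<close>, with value
    \<open>d\<^sup>2 / l\<close>.\<close>
  define c where "c = d / l"
  have c: "0 \<le> c" using d l by (simp add: c_def)
  have "\<eta> \<le> \<alpha> * (2 * c * ?p - c\<^sup>2 * ?len)"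
  proof -
    have "c * d = d\<^sup>2 / l" "c\<^sup>2 * l = d\<^sup>2 / l"
      using l by (auto simp: c_def power2_eq_square field_simps)
    moreover have "c * d \<le> c * ?p" using \<open>d \<le> ?p\<close> c by (rule mult_left_mono)
    moreover have "c\<^sup>2 * ?len \<le> c\<^sup>2 * l" using gl by (intro mult_left_mono) auto
    ultimately have "d\<^sup>2 / l \<le> 2 * c * ?p - c\<^sup>2 * ?len" by simp
    then have "\<alpha> * (d\<^sup>2 / l) \<le> \<alpha> * (2 * c * ?p - c\<^sup>2 * ?len)" using \<alpha>_pos by (intro mult_left_mono) auto
    then show ?thesis by (simp add: \<eta>_def)
  qed
  then have "h * \<eta> \<le> h * (\<alpha> * (2 * c * ?p - c\<^sup>2 * ?len))" using h by (intro mult_left_mono) auto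
  moreover have "\<epsilon> * h * ?len \<le> h * (\<eta> / 2)"
  proof -
    have "\<epsilon> * h * ?len \<le> \<epsilon> * h * l" using gl \<epsilon>(1) h by (intro mult_left_mono) auto
    also have "\<dots> = h * (\<epsilon> * l)" by simp
    finally show ?thesis unfolding \<epsilon>(2) .
  qed
  ultimately have "?D \<le> ?len - h * \<eta> / 2"
    using step[OF g(1) gK, of c] g(2,3) e0 by (simp add: algebra_simps)
  then show False using g(4) by simp
qed

end

section \<open>The Riemannian Hessian as a quadratic form\<close>

lemma partial_deriv_eq:
  assumes "(f has_derivative f') (at x)"
  shows "partial_deriv i f x = f' (axis i 1)"
proof -
  have lin: "linear f'" using assms has_derivative_linear by blast
  have "((\<lambda>h. x + h *\<^sub>R axis i 1) has_derivative (\<lambda>h. h *\<^sub>R axis i 1)) (at 0)"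
    by (auto intro!: derivative_eq_intros)
  from has_derivative_compose[OF this, of f f'] assms
  have "((\<lambda>h. f (x + h *\<^sub>R axis i 1)) has_derivative (\<lambda>h. f' (h *\<^sub>R axis i 1))) (at 0)" by simp
  moreover have "(\<lambda>h. f' (h *\<^sub>R axis i 1)) = (*) (f' (axis i 1))"
    by (auto simp: linear_cmul[OF lin])
  ultimately show ?thesis
    unfolding partial_deriv_def by (intro DERIV_imp_deriv) (simp add: has_field_derivative_def)
qed

lemma linear_axis_expansion:
  fixes f :: "real ^ 'n \<Rightarrow> 'b::real_vector"
  assumes "linear f"
  shows "f v = (\<Sum>i\<in>UNIV. v $ i *\<^sub>R f (axis i 1))"
proof -
  have "f v = f (\<Sum>i\<in>UNIV. v $ i *\<^sub>R axis i 1)"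
    using basis_expansion[of v] by (simp add: scalar_mult_eq_scaleR)
  then show ?thesis by (simp add: linear_sum[OF assms] linear_cmul[OF assms])
qed

lemma derivative_eq_grad_inner:
  assumes "(f has_derivative f') (at x)"
  shows "f' v = grad f x \<bullet> v"
  using linear_axis_expansion[OF has_derivative_linear[OF assms], of v]
  by (simp add: grad_def partial_deriv_eq[OF assms] inner_vec_def mult.commute)

lemma matrix_vector_inner_sum:
  fixes A :: "real ^ 'n ^ 'n"
  shows "v \<bullet> (A *v w) = (\<Sum>i\<in>UNIV. \<Sum>j\<in>UNIV. v $ i * w $ j * A $ i $ j)"
  by (simp add: inner_vec_def matrix_vector_mult_def sum_distrib_left mult_ac)

lemma transpose_matrix_inv_symmetric:
  fixes A :: "real ^ 'n ^ 'n"
  assumes "invertible A" "transpose A = A"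
  shows "transpose (matrix_inv A) = matrix_inv A"
proof -
  have "transpose (matrix_inv A) ** A = mat 1"
    using matrix_inv_mult(1)[OF assms(1)] assms(2) by (metis matrix_transpose_mul transpose_mat)
  then show ?thesis
    using matrix_inv_mult(1)[OF assms(1)] by (metis matrix_mul_assoc matrix_mul_lid matrix_mul_rid)
qed

text \<open>\<open>w\<close> is the negative Riemannian gradient. The inverse metric in the
  Christoffel symbols acts on the partial derivatives of \<open>f\<close> and produces
  \<open>- w\<close>, so only derivatives of \<open>M\<close> remain. Two of the three metric terms
  coincide once contracted twice with \<open>v\<close>, which explains the coefficients 1 and
  1/2.\<close>

lemma riem_hessian_form:
  fixes M :: "real ^ 'n \<Rightarrow> real ^ 'n ^ 'n" and f :: "real ^ 'n \<Rightarrow> real"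
  assumes M: "(M has_derivative M') (at x)" and g: "(grad f has_derivative g') (at x)"
    and sym: "transpose (M x) = M x" and inv: "invertible (M x)"
    and w: "M x *v w = - grad f x"
  shows "v \<bullet> (riem_hessian M f x *v v) = v \<bullet> g' v + v \<bullet> (M' v *v w) - 1 / 2 * (v \<bullet> (M' w *v v))"
proof -
  define D where "D k i j = M' (axis k 1) $ i $ j" for k i j
  define P where "P i j = g' (axis i 1) $ j" for i j
  have pM: "partial_deriv k (\<lambda>y. M y $ i $ j) x = D k i j" for i j k
    unfolding D_def
    by (rule partial_deriv_eq) (intro bounded_linear.has_derivative[OF bounded_linear_vec_nth] M)
  have pg: "partial_deriv i (partial_deriv j f) x = P i j" for i j
  proof -
    have "partial_deriv j f = (\<lambda>y. grad f y $ j)" by (simp add: grad_def)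
    moreover have "((\<lambda>y. grad f y $ j) has_derivative (\<lambda>h. g' h $ j)) (at x)"
      by (rule bounded_linear.has_derivative[OF bounded_linear_vec_nth g])
    ultimately show ?thesis using partial_deriv_eq P_def by metis
  qed
  have M'w: "M' u $ i $ j = (\<Sum>k\<in>UNIV. u $ k * D k i j)" for u i j
    using arg_cong[OF linear_axis_expansion[OF has_derivative_linear[OF M], of u], of "\<lambda>A. A $ i $ j"]
    by (simp add: D_def)
  have g'v: "g' v $ j = (\<Sum>i\<in>UNIV. v $ i * P i j)" for j
    using arg_cong[OF linear_axis_expansion[OF has_derivative_linear[OF g], of v], of "\<lambda>u. u $ j"]
    by (simp add: P_def)
  \<comment> \<open>The contraction runs over the first index of the inverse matrix, hence the
    transpose and the symmetry of \<open>M x\<close>.\<close>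
  have w_inv: "(\<Sum>k\<in>UNIV. matrix_inv (M x) $ k $ m * partial_deriv k f x) = - w $ m" for m
  proof -
    have "w = transpose (matrix_inv (M x)) *v (- grad f x)"
      using w matrix_inv_vector_mult_eq[OF inv] transpose_matrix_inv_symmetric[OF inv sym] by simp
    then have "w $ m = (\<Sum>k\<in>UNIV. matrix_inv (M x) $ k $ m * (- grad f x $ k))"
      by (simp add: matrix_vector_mult_def transpose_def)
    then show ?thesis by (simp add: grad_def sum_negf)
  qed
  have "(\<Sum>k\<in>UNIV. christoffel M k i j x * partial_deriv k f x)
    = - (1 / 2) * (\<Sum>m\<in>UNIV. (D j i m + D i j m - D m i j) * w $ m)" for i j
  proof -
    have "(\<Sum>k\<in>UNIV. christoffel M k i j x * partial_deriv k f x)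
      = (\<Sum>k\<in>UNIV. \<Sum>m\<in>UNIV. 1 / 2 * (D j i m + D i j m - D m i j) * (matrix_inv (M x) $ k $ m * partial_deriv k f x))"
      unfolding christoffel_def pM by (simp add: sum_distrib_left sum_distrib_right mult_ac)
    also have "\<dots> = (\<Sum>m\<in>UNIV. 1 / 2 * (D j i m + D i j m - D m i j) * (\<Sum>k\<in>UNIV. matrix_inv (M x) $ k $ m * partial_deriv k f x))"
      by (subst sum.swap) (simp add: sum_distrib_left)
    also have "\<dots> = - (1 / 2) * (\<Sum>m\<in>UNIV. (D j i m + D i j m - D m i j) * w $ m)"
      unfolding w_inv by (simp add: sum_distrib_left sum_negf[symmetric] algebra_simps)
    finally show ?thesis .
  qed
  then have H: "riem_hessian M f x $ i $ j = P i j + 1 / 2 * (\<Sum>m\<in>UNIV. (D j i m + D i j m - D m i j) * w $ m)" for i j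
    unfolding riem_hessian_def pg by simp
  define T where "T = (\<Sum>i\<in>UNIV. \<Sum>j\<in>UNIV. \<Sum>m\<in>UNIV. v $ i * v $ j * w $ m * D j i m)"
  define U where "U = (\<Sum>i\<in>UNIV. \<Sum>j\<in>UNIV. \<Sum>m\<in>UNIV. v $ i * v $ j * w $ m * D m i j)"
  have T': "(\<Sum>i\<in>UNIV. \<Sum>j\<in>UNIV. \<Sum>m\<in>UNIV. v $ i * v $ j * w $ m * D i j m) = T"
    unfolding T_def by (subst sum.swap) (simp add: mult_ac)
  have "v \<bullet> (riem_hessian M f x *v v) = (\<Sum>i\<in>UNIV. \<Sum>j\<in>UNIV. v $ i * v $ j * P i j
      + 1 / 2 * ((\<Sum>m\<in>UNIV. v $ i * v $ j * w $ m * D j i m) + (\<Sum>m\<in>UNIV. v $ i * v $ j * w $ m * D i j m)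
        - (\<Sum>m\<in>UNIV. v $ i * v $ j * w $ m * D m i j)))"
    unfolding matrix_vector_inner_sum H
    by (simp add: sum_distrib_left sum.distrib[symmetric] sum_subtractf[symmetric] algebra_simps)
  also have "\<dots> = (\<Sum>i\<in>UNIV. \<Sum>j\<in>UNIV. v $ i * v $ j * P i j) + 1 / 2 * (T + T - U)"
    by (simp only: sum.distrib sum_subtractf sum_distrib_left[symmetric] T' T_def[symmetric] U_def[symmetric])
  also have "(\<Sum>i\<in>UNIV. \<Sum>j\<in>UNIV. v $ i * v $ j * P i j) = v \<bullet> g' v"
    unfolding inner_vec_def g'v
    by (subst sum.swap) (simp add: sum_distrib_left mult_ac)
  also have "T = v \<bullet> (M' v *v w)"
    unfolding T_def matrix_vector_inner_sum M'w sum_distrib_left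
    by (rule sum.cong[OF refl], subst sum.swap) (simp add: mult_ac)
  also have "U = v \<bullet> (M' w *v v)"
    unfolding U_def matrix_vector_inner_sum M'w sum_distrib_left by (simp add: mult_ac)
  finally show ?thesis by simp
qed

lemma pos_def_invertible:
  fixes A :: "real ^ 'n ^ 'n"
  assumes "\<And>v. v \<noteq> 0 \<Longrightarrow> 0 < v \<bullet> (A *v v)"
  shows "invertible A"
  unfolding invertible_left_inverse matrix_left_invertible_ker
  using assms by (metis inner_zero_right less_irrefl)

text \<open>\<open>A\<close> is the velocity prescribed by \<open>M x *v A = - grad f x\<close> and \<open>A'\<close> its derivative along a
  variation \<open>a\<close> of \<open>x\<close>; \<open>c\<close> is the contribution of varying the other argument of the cost.\<close>

lemma metric_variation_eq_hessian:
  fixes M :: "real ^ 'n \<Rightarrow> real ^ 'n ^ 'n"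
  assumes M: "(M has_derivative M') (at x)" and g: "(grad f has_derivative g') (at x)"
    and sym: "transpose (M x) = M x" and inv: "invertible (M x)"
    and A: "M x *v A = - grad f x" and A': "M' a *v A + M x *v A' = - (g' a + c)"
  shows "2 * (a \<bullet> (M x *v A')) + a \<bullet> (M' A *v a) = - 2 * (a \<bullet> (riem_hessian M f x *v a)) - 2 * (a \<bullet> c)"
proof -
  have "M x *v A' = - (g' a + c) - M' a *v A" using A' by (simp add: algebra_simps)
  then have "a \<bullet> (M x *v A') = - (a \<bullet> g' a) - a \<bullet> c - a \<bullet> (M' a *v A)"
    by (simp add: inner_diff_right inner_add_right inner_minus_right)
  then show ?thesis unfolding riem_hessian_form[OF M g sym inv A] by simp
qed

lemma symmetric_matrix_inner:
  fixes A :: "real ^ 'n ^ 'n"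
  assumes "transpose A = A"
  shows "u \<bullet> (A *v v) = v \<bullet> (A *v u)"
  using dot_lmul_matrix[of u A v] assms by (metis inner_commute transpose_matrix_vector)

section \<open>Primal-dual dynamics\<close>

lemma bounded_bilinear_matrix_vector_mult:
  "bounded_bilinear (\<lambda>(A :: real ^ 'n ^ 'm) (x :: real ^ 'n). A *v x)"
  unfolding bilinear_conv_bounded_bilinear[symmetric] bilinear_def
  by (auto intro!: linearI simp: matrix_vector_mult_add_rdistrib matrix_vector_right_distrib
      scaleR_matrix_vector_assoc matrix_vector_mult_scaleR)

lemma riemannian_metricD:
  fixes M :: "real ^ 'n \<Rightarrow> real ^ 'n ^ 'n"
  assumes "riemannian_metric M"
  shows "C1_map M" "transpose (M x) = M x" "v \<noteq> 0 \<Longrightarrow> 0 < v \<bullet> (M x *v v)" "0 \<le> v \<bullet> (M x *v v)" "invertible (M x)"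
proof -
  show M: "C1_map M" "transpose (M x) = M x" and pos: "v \<noteq> 0 \<Longrightarrow> 0 < v \<bullet> (M x *v v)" for v
    using assms by (auto simp: riemannian_metric_def)
  show "0 \<le> v \<bullet> (M x *v v)" using pos[of v] by (cases "v = 0") auto
  show "invertible (M x)" by (rule pos_def_invertible) (rule pos)
qed

locale primal_dual =
  fixes L :: "real ^ 'n \<Rightarrow> real ^ 'm \<Rightarrow> real"
    and Mx :: "real ^ 'n \<Rightarrow> real ^ 'n ^ 'n" and Ml :: "real ^ 'm \<Rightarrow> real ^ 'm ^ 'm"
  assumes L_C2: "C2_map (\<lambda>(x, l). L x l)"
    and metric_x: "riemannian_metric Mx" and metric_l: "riemannian_metric Ml"
begin

definition grad_x :: "(real ^ 'n) \<times> (real ^ 'm) \<Rightarrow> real ^ 'n" where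
  "grad_x z = grad (\<lambda>y. L y (snd z)) (fst z)"

definition grad_l :: "(real ^ 'n) \<times> (real ^ 'm) \<Rightarrow> real ^ 'm" where
  "grad_l z = grad (\<lambda>k. L (fst z) k) (snd z)"

definition velocity :: "(real ^ 'n) \<times> (real ^ 'm) \<Rightarrow> (real ^ 'n) \<times> (real ^ 'm)" where
  "velocity z = (matrix_inv (Mx (fst z)) *v - grad_x z, matrix_inv (Ml (snd z)) *v grad_l z)"

definition q :: "(real ^ 'n) \<times> (real ^ 'm) \<Rightarrow> (real ^ 'n) \<times> (real ^ 'm) \<Rightarrow> real" where
  "q z v = fst v \<bullet> (Mx (fst z) *v fst v) + snd v \<bullet> (Ml (snd z) *v snd v)"

text \<open>Only the primal part of the norm: mere concavity in \<open>l\<close> guarantees no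
  strict decrease in dual directions.\<close>

definition p :: "(real ^ 'n) \<times> (real ^ 'm) \<Rightarrow> (real ^ 'n) \<times> (real ^ 'm) \<Rightarrow> real" where
  "p z v = sqrt (fst v \<bullet> (Mx (fst z) *v fst v))"

lemma L_derivatives:
  obtains L' L'' where "\<And>z. ((\<lambda>(x, l). L x l) has_derivative blinfun_apply (L' z)) (at z)"
    "\<And>z. (L' has_derivative blinfun_apply (L'' z)) (at z)" "continuous_on UNIV L''"
  using L_C2 unfolding C2_map_def C1_map_def by blast

lemma has_derivative_x_slice:
  assumes "((\<lambda>(x, l). f x l) has_derivative f') (at z)"
  shows "((\<lambda>y. f y (snd z)) has_derivative (\<lambda>a. f' (a, 0))) (at (fst z))"
proof -
  have "((\<lambda>y. (y, snd z)) has_derivative (\<lambda>a. (a, 0))) (at (fst z))"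
    by (auto intro!: derivative_eq_intros)
  from has_derivative_compose[OF this, of "\<lambda>(x, l). f x l" f'] assms show ?thesis by simp
qed

lemma has_derivative_l_slice:
  assumes "((\<lambda>(x, l). f x l) has_derivative f') (at z)"
  shows "((\<lambda>k. f (fst z) k) has_derivative (\<lambda>b. f' (0, b))) (at (snd z))"
proof -
  have "((\<lambda>k. (fst z, k)) has_derivative (\<lambda>b. (0, b))) (at (snd z))"
    by (auto intro!: derivative_eq_intros)
  from has_derivative_compose[OF this, of "\<lambda>(x, l). f x l" f'] assms show ?thesis by simp
qed

lemma grad_x_inner:
  assumes "((\<lambda>(x, l). L x l) has_derivative L') (at z)"
  shows "grad_x z \<bullet> a = L' (a, 0)"
  unfolding grad_x_def using derivative_eq_grad_inner[OF has_derivative_x_slice[OF assms]] by simp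

lemma grad_l_inner:
  assumes "((\<lambda>(x, l). L x l) has_derivative L') (at z)"
  shows "grad_l z \<bullet> b = L' (0, b)"
  unfolding grad_l_def using derivative_eq_grad_inner[OF has_derivative_l_slice[OF assms]] by simp

lemma C1_map_grad: "C1_map grad_x" "C1_map grad_l"
proof -
  obtain L' L'' where L': "\<And>z. ((\<lambda>(x, l). L x l) has_derivative blinfun_apply (L' z)) (at z)"
    and L'': "\<And>z. (L' has_derivative blinfun_apply (L'' z)) (at z)" "continuous_on UNIV L''"
    by (rule L_derivatives) blast
  have C1: "C1_map L'" using L'' unfolding C1_map_def by blast
  have app: "bounded_linear (\<lambda>f :: ((real ^ 'n) \<times> (real ^ 'm)) \<Rightarrow>\<^sub>L real. blinfun_apply f v)" for v
    by (rule blinfun.bounded_linear_left)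
  have "grad_x z $ i = L' z (axis i 1, 0)" for z i
    using grad_x_inner[OF L', of z "axis i 1"] by (simp add: inner_axis)
  then show "C1_map grad_x"
    by (intro C1_map_vec) (simp add: C1_map_linear_compose[OF app C1])
  have "grad_l z $ i = L' z (0, axis i 1)" for z i
    using grad_l_inner[OF L', of z "axis i 1"] by (simp add: inner_axis)
  then show "C1_map grad_l"
    by (intro C1_map_vec) (simp add: C1_map_linear_compose[OF app C1])
qed

lemma C1_map_metric_fst: "C1_map (\<lambda>z :: (real ^ 'n) \<times> (real ^ 'm). Mx (fst z))"
  by (rule C1_map_compose[OF C1_map_bounded_linear[OF bounded_linear_fst] riemannian_metricD(1)[OF metric_x]])

lemma C1_map_metric_snd: "C1_map (\<lambda>z :: (real ^ 'n) \<times> (real ^ 'm). Ml (snd z))"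
  by (rule C1_map_compose[OF C1_map_bounded_linear[OF bounded_linear_snd] riemannian_metricD(1)[OF metric_l]])

lemma C1_map_velocity: "C1_map velocity"
  unfolding velocity_def
  by (intro C1_map_Pair C1_map_matrix_inv_vector_mult C1_map_metric_fst C1_map_metric_snd C1_map_grad
      C1_map_linear_compose[OF bounded_linear_minus[OF bounded_linear_ident]] riemannian_metricD(5) metric_x metric_l)

lemma C1_map_q: "C1_map (\<lambda>(z, v). q z v)"
proof -
  note comp = bounded_linear_compose
  note lin = comp[OF bounded_linear_fst bounded_linear_fst, THEN C1_map_bounded_linear]
    comp[OF bounded_linear_fst bounded_linear_snd, THEN C1_map_bounded_linear]
    comp[OF bounded_linear_snd bounded_linear_fst, THEN C1_map_bounded_linear]
    comp[OF bounded_linear_snd bounded_linear_snd, THEN C1_map_bounded_linear]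
  show ?thesis
    unfolding q_def case_prod_unfold
    by (intro C1_map_add bounded_bilinear.C1_map[OF bounded_bilinear_inner]
        bounded_bilinear.C1_map[OF bounded_bilinear_matrix_vector_mult] lin
        C1_map_compose[OF lin(1) riemannian_metricD(1)[OF metric_x]]
        C1_map_compose[OF lin(3) riemannian_metricD(1)[OF metric_l]])
qed

lemma q_pos: "v \<noteq> 0 \<Longrightarrow> 0 < q z v"
  unfolding q_def
  using riemannian_metricD(3,4)[OF metric_x, of "fst v" "fst z"] riemannian_metricD(3,4)[OF metric_l, of "snd v" "snd z"]
  by (metis add_nonneg_pos add_pos_nonneg prod_eq_iff zero_prod_def fst_conv snd_conv)

lemma q_scale: "q z (c *\<^sub>R v) = c\<^sup>2 * q z v"
  by (simp add: q_def matrix_vector_mult_scaleR power2_eq_square algebra_simps)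

lemma p_scale: "p z (c *\<^sub>R v) = \<bar>c\<bar> * p z v"
  by (simp add: p_def matrix_vector_mult_scaleR real_sqrt_mult[symmetric] flip: real_sqrt_abs)
    (simp add: power2_eq_square mult_ac)

lemma p_square: "(p z v)\<^sup>2 = fst v \<bullet> (Mx (fst z) *v fst v)"
  by (simp add: p_def riemannian_metricD(4)[OF metric_x])

lemma velocity_eqs: "Mx (fst z) *v fst (velocity z) = - grad_x z" "Ml (snd z) *v snd (velocity z) = grad_l z"
  using matrix_inv_vector_mult_eq[OF riemannian_metricD(5)[OF metric_x]]
    matrix_inv_vector_mult_eq[OF riemannian_metricD(5)[OF metric_l]] by (auto simp: velocity_def)

lemma primal_dual_velocity_iff: "primal_dual_velocity L Mx Ml x l x' l' \<longleftrightarrow> (x', l') = velocity (x, l)"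
  unfolding primal_dual_velocity_def velocity_def
    matrix_inv_vector_mult_eq[OF riemannian_metricD(5)[OF metric_x]]
    matrix_inv_vector_mult_eq[OF riemannian_metricD(5)[OF metric_l]]
  by (simp add: grad_x_def grad_l_def)

lemma primal_dual_solution_iff:
  "primal_dual_solution L Mx Ml x l \<longleftrightarrow>
    (\<forall>t\<ge>0. ((\<lambda>t. (x t, l t)) has_vector_derivative velocity (x t, l t)) (at t within {0..}))"
proof -
  have "(\<exists>x' l'. (x has_vector_derivative x') (at s within S) \<and> (l has_vector_derivative l') (at s within S) \<and> (x', l') = V)
    \<longleftrightarrow> ((\<lambda>t. (x t, l t)) has_vector_derivative V) (at s within S)" for s S V
  proof
    assume "\<exists>x' l'. (x has_vector_derivative x') (at s within S) \<and> (l has_vector_derivative l') (at s within S) \<and> (x', l') = V"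
    then obtain x' l' where d: "(x has_vector_derivative x') (at s within S)" "(l has_vector_derivative l') (at s within S)" "V = (x', l')" by auto
    show "((\<lambda>t. (x t, l t)) has_vector_derivative V) (at s within S)"
      using has_derivative_Pair[OF d(1,2)[unfolded has_vector_derivative_def]]
      by (simp add: has_vector_derivative_def d(3))
  next
    assume d: "((\<lambda>t. (x t, l t)) has_vector_derivative V) (at s within S)"
    show "\<exists>x' l'. (x has_vector_derivative x') (at s within S) \<and> (l has_vector_derivative l') (at s within S) \<and> (x', l') = V"
      using bounded_linear.has_vector_derivative[OF bounded_linear_fst d]
        bounded_linear.has_vector_derivative[OF bounded_linear_snd d]
      by (intro exI[of _ "fst V"] exI[of _ "snd V"]) simp
  qed
  then show ?thesis unfolding primal_dual_solution_def primal_dual_velocity_iff by simp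
qed

text \<open>Descent in \<open>x\<close> contributes minus the squared speed of \<open>x\<close>,
  ascent in \<open>l\<close> plus that of \<open>l\<close>. In terms of the full \<open>q\<close>
  this is the form required of \<open>\<phi>\<close> in
  \<open>equilibrium_in_closure_of_bounded_solution\<close>.\<close>

lemma L_derivative_along_velocity:
  assumes "((\<lambda>(x, l). L x l) has_derivative L') (at z)"
  shows "L' (velocity z) = q z (velocity z) - 2 * (p z (velocity z))\<^sup>2"
proof -
  let ?A = "fst (velocity z)" and ?B = "snd (velocity z)"
  have "L' (velocity z) = L' ((?A, 0) + (0, ?B))" by simp
  also have "\<dots> = grad_x z \<bullet> ?A + grad_l z \<bullet> ?B"
    unfolding linear_add[OF has_derivative_linear[OF assms]] grad_x_inner[OF assms] grad_l_inner[OF assms] ..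
  also have "\<dots> = - (?A \<bullet> (Mx (fst z) *v ?A)) + ?B \<bullet> (Ml (snd z) *v ?B)"
    unfolding velocity_eqs by (simp add: inner_commute)
  finally show ?thesis unfolding p_square q_def by simp
qed

text \<open>The linearized velocity is eliminated through the implicit equations, and the metric
  terms assemble into the two Hessians. The mixed derivatives of \<open>L\<close> enter with
  opposite signs because \<open>x\<close> descends while \<open>l\<close> ascends.\<close>

lemma q_derivative_along_velocity:
  assumes q': "((\<lambda>(z, v). q z v) has_derivative q') (at (z, v))" and V': "(velocity has_derivative V') (at z)"
  shows "q' (velocity z, V' v)
    = - 2 * (fst v \<bullet> (riem_hessian Mx (\<lambda>x. L x (snd z)) (fst z) *v fst v))
      - 2 * (snd v \<bullet> (riem_hessian Ml (\<lambda>l. - L (fst z) l) (snd z) *v snd v))"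
proof -
  obtain L' L'' where L': "\<And>z. ((\<lambda>(x, l). L x l) has_derivative blinfun_apply (L' z)) (at z)"
    and L'': "\<And>z. (L' has_derivative blinfun_apply (L'' z)) (at z)" "continuous_on UNIV L''"
    by (rule L_derivatives) blast
  obtain Mx' where Mx': "\<And>x. (Mx has_derivative blinfun_apply (Mx' x)) (at x)"
    using riemannian_metricD(1)[OF metric_x] by (rule C1_mapE) blast
  obtain Ml' where Ml': "\<And>x. (Ml has_derivative blinfun_apply (Ml' x)) (at x)"
    using riemannian_metricD(1)[OF metric_l] by (rule C1_mapE) blast
  obtain gx' where gx': "\<And>z. (grad_x has_derivative blinfun_apply (gx' z)) (at z)"
    using C1_map_grad(1) by (rule C1_mapE) blast
  obtain gl' where gl': "\<And>z. (grad_l has_derivative blinfun_apply (gl' z)) (at z)"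
    using C1_map_grad(2) by (rule C1_mapE) blast
  obtain x l where z: "z = (x, l)" by (cases z)
  obtain a b where v: "v = (a, b)" by (cases v)
  let ?A = "fst (velocity z)" and ?B = "snd (velocity z)" and ?A' = "fst (V' v)" and ?B' = "snd (V' v)"
  note mv = bounded_bilinear.FDERIV[OF bounded_bilinear_matrix_vector_mult]
  note inn = has_derivative_inner
  have dx: "((\<lambda>w. Mx (fst w)) has_derivative (\<lambda>h. Mx' x (fst h))) (at z)"
    using has_derivative_compose[OF bounded_linear_imp_has_derivative[OF bounded_linear_fst] Mx', of z] by (simp add: z)
  have dl: "((\<lambda>w. Ml (snd w)) has_derivative (\<lambda>h. Ml' l (snd h))) (at z)"
    using has_derivative_compose[OF bounded_linear_imp_has_derivative[OF bounded_linear_snd] Ml', of z] by (simp add: z)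
  have q'_eq: "q' (u, w) = (fst w \<bullet> (Mx x *v a) + a \<bullet> (Mx' x (fst u) *v a + Mx x *v fst w))
      + (snd w \<bullet> (Ml l *v b) + b \<bullet> (Ml' l (snd u) *v b + Ml l *v snd w))" for u w
  proof -
    have dfs: "((\<lambda>w. fst (snd w)) has_derivative (\<lambda>h. fst (snd h))) (at (z, v))"
      and dss: "((\<lambda>w. snd (snd w)) has_derivative (\<lambda>h. snd (snd h))) (at (z, v))"
      for z :: "(real ^ 'n) \<times> (real ^ 'm)" and v :: "(real ^ 'n) \<times> (real ^ 'm)"
      by (intro bounded_linear_imp_has_derivative bounded_linear_intros)+
    have dfst: "(fst has_derivative fst) (at (z, v))"
      by (rule bounded_linear_imp_has_derivative[OF bounded_linear_fst])
    have d1: "((\<lambda>w. Mx (fst (fst w))) has_derivative (\<lambda>h. Mx' x (fst (fst h)))) (at (z, v))"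
      using has_derivative_compose[OF dfst, of "\<lambda>w. Mx (fst w)"] dx by simp
    have d2: "((\<lambda>w. Ml (snd (fst w))) has_derivative (\<lambda>h. Ml' l (snd (fst h)))) (at (z, v))"
      using has_derivative_compose[OF dfst, of "\<lambda>w. Ml (snd w)"] dl by simp
    have "((\<lambda>(z, v). q z v) has_derivative (\<lambda>h.
        (a \<bullet> (Mx x *v fst (snd h) + Mx' x (fst (fst h)) *v a) + fst (snd h) \<bullet> (Mx x *v a))
      + (b \<bullet> (Ml l *v snd (snd h) + Ml' l (snd (fst h)) *v b) + snd (snd h) \<bullet> (Ml l *v b)))) (at (z, v))"
      unfolding q_def case_prod_unfold
      using has_derivative_add[OF inn[OF dfs mv[OF d1 dfs]] inn[OF dss mv[OF d2 dss]]] by (simp add: z v)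
    from fun_cong[OF has_derivative_unique[OF q' this], of "(u, w)"]
    show ?thesis by (simp add: add_ac)
  qed
  have dV: "((\<lambda>z. fst (velocity z)) has_derivative (\<lambda>h. fst (V' h))) (at z)"
    "((\<lambda>z. snd (velocity z)) has_derivative (\<lambda>h. snd (V' h))) (at z)"
    using bounded_linear.has_derivative[OF bounded_linear_fst V'] bounded_linear.has_derivative[OF bounded_linear_snd V'] by auto
  \<comment> \<open>Differentiating the implicit equation rather than the formula for
    \<open>velocity\<close> avoids the derivative of the inverse matrix.\<close>
  have eA: "Mx' x a *v ?A + Mx x *v ?A' = - gx' z v"
  proof -
    have "((\<lambda>z. Mx (fst z) *v fst (velocity z)) has_derivative (\<lambda>h. Mx x *v fst (V' h) + Mx' x (fst h) *v ?A)) (at z)"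
      using mv[OF dx dV(1)] by (simp add: z)
    moreover have "((\<lambda>z. Mx (fst z) *v fst (velocity z)) has_derivative (\<lambda>h. - gx' z h)) (at z)"
      unfolding velocity_eqs by (intro has_derivative_minus gx')
    ultimately show ?thesis using has_derivative_unique v by (metis (no_types, lifting) add.commute fst_conv)
  qed
  have eB: "Ml' l b *v ?B + Ml l *v ?B' = gl' z v"
  proof -
    have "((\<lambda>z. Ml (snd z) *v snd (velocity z)) has_derivative (\<lambda>h. Ml l *v snd (V' h) + Ml' l (snd h) *v ?B)) (at z)"
      using mv[OF dl dV(2)] by (simp add: z)
    moreover have "((\<lambda>z. Ml (snd z) *v snd (velocity z)) has_derivative (\<lambda>h. gl' z h)) (at z)"
      unfolding velocity_eqs by (rule gl')
    ultimately show ?thesis using has_derivative_unique v by (metis (no_types, lifting) add.commute snd_conv)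
  qed
  have gx: "grad (\<lambda>y. L y l) = (\<lambda>y. grad_x (y, l))" by (simp add: grad_x_def fun_eq_iff)
  have dgx: "(grad (\<lambda>y. L y l) has_derivative (\<lambda>a. gx' z (a, 0))) (at x)"
    unfolding gx using has_derivative_x_slice[of "\<lambda>x l. grad_x (x, l)" "gx' z" z] gx'[of z] by (simp add: z)
  \<comment> \<open>Ascent of \<open>L\<close> in \<open>l\<close> is descent of its negative, so
    \<open>metric_variation_eq_hessian\<close> serves both parts.\<close>
  have neg: "grad (\<lambda>k. - L x k) = (\<lambda>k. - grad_l (x, k))"
  proof
    fix k
    note d = has_derivative_l_slice[OF L', of "(x, k)", simplified]
    show "grad (\<lambda>k. - L x k) k = - grad_l (x, k)"
      unfolding grad_def grad_l_def vec_eq_iff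
      using partial_deriv_eq[OF d] partial_deriv_eq[OF has_derivative_minus[OF d]] by (simp add: grad_def)
  qed
  have dgl: "(grad (\<lambda>k. - L x k) has_derivative (\<lambda>b. - gl' z (0, b))) (at l)"
    unfolding neg using has_derivative_minus[OF has_derivative_l_slice[of "\<lambda>x l. grad_l (x, l)" "gl' z" z]] gl'[of z] by (simp add: z)
  have split_x: "gx' z v = gx' z (a, 0) + gx' z (0, b)"
    using blinfun.add_right[of "gx' z" "(a, 0)" "(0, b)"] by (simp add: v)
  have split_l: "gl' z v = gl' z (a, 0) + gl' z (0, b)"
    using blinfun.add_right[of "gl' z" "(a, 0)" "(0, b)"] by (simp add: v)
  have hx: "2 * (a \<bullet> (Mx x *v ?A')) + a \<bullet> (Mx' x ?A *v a)
    = - 2 * (a \<bullet> (riem_hessian Mx (\<lambda>y. L y l) x *v a)) - 2 * (a \<bullet> gx' z (0, b))"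
  proof (rule metric_variation_eq_hessian[OF Mx' dgx riemannian_metricD(2,5)[OF metric_x]])
    show "Mx x *v ?A = - grad (\<lambda>y. L y l) x" using velocity_eqs(1)[of z] by (simp add: gx z)
    show "Mx' x a *v ?A + Mx x *v ?A' = - (gx' z (a, 0) + gx' z (0, b))"
      unfolding eA split_x ..
  qed
  have hl: "2 * (b \<bullet> (Ml l *v ?B')) + b \<bullet> (Ml' l ?B *v b)
    = - 2 * (b \<bullet> (riem_hessian Ml (\<lambda>k. - L x k) l *v b)) - 2 * (b \<bullet> (- gl' z (a, 0)))"
  proof (rule metric_variation_eq_hessian[OF Ml' dgl riemannian_metricD(2,5)[OF metric_l]])
    show "Ml l *v ?B = - grad (\<lambda>k. - L x k) l" using velocity_eqs(2)[of z] by (simp add: neg z)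
    show "Ml' l b *v ?B + Ml l *v ?B' = - (- gl' z (0, b) + - gl' z (a, 0))"
      unfolding eB split_l by simp
  qed
  have L''_x: "gx' z h \<bullet> a = L'' z h (a, 0)" for h
  proof -
    have "((\<lambda>z. grad_x z \<bullet> a) has_derivative (\<lambda>h. gx' z h \<bullet> a)) (at z)"
      by (rule bounded_linear.has_derivative[OF bounded_linear_inner_left gx'])
    moreover have "((\<lambda>z. grad_x z \<bullet> a) has_derivative (\<lambda>h. L'' z h (a, 0))) (at z)"
      unfolding grad_x_inner[OF L'] by (rule bounded_linear.has_derivative[OF blinfun.bounded_linear_left L''(1)])
    ultimately show ?thesis using has_derivative_unique by metis
  qed
  have L''_l: "gl' z h \<bullet> b = L'' z h (0, b)" for h
  proof -
    have "((\<lambda>z. grad_l z \<bullet> b) has_derivative (\<lambda>h. gl' z h \<bullet> b)) (at z)"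
      by (rule bounded_linear.has_derivative[OF bounded_linear_inner_left gl'])
    moreover have "((\<lambda>z. grad_l z \<bullet> b) has_derivative (\<lambda>h. L'' z h (0, b))) (at z)"
      unfolding grad_l_inner[OF L'] by (rule bounded_linear.has_derivative[OF blinfun.bounded_linear_left L''(1)])
    ultimately show ?thesis using has_derivative_unique by metis
  qed
  \<comment> \<open>Both sides are the second derivative of \<open>L\<close> in the directions
    \<open>(a, 0)\<close> and \<open>(0, b)\<close>, taken in the two orders.\<close>
  have cross: "a \<bullet> gx' z (0, b) = b \<bullet> gl' z (a, 0)"
    using second_derivative_symmetric[OF L' L'', of z "(0, b)" "(a, 0)"] L''_x[of "(0, b)"] L''_l[of "(a, 0)"]
    by (simp add: inner_commute)
  have "q' (velocity z, V' v) = (2 * (a \<bullet> (Mx x *v ?A')) + a \<bullet> (Mx' x ?A *v a))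
      + (2 * (b \<bullet> (Ml l *v ?B')) + b \<bullet> (Ml' l ?B *v b))"
    unfolding q'_eq
    using symmetric_matrix_inner[OF riemannian_metricD(2)[OF metric_x], of ?A' x a]
      symmetric_matrix_inner[OF riemannian_metricD(2)[OF metric_l], of ?B' l b]
    by (simp add: inner_add_right)
  then show ?thesis unfolding hx hl using cross by (simp add: z v inner_minus_right)
qed

end

section \<open>The product metric: its quadratic form and its completeness\<close>

context primal_dual begin

text \<open>A locale parameter has to be a term, so the derivative is named by
  \<open>frechet_derivative\<close>; uniqueness identifies it with the continuous witness from
  \<open>C1_map_q\<close>.\<close>

sublocale quadratic: quadratic_form_field q "\<lambda>w. Blinfun (frechet_derivative (\<lambda>(z, v). q z v) (at w))"
proof
  obtain q' where q': "\<And>w. ((\<lambda>(z, v). q z v) has_derivative blinfun_apply (q' w)) (at w)" "continuous_on UNIV q'"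
    using C1_map_q by (rule C1_mapE) blast
  have eq: "Blinfun (frechet_derivative (\<lambda>(z, v). q z v) (at w)) = q' w" for w
    unfolding frechet_derivative_at[OF q'(1), symmetric] by (rule blinfun_apply_inverse)
  show "((\<lambda>(z, v). q z v) has_derivative blinfun_apply (Blinfun (frechet_derivative (\<lambda>(z, v). q z v) (at w)))) (at w)" for w
    unfolding eq by (rule q'(1))
  show "continuous_on UNIV (\<lambda>w. Blinfun (frechet_derivative (\<lambda>(z, v). q z v) (at w)))"
    unfolding eq by (rule q'(2))
qed (simp_all add: q_pos q_scale)

end

text \<open>\<open>h\<close> will be one of the two projections of the product: the projected curve
  competes in the infimum for \<open>riem_dist\<close>, and its speed is dominated by
  \<open>S\<close>.\<close>

lemma riem_dist_le_len:
  fixes M :: "real ^ 'n \<Rightarrow> real ^ 'n ^ 'n" and h :: "'a::euclidean_space \<Rightarrow> real ^ 'n"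
  assumes M: "riemannian_metric M" and h: "bounded_linear h"
    and g: "C1_curve 0 1 g g'" and S: "(\<lambda>t. S t) integrable_on {0..1}"
    and le: "\<And>t. t \<in> {0..1} \<Longrightarrow> sqrt (h (g' t) \<bullet> (M (h (g t)) *v h (g' t))) \<le> S t"
  shows "riem_dist M (h (g 0)) (h (g 1)) \<le> integral {0..1} S"
proof -
  let ?\<gamma> = "\<lambda>t. h (g t)"
  have d: "(?\<gamma> has_vector_derivative h (g' t)) (at t)" if "t \<in> {0..1}" for t
    using bounded_linear.has_vector_derivative[OF h C1_curve_deriv[OF g, of t]] that by simp
  have c: "continuous_on {0..1} (\<lambda>t. h (g' t))"
    by (rule bounded_linear.continuous_on[OF h C1_curve_cont_deriv[OF g]])
  have "?\<gamma> C1_differentiable_on {0..1}"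
    unfolding C1_differentiable_on_def by (rule exI[of _ "\<lambda>t. h (g' t)"]) (simp add: d c)
  then have "riem_dist M (h (g 0)) (h (g 1)) \<le> riem_length M ?\<gamma>"
    unfolding riem_dist_def
  proof (intro cINF_lower)
    show "bdd_below (riem_length M ` {\<gamma>. \<gamma> C1_differentiable_on {0..1} \<and> \<gamma> 0 = h (g 0) \<and> \<gamma> 1 = h (g 1)})"
    proof (rule bdd_belowI2[of _ 0])
      fix \<gamma>
      let ?s = "\<lambda>t. sqrt (vector_derivative \<gamma> (at t) \<bullet> (M (\<gamma> t) *v vector_derivative \<gamma> (at t)))"
      \<comment> \<open>For an arbitrary \<open>\<gamma>\<close> the speed need not be integrable;
        \<open>integral\<close> is then 0 by convention and the bound still holds.\<close>
      show "0 \<le> riem_length M \<gamma>"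
        unfolding riem_length_def
        by (cases "?s integrable_on {0..1}")
          (auto intro!: integral_nonneg simp: riemannian_metricD(4)[OF M] not_integrable_integral)
    qed
  qed auto
  also have "riem_length M ?\<gamma> = integral {0..1} (\<lambda>t. sqrt (h (g' t) \<bullet> (M (h (g t)) *v h (g' t))))"
    unfolding riem_length_def by (rule integral_cong) (simp add: vector_derivative_at[OF d])
  also have "\<dots> \<le> integral {0..1} S"
  proof (rule integral_le[OF integrable_continuous_real S le])
    have cg: "continuous_on {0..1} ?\<gamma>" by (rule bounded_linear.continuous_on[OF h C1_curve_cont[OF g]])
    have "continuous_on {0..1} (\<lambda>t. M (h (g t)))"
      by (rule continuous_on_compose2[OF C1_map_continuous[OF riemannian_metricD(1)[OF M]] cg]) simp
    then show "continuous_on {0..1} (\<lambda>t. sqrt (h (g' t) \<bullet> (M (h (g t)) *v h (g' t))))"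
      by (intro continuous_on_real_sqrt continuous_on_inner c
          bounded_bilinear.continuous_on[OF bounded_bilinear_matrix_vector_mult])
  qed
  finally show ?thesis .
qed

lemma complete_metricD:
  assumes "complete_metric M" "\<forall>e>0. \<exists>N. \<forall>i\<ge>N. \<forall>j\<ge>N. riem_dist M (X i) (X j) < e"
  shows "convergent X"
  using assms unfolding complete_metric_def by blast

context primal_dual begin

text \<open>Each factor contributes a nonnegative summand to \<open>q\<close>, so projecting a curve
  does not lengthen it. Cauchy sequences for the product distance are therefore Cauchy in both
  factors, and completeness passes to the product.\<close>

lemma riem_dist_le_dst:
  "riem_dist Mx (fst z) (fst z') \<le> quadratic.dst z z'" "riem_dist Ml (snd z) (snd z') \<le> quadratic.dst z z'"
proof -
  have *: "riem_dist Mx (fst z) (fst z') \<le> quadratic.len 0 1 g g' \<and> riem_dist Ml (snd z) (snd z') \<le> quadratic.len 0 1 g g'"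
    if g: "C1_curve 0 1 g g'" "g 0 = z" "g 1 = z'" for g g'
  proof
    note S = quadratic.speed_integrable[OF g(1)]
    have "sqrt (fst (g' t) \<bullet> (Mx (fst (g t)) *v fst (g' t))) \<le> sqrt (q (g t) (g' t))"
      "sqrt (snd (g' t) \<bullet> (Ml (snd (g t)) *v snd (g' t))) \<le> sqrt (q (g t) (g' t))" for t
      by (simp_all add: q_def riemannian_metricD(4)[OF metric_x] riemannian_metricD(4)[OF metric_l])
    then show "riem_dist Mx (fst z) (fst z') \<le> quadratic.len 0 1 g g'" "riem_dist Ml (snd z) (snd z') \<le> quadratic.len 0 1 g g'"
      unfolding quadratic.len_def g(2)[symmetric] g(3)[symmetric]
      by (auto intro!: riem_dist_le_len[OF metric_x bounded_linear_fst g(1) S] riem_dist_le_len[OF metric_l bounded_linear_snd g(1) S])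
  qed
  show "riem_dist Mx (fst z) (fst z') \<le> quadratic.dst z z'" "riem_dist Ml (snd z) (snd z') \<le> quadratic.dst z z'"
    unfolding quadratic.dst_def
    by (rule cInf_greatest[OF quadratic.dst_nonempty], use * in blast)+
qed

end

section \<open>The contraction property of the dynamics and the convergence theorem\<close>

locale convex_concave_primal_dual = primal_dual L Mx Ml
  for L :: "real ^ 'n \<Rightarrow> real ^ 'm \<Rightarrow> real" and Mx Ml +
  fixes \<alpha> :: real
  assumes complete_x: "complete_metric Mx" and complete_l: "complete_metric Ml"
    and strongly_convex: "\<And>l. geod_strongly_convex \<alpha> Mx (\<lambda>x. L x l)"
    and concave: "\<And>x. geod_concave Ml (\<lambda>l. L x l)"
begin

sublocale contracting: contracting_field q "\<lambda>w. Blinfun (frechet_derivative (\<lambda>(z, v). q z v) (at w))"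
  velocity "\<lambda>z. Blinfun (frechet_derivative velocity (at z))" p \<alpha>
proof
  obtain V' where V': "\<And>z. (velocity has_derivative blinfun_apply (V' z)) (at z)" "continuous_on UNIV V'"
    using C1_map_velocity by (rule C1_mapE) blast
  have eq: "Blinfun (frechet_derivative velocity (at z)) = V' z" for z
    unfolding frechet_derivative_at[OF V'(1), symmetric] by (rule blinfun_apply_inverse)
  show "(velocity has_derivative blinfun_apply (Blinfun (frechet_derivative velocity (at z)))) (at z)" for z
    unfolding eq by (rule V'(1))
  show "continuous_on UNIV (\<lambda>z. Blinfun (frechet_derivative velocity (at z)))"
    unfolding eq by (rule V'(2))
  show "0 < \<alpha>" using strongly_convex by (simp add: geod_strongly_convex_def)
  show "p z (c *\<^sub>R v) = \<bar>c\<bar> * p z v" for z c v by (rule p_scale)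
  show "continuous_on UNIV (\<lambda>(z, v). p z v)"
  proof -
    \<comment> \<open>\<open>p z v\<close> is the norm of \<open>(fst v, 0)\<close> at
      \<open>z\<close>, so its continuity is that of \<open>q\<close> along a continuous
      map.\<close>
    let ?h = "\<lambda>w :: ((real ^ 'n) \<times> (real ^ 'm)) \<times> ((real ^ 'n) \<times> (real ^ 'm)). (fst w, (fst (snd w), 0 :: real ^ 'm))"
    have "continuous_on UNIV ?h" by (intro continuous_intros)
    from continuous_on_real_sqrt[OF continuous_on_compose2[OF quadratic.q_cont this]]
    show ?thesis by (simp add: p_def q_def case_prod_unfold)
  qed
  show "blinfun_apply (Blinfun (frechet_derivative (\<lambda>(z, v). q z v) (at (z, v))))
      (velocity z, blinfun_apply (Blinfun (frechet_derivative velocity (at z))) v) \<le> - 2 * \<alpha> * (p z v)\<^sup>2" for z v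
  proof -
    have "0 \<le> fst v \<bullet> ((riem_hessian Mx (\<lambda>x. L x (snd z)) (fst z) - \<alpha> *\<^sub>R Mx (fst z)) *v fst v)"
      using strongly_convex by (simp add: geod_strongly_convex_def loewner_ge_def)
    then have "\<alpha> * (p z v)\<^sup>2 \<le> fst v \<bullet> (riem_hessian Mx (\<lambda>x. L x (snd z)) (fst z) *v fst v)"
      unfolding p_square
      by (simp add: matrix_vector_mult_diff_rdistrib inner_diff_right scaleR_matrix_vector_assoc[symmetric])
    moreover have "0 \<le> snd v \<bullet> (riem_hessian Ml (\<lambda>l. - L (fst z) l) (snd z) *v snd v)"
      using concave[of "fst z"] by (simp add: geod_concave_def geod_convex_def loewner_ge_def)
    ultimately show ?thesis
      unfolding eq using q_derivative_along_velocity[OF quadratic.q_deriv V'(1)] by simp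
  qed
  fix X :: "nat \<Rightarrow> (real ^ 'n) \<times> (real ^ 'm)"
  assume C: "\<forall>e>0. \<exists>N. \<forall>i\<ge>N. \<forall>j\<ge>N. quadratic.dst (X i) (X j) < e"
  have "convergent (\<lambda>i. fst (X i))"
    by (rule complete_metricD[OF complete_x]) (meson C riem_dist_le_dst(1) order_le_less_trans)
  moreover have "convergent (\<lambda>i. snd (X i))"
    by (rule complete_metricD[OF complete_l]) (meson C riem_dist_le_dst(2) order_le_less_trans)
  ultimately obtain a b where "(\<lambda>i. fst (X i)) \<longlonglongrightarrow> a" "(\<lambda>i. snd (X i)) \<longlonglongrightarrow> b"
    by (auto simp: convergent_def)
  then have "(\<lambda>i. (fst (X i), snd (X i))) \<longlonglongrightarrow> (a, b)" by (rule tendsto_Pair)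
  then show "convergent X" by (auto simp: convergent_def)
qed

lemma primal_dual_solution_iff_solution_from:
  "primal_dual_solution L Mx Ml x l \<and> x 0 = x0 \<and> l 0 = l0
    \<longleftrightarrow> contracting.solution_from (x0, l0) (\<lambda>t. (x t, l t))"
  unfolding primal_dual_solution_iff contracting.solution_from_def by auto

lemma primal_dual_equilibrium_iff: "primal_dual_equilibrium L Mx Ml x l \<longleftrightarrow> velocity (x, l) = 0"
  unfolding primal_dual_equilibrium_def primal_dual_velocity_iff by (auto simp: zero_prod_def)

lemma equilibrium_in_closure:
  assumes "contracting.solution_from z w" "bounded (w ` {0..})"
  shows "\<exists>e\<in>closure (w ` {0..}). velocity e = 0"
proof -
  obtain L' L'' where L': "\<And>z. ((\<lambda>(x, l). L x l) has_derivative blinfun_apply (L' z)) (at z)"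
    by (rule L_derivatives) blast
  show ?thesis
    by (rule contracting.equilibrium_in_closure_of_bounded_solution[OF L' L_derivative_along_velocity[OF L'] assms])
qed

lemma equilibria_same_primal:
  assumes "velocity e1 = 0" "velocity e2 = 0"
  shows "fst e1 = fst e2"
proof (rule contracting.equilibria_agree[OF assms bounded_linear_fst])
  fix K :: "((real ^ 'n) \<times> (real ^ 'm)) set"
  assume "compact K"
  then obtain c where c: "0 < c" "\<And>z v. z \<in> K \<Longrightarrow> c * norm v \<le> sqrt (q z v)"
    using quadratic.N_equivalent by metis
  have "c * norm (fst v) \<le> p z v" if "z \<in> K" for z v
    \<comment> \<open>The comparison of norms is evaluated at \<open>(fst v, 0)\<close>, where the
      square root of \<open>q\<close> is \<open>p\<close>.\<close>
    using c(2)[OF that, of "(fst v, 0)"] by (simp add: q_def p_def norm_Pair)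
  then show "\<exists>\<kappa>>0. \<forall>z\<in>K. \<forall>v. \<kappa> * norm (fst v) \<le> p z v" using c(1) by blast
qed

end

theorem proposition10:
  fixes L :: "real ^ 'n::finite \<Rightarrow> real ^ 'm::finite \<Rightarrow> real"
    and Mx :: "real ^ 'n \<Rightarrow> real ^ 'n ^ 'n"
    and Ml :: "real ^ 'm \<Rightarrow> real ^ 'm ^ 'm"
  assumes "C2_map (\<lambda>(x, l). L x l)"
    and "riemannian_metric Mx" and "riemannian_metric Ml"
    and "complete_metric Mx" and "complete_metric Ml"
    and "\<exists>\<alpha>. \<forall>l. geod_strongly_convex \<alpha> Mx (\<lambda>x. L x l)"
    and "\<forall>x. geod_concave Ml (\<lambda>l. L x l)"
    and "\<exists>x l. primal_dual_solution L Mx Ml x l \<and> bounded (x ` {0..}) \<and> bounded (l ` {0..})"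
  shows "\<exists>xs. \<forall>x0 l0. \<exists>ls.
           primal_dual_equilibrium L Mx Ml xs ls \<and>
           (\<exists>x l. primal_dual_solution L Mx Ml x l \<and> x 0 = x0 \<and> l 0 = l0) \<and>
           (\<forall>x l. primal_dual_solution L Mx Ml x l \<and> x 0 = x0 \<and> l 0 = l0 \<longrightarrow>
              (x \<longlongrightarrow> xs) at_top \<and> (l \<longlongrightarrow> ls) at_top)"
proof -
  obtain \<alpha> where \<alpha>: "\<And>l. geod_strongly_convex \<alpha> Mx (\<lambda>x. L x l)" using assms(6) by blast
  interpret convex_concave_primal_dual L Mx Ml \<alpha>
    by unfold_locales (use assms \<alpha> in auto)
  obtain x l where xl: "primal_dual_solution L Mx Ml x l" "bounded (x ` {0..})" "bounded (l ` {0..})"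
    using assms(8) by blast
  have "contracting.solution_from (x 0, l 0) (\<lambda>t. (x t, l t))"
    using xl(1) by (simp flip: primal_dual_solution_iff_solution_from)
  moreover have "bounded ((\<lambda>t. (x t, l t)) ` {0..})"
    by (rule bounded_subset[OF bounded_Times[OF xl(2,3)]]) auto
  ultimately obtain e where e: "velocity e = 0" using equilibrium_in_closure by blast
  \<comment> \<open>The primal part \<open>fst e\<close> is chosen before the initial value
    \<open>z\<close>; only the dual part \<open>ls\<close> may depend on it.\<close>
  have "\<exists>ls. velocity (fst e, ls) = 0 \<and> (\<exists>w. contracting.solution_from z w) \<and>
      (\<forall>w. contracting.solution_from z w \<longrightarrow> (w \<longlongrightarrow> (fst e, ls)) at_top)" for z
  proof -
    obtain w where w: "contracting.solution_from z w"
      using contracting.solution_exists_if_equilibrium[OF e] by blast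
    obtain e' where "e' \<in> closure (w ` {0..})" and e': "velocity e' = 0"
      using equilibrium_in_closure[OF w contracting.bounded_solution_if_equilibrium[OF e w]] by blast
    then have lim: "(w \<longlongrightarrow> e') at_top" using contracting.solution_tendsto_equilibrium[OF _ w] by blast
    \<comment> \<open>Solutions with the same initial value agree at nonnegative times, so the limit
      of \<open>w\<close> is the limit of every \<open>u\<close>.\<close>
    have "(u \<longlongrightarrow> e') at_top" if u: "contracting.solution_from z u" for u
    proof (rule Lim_transform_eventually[OF lim])
      show "\<forall>\<^sub>F t in at_top. w t = u t"
        using contracting.solution_unique[OF e w u] by (auto simp: eventually_at_top_linorder)
    qed
    moreover have "e' = (fst e, snd e')" using equilibria_same_primal[OF e e'] by (simp add: prod_eq_iff)
    ultimately show ?thesis using e' w by metis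
  qed
  then obtain ls where ls: "\<And>z. velocity (fst e, ls z) = 0" "\<And>z. \<exists>w. contracting.solution_from z w"
    "\<And>z w. contracting.solution_from z w \<Longrightarrow> (w \<longlongrightarrow> (fst e, ls z)) at_top" by metis
  show ?thesis
    unfolding primal_dual_solution_iff_solution_from primal_dual_equilibrium_iff
  proof (rule exI[of _ "fst e"], intro allI)
    fix x0 :: "real ^ 'n" and l0 :: "real ^ 'm"
    let ?ls = "ls (x0, l0)"
    obtain w where "contracting.solution_from (x0, l0) w" using ls(2) by blast
    then have "contracting.solution_from (x0, l0) (\<lambda>t. (fst (w t), snd (w t)))" by simp
    then have ex: "\<exists>x l. contracting.solution_from (x0, l0) (\<lambda>t. (x t, l t))" by (intro exI)
    have lim: "(x \<longlongrightarrow> fst e) at_top" "(l \<longlongrightarrow> ?ls) at_top"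
      if "contracting.solution_from (x0, l0) (\<lambda>t. (x t, l t))" for x l
      using tendsto_fst[OF ls(3)[OF that]] tendsto_snd[OF ls(3)[OF that]] by simp_all
    show "\<exists>ls. velocity (fst e, ls) = 0 \<and>
        (\<exists>x l. contracting.solution_from (x0, l0) (\<lambda>t. (x t, l t))) \<and>
        (\<forall>x l. contracting.solution_from (x0, l0) (\<lambda>t. (x t, l t)) \<longrightarrow>
          (x \<longlongrightarrow> fst e) at_top \<and> (l \<longlongrightarrow> ls) at_top)"
      by (intro exI[of _ ?ls] conjI ls(1) ex allI impI) (fact lim)+
  qed
qed

end
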